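(* Let $n$ be a positive integer and $\lambda=(\lambda_1\ge\lambda_2\ge\cdots\ge\lambda_p)$ a partition with positive parts and $\lambda_1\le n$. For $i=1,2,\dots,p$ set $$\mathbf{C}_{\lambda_i}(i-1)=\sum_{j=0}^{\lambda_i}(-1)^{\lambda_i-j}(i-1)_{\lambda_i-j}\ \mathbf{H}_{\lambda_i}^{(j)} .$$ Then: 1. the element $\mathbf{C}_{\lambda_i}(i-1)$ is central in the enveloping algebra $\mathbf{U}(gl(\lambda_i))$, for $i=1,2,\dots,p$; 2. the Capelli-Deruyts bitableau $\mathbf{K}^\lambda\in\mathbf{U}(gl(n))$ equals the polynomial in the Capelli elements $\mathbf{H}_{\lambda_i}^{(j)}$ $$\mathbf{K}^\lambda=(-1)^{\lambda_p(\lambda_{p-1}+\cdots+\lambda_1)+\cdots+\lambda_2\lambda_1}\ \mathbf{C}_{\lambda_p}(p-1)\cdots\mathbf{C}_{\lambda_2}(1)\ \mathbf{C}_{\lambda_1}(0).$$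
   Context: $(q)_k=q(q-1)\cdots(q-k+1)$ is the falling factorial. The sign exponent is $\sum_{1\le i<j\le p}\lambda_i\lambda_j$. For $1\le k\le n$, $\mathbf{U}(gl(k))\subseteq\mathbf{U}(gl(n))$ is the subalgebra generated by $e_{i,j}$, $1\le i,j\le k$. The Capelli elements are $\mathbf{H}_k^{(0)}=\mathbf{1}$ and, for $1\le j\le k$, $\mathbf{H}_k^{(j)}=\sum_{1\le i_1<\cdots<i_j\le k}\mathbf{cdet}\big[e_{i_r,i_s}+\delta_{rs}(j-r)\big]_{r,s=1,\dots,j}\in\mathbf{U}(gl(k))$, where $\mathbf{cdet}[a_{rs}]=\sum_\sigma(-1)^{|\sigma|}a_{\sigma(1),1}a_{\sigma(2),2}\cdots a_{\sigma(j),j}$ is the column determinant. Capelli bitableaux. Let $\mathcal{A}_0=\{\alpha_1,\dots,\alpha_{m}\}$ ($m$ sufficiently large) be a set of virtual symbols, with $|\alpha_s|=0\in\mathbb{Z}_2$, and $\mathcal{L}=\{1,\dots,n\}$ the proper symbols, with $|i|=1\in\mathbb{Z}_2$. Let $gl(m|n)$ be the complex Lie superalgebra with basis $e_{a,b}$, $a,b\in\mathcal{A}_0\cup\mathcal{L}$, of parity $|a|+|b|$, and superbracket $[e_{a,b},e_{c,d}]=\delta_{bc}e_{a,d}-(-1)^{(|a|+|b|)(|c|+|d|)}\delta_{ad}e_{c,b}$. The enveloping algebra $\mathbf{U}(gl(n))$ is the subalgebra of $\mathbf{U}(gl(m|n))$ generated by the $e_{i,j}$, $i,j\in\mathcal{L}$.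 A product $e_{a_r,b_r}\cdots e_{a_1,b_1}$ is irregular if there are $i\le r$ and $\gamma\in\mathcal{A}_0$ with $\#\{j\le i: b_j=\gamma\}>\#\{j<i: a_j=\gamma\}$. Let $\mathbf{Irr}$ be the left ideal of $\mathbf{U}(gl(m|n))$ generated by the irregular products. It is known that $\mathbf{U}(gl(n))\cap\mathbf{Irr}=0$, that $Virt(m,n)=\mathbf{U}(gl(n))\oplus\mathbf{Irr}$ is a subalgebra, and that $\mathbf{Irr}$ is a two-sided ideal of it; the Capelli devirtualization epimorphism $\mathfrak{p}:Virt(m,n)\to\mathbf{U}(gl(n))$ is the projection with kernel $\mathbf{Irr}$. For Young tableaux $S=(s_{ij})$, $T=(t_{ij})$ of the same shape $\lambda=(\lambda_1\ge\dots\ge\lambda_p)$ with entries in $\mathcal{L}$, the Capelli bitableau is $$[S|T]=\mathfrak{p}\Big(\prod_{i=1}^{p}\big(e_{s_{i1},\alpha_i}e_{s_{i2},\alpha_i}\cdots e_{s_{i\lambda_i},\alpha_i}\big)\cdot\prod_{i=1}^{p}\big(e_{\alpha_i,t_{i1}}e_{\alpha_i,t_{i2}}\cdots e_{\alpha_i,t_{i\lambda_i}}\big)\Big),$$ with products ordered from left to right by increasing $i$ and $\alpha_1,\dots,\alpha_p$ distinct virtual symbols (the argument lies in $Virt(m,n)$ and the result does not depend on the choice of the $\alpha_i$). The Capelli-Deruyts bitableau $\mathbf{K}^\lambda$ is $[S|T]$ where the $i$-th row of $S$ is $\lambda_i\ \cdots\ 2\ 1$ and the $i$-th row of $T$ is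 $1\ 2\ \cdots\ \lambda_i$, $i=1,\dots,p$. *)

theory Defs
  imports
    "HOL-Analysis.Analysis"
    "HOL-Library.Poly_Mapping"
    "HOL-Combinatorics.Permutations"
begin

section \<open>Generated ideals, subalgebras, centre\<close>

inductive_set two_sided_ideal :: "'a::ring_1 set \<Rightarrow> 'a set" for X where
  zero: "0 \<in> two_sided_ideal X"
| step: "r \<in> X \<Longrightarrow> y \<in> two_sided_ideal X \<Longrightarrow> u * r * v + y \<in> two_sided_ideal X"

inductive_set left_ideal :: "'a::ring_1 set \<Rightarrow> 'a set" for X where
  zero: "0 \<in> left_ideal X"
| step: "r \<in> X \<Longrightarrow> y \<in> left_ideal X \<Longrightarrow> u * r + y \<in> left_ideal X"

lemma two_sided_ideal_add:
  assumes "x \<in> two_sided_ideal X" "y \<in> two_sided_ideal X"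
  shows "x + y \<in> two_sided_ideal X"
  using assms by induction (auto simp: add.assoc intro: two_sided_ideal.step)

lemma two_sided_ideal_mult_left:
  assumes "x \<in> two_sided_ideal X"
  shows "w * x \<in> two_sided_ideal X"
  using assms
proof induction
  case (step r y u v)
  then show ?case
    using two_sided_ideal.step[of r X "w * y" "w * u" v] by (simp add: algebra_simps)
qed (auto intro: two_sided_ideal.zero)

lemma two_sided_ideal_mult_right:
  assumes "x \<in> two_sided_ideal X"
  shows "x * w \<in> two_sided_ideal X"
  using assms
proof induction
  case (step r y u v)
  then show ?case
    using two_sided_ideal.step[of r X "y * w" u "v * w"] by (simp add: algebra_simps)
qed (auto intro: two_sided_ideal.zero)

lemma two_sided_ideal_uminus:
  assumes "x \<in> two_sided_ideal X"
  shows "- x \<in> two_sided_ideal X"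
  using two_sided_ideal_mult_left[OF assms, of "- 1"] by simp


section \<open>The free associative algebra over the complex numbers\<close>

text \<open>Words are wrapped in a datatype of their own, so that no arithmetic class is
  instantiated for lists; the \<open>+\<close> of words is concatenation, as required by the
  convolution product of \<open>HOL-Library.Poly_Mapping\<close>.\<close>

datatype 'g free_word = Free_Word (letters: "'g list")

instantiation free_word :: (type) monoid_add
begin

definition zero_free_word :: "'a free_word" where
  "0 = Free_Word []"

definition plus_free_word :: "'a free_word \<Rightarrow> 'a free_word \<Rightarrow> 'a free_word" where
  "v + w = Free_Word (letters v @ letters w)"

instance
  by standard (auto simp: zero_free_word_def plus_free_word_def)

end

lemma free_word_add_eq_zero_iff: "0 = v + w \<longleftrightarrow> v = 0 \<and> w = (0 :: 'g free_word)"
  by (cases v; cases w) (auto simp: zero_free_word_def plus_free_word_def)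

type_synonym 'g free_alg = "'g free_word \<Rightarrow>\<^sub>0 complex"

definition free_gen :: "'g \<Rightarrow> 'g free_alg" where
  "free_gen g = Poly_Mapping.single (Free_Word [g]) 1"

lemma lookup_mult_zero:
  "Poly_Mapping.lookup (f * g) 0 = Poly_Mapping.lookup f 0 * Poly_Mapping.lookup g 0"
  for f g :: "'g free_alg"
proof -
  have "(\<Sum>q. Poly_Mapping.lookup g q when (0::'g free_word) = l + q) =
          (Poly_Mapping.lookup g 0 when l = 0)" for l
    by (cases "l = 0") (auto simp: free_word_add_eq_zero_iff)
  then show ?thesis
    by (simp add: lookup_mult mult_when)
qed


section \<open>The enveloping algebra of \<open>gl(m|n)\<close>\<close>

text \<open>The symbol sets are types: \<open>m\<close> and \<open>n\<close> are the cardinalities of the (finite) types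
  \<open>'m\<close> of virtual symbols and \<open>'n\<close> of proper symbols.\<close>

datatype ('m, 'n) symbol = Virtual 'm | Proper 'n

fun parity :: "('m, 'n) symbol \<Rightarrow> nat" where
  "parity (Virtual _) = 0"
| "parity (Proper _) = 1"

type_synonym ('m, 'n) gl_index = "('m, 'n) symbol \<times> ('m, 'n) symbol"

definition super_sign :: "('m, 'n) gl_index \<Rightarrow> ('m, 'n) gl_index \<Rightarrow> complex" where
  "super_sign x y = (-1) ^ ((parity (fst x) + parity (snd x)) * (parity (fst y) + parity (snd y)))"

text \<open>The superbracket of two basis elements of \<open>gl(m|n)\<close>, as a linear combination of
  generators of the free algebra on the basis.\<close>

fun superbracket :: "('m, 'n) gl_index \<Rightarrow> ('m, 'n) gl_index \<Rightarrow> ('m, 'n) gl_index free_alg" where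
  "superbracket (a, b) (c, d) =
     (if b = c then free_gen (a, d) else 0)
     - Poly_Mapping.single 0 (super_sign (a, b) (c, d)) * (if a = d then free_gen (c, b) else 0)"

definition enveloping_relator ::
    "('m, 'n) gl_index \<Rightarrow> ('m, 'n) gl_index \<Rightarrow> ('m, 'n) gl_index free_alg" where
  "enveloping_relator x y =
     free_gen x * free_gen y
     - Poly_Mapping.single 0 (super_sign x y) * (free_gen y * free_gen x)
     - superbracket x y"

definition enveloping_ideal :: "('m, 'n) gl_index free_alg set" where
  "enveloping_ideal = two_sided_ideal {enveloping_relator x y |x y. True}"

definition enveloping_rel ::
    "('m, 'n) gl_index free_alg \<Rightarrow> ('m, 'n) gl_index free_alg \<Rightarrow> bool" where
  "enveloping_rel f g \<longleftrightarrow> f - g \<in> enveloping_ideal"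

lemma enveloping_rel_eqI: "f = g \<Longrightarrow> enveloping_rel f g"
  by (simp add: enveloping_rel_def enveloping_ideal_def two_sided_ideal.zero)

lemma lookup_free_gen_zero: "Poly_Mapping.lookup (free_gen x) 0 = 0"
  by (simp add: free_gen_def lookup_single zero_free_word_def)

lemma lookup_enveloping_relator_zero: "Poly_Mapping.lookup (enveloping_relator x y) 0 = 0"
proof -
  have "Poly_Mapping.lookup (superbracket x y) 0 = 0"
    by (cases x; cases y) (simp add: lookup_minus lookup_mult_zero lookup_free_gen_zero)
  then show ?thesis
    by (simp add: enveloping_relator_def lookup_minus lookup_mult_zero lookup_free_gen_zero)
qed

lemma lookup_enveloping_ideal_zero:
  assumes "f \<in> enveloping_ideal"
  shows "Poly_Mapping.lookup f 0 = 0"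
  using assms unfolding enveloping_ideal_def
proof induction
  case (step r y u v)
  then have "Poly_Mapping.lookup r 0 = 0"
    using lookup_enveloping_relator_zero by blast
  with step.IH show ?case
    by (simp only: lookup_add lookup_mult_zero) simp
qed simp

lemma equivp_enveloping_rel:
  "equivp (enveloping_rel :: ('a, 'b) gl_index free_alg \<Rightarrow> _)"
proof (rule equivpI)
  show "reflp (enveloping_rel :: ('a, 'b) gl_index free_alg \<Rightarrow> _)"
    by (simp add: reflp_def enveloping_rel_eqI)
  show "symp (enveloping_rel :: ('a, 'b) gl_index free_alg \<Rightarrow> _)"
  proof (rule sympI)
    fix x y :: "('a, 'b) gl_index free_alg"
    assume "enveloping_rel x y"
    then show "enveloping_rel y x"
      using two_sided_ideal_uminus[of "x - y"]
      by (simp add: enveloping_rel_def enveloping_ideal_def)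
  qed
  show "transp (enveloping_rel :: ('a, 'b) gl_index free_alg \<Rightarrow> _)"
  proof (rule transpI)
    fix x y z :: "('a, 'b) gl_index free_alg"
    assume "enveloping_rel x y" "enveloping_rel y z"
    then show "enveloping_rel x z"
      using two_sided_ideal_add[of "x - y" _ "y - z"]
      by (simp add: enveloping_rel_def enveloping_ideal_def)
  qed
qed

quotient_type ('m, 'n) Ugl = "('m, 'n) gl_index free_alg" / enveloping_rel
  by (rule equivp_enveloping_rel)

instantiation Ugl :: (type, type) ring_1
begin

lift_definition zero_Ugl :: "('a, 'b) Ugl" is 0 .

lift_definition one_Ugl :: "('a, 'b) Ugl" is 1 .

lift_definition plus_Ugl :: "('a, 'b) Ugl \<Rightarrow> ('a, 'b) Ugl \<Rightarrow> ('a, 'b) Ugl" is "(+)"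
proof -
  fix x x' y y' :: "('a, 'b) gl_index free_alg"
  assume "enveloping_rel x x'" "enveloping_rel y y'"
  then show "enveloping_rel (x + y) (x' + y')"
    using two_sided_ideal_add[of "x - x'" _ "y - y'"]
    by (simp add: enveloping_rel_def enveloping_ideal_def algebra_simps)
qed

lift_definition uminus_Ugl :: "('a, 'b) Ugl \<Rightarrow> ('a, 'b) Ugl" is uminus
proof -
  fix x x' :: "('a, 'b) gl_index free_alg"
  assume "enveloping_rel x x'"
  then show "enveloping_rel (- x) (- x')"
    using two_sided_ideal_uminus[of "x - x'"]
    by (simp add: enveloping_rel_def enveloping_ideal_def)
qed

lift_definition minus_Ugl :: "('a, 'b) Ugl \<Rightarrow> ('a, 'b) Ugl \<Rightarrow> ('a, 'b) Ugl" is "(-)"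
proof -
  fix x x' y y' :: "('a, 'b) gl_index free_alg"
  assume "enveloping_rel x x'" "enveloping_rel y y'"
  then show "enveloping_rel (x - y) (x' - y')"
    using two_sided_ideal_add[of "x - x'" _ "- (y - y')"] two_sided_ideal_uminus[of "y - y'"]
    by (simp add: enveloping_rel_def enveloping_ideal_def algebra_simps)
qed

lift_definition times_Ugl :: "('a, 'b) Ugl \<Rightarrow> ('a, 'b) Ugl \<Rightarrow> ('a, 'b) Ugl" is "(*)"
proof -
  fix x x' y y' :: "('a, 'b) gl_index free_alg"
  assume *: "enveloping_rel x x'" "enveloping_rel y y'"
  have "x * y - x' * y' = (x - x') * y + x' * (y - y')"
    by (simp add: algebra_simps)
  with * show "enveloping_rel (x * y) (x' * y')"
    by (simp add: enveloping_rel_def enveloping_ideal_def two_sided_ideal_add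
        two_sided_ideal_mult_left two_sided_ideal_mult_right)
qed

instance
proof
  have "\<not> enveloping_rel 0 (1 :: ('a, 'b) gl_index free_alg)"
    using lookup_enveloping_ideal_zero[of "0 - 1 :: ('a, 'b) gl_index free_alg"]
    by (auto simp: enveloping_rel_def lookup_minus lookup_one)
  then show "(0 :: ('a, 'b) Ugl) \<noteq> 1"
    by transfer
qed (transfer, rule enveloping_rel_eqI,
      rule mult.assoc mult_1_left mult_1_right add.assoc add.commute add_0_left
        left_minus diff_conv_add_uminus distrib_left distrib_right)+

end

lift_definition cscale :: "complex \<Rightarrow> ('m, 'n) Ugl \<Rightarrow> ('m, 'n) Ugl"
  is "\<lambda>c f. Poly_Mapping.single 0 c * f"
proof -
  fix c :: complex and x x' :: "('m, 'n) gl_index free_alg"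
  assume "enveloping_rel x x'"
  then show "enveloping_rel (Poly_Mapping.single 0 c * x) (Poly_Mapping.single 0 c * x')"
    using two_sided_ideal_mult_left[of "x - x'" _ "Poly_Mapping.single 0 c"]
    by (simp add: enveloping_rel_def enveloping_ideal_def algebra_simps)
qed

lift_definition e :: "('m, 'n) symbol \<Rightarrow> ('m, 'n) symbol \<Rightarrow> ('m, 'n) Ugl"
  is "\<lambda>a b. free_gen (a, b)" .

inductive_set subalgebra :: "('m, 'n) Ugl set \<Rightarrow> ('m, 'n) Ugl set" for X where
  gen: "x \<in> X \<Longrightarrow> x \<in> subalgebra X"
| one: "1 \<in> subalgebra X"
| add: "x \<in> subalgebra X \<Longrightarrow> y \<in> subalgebra X \<Longrightarrow> x + y \<in> subalgebra X"
| mult: "x \<in> subalgebra X \<Longrightarrow> y \<in> subalgebra X \<Longrightarrow> x * y \<in> subalgebra X"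
| scale: "x \<in> subalgebra X \<Longrightarrow> cscale c x \<in> subalgebra X"

definition center :: "'a::ring_1 set \<Rightarrow> 'a set" where
  "center A = {z \<in> A. \<forall>x\<in>A. z * x = x * z}"

definition U_proper :: "('m, 'n) Ugl set" where
  "U_proper = subalgebra {e (Proper s) (Proper t) |s t. True}"

text \<open>From here on a map \<open>\<nu>\<close> numbers the proper symbols: \<open>\<nu> i\<close> is the symbol written \<open>i\<close>.
  When \<open>\<nu>\<close> is a bijection from \<open>{1..n}\<close> onto the type of proper symbols,
  \<open>U_gl \<nu> k\<close> is \<open>U(gl(k))\<close> for \<open>k \<le> n\<close>, and \<open>U_gl \<nu> n = U_proper\<close>.\<close>

definition U_gl :: "(nat \<Rightarrow> 'n) \<Rightarrow> nat \<Rightarrow> ('m, 'n) Ugl set" where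
  "U_gl \<nu> k = subalgebra {e (Proper (\<nu> i)) (Proper (\<nu> j)) |i j. i \<in> {1..k} \<and> j \<in> {1..k}}"

lemma U_gl_eq_U_proper:
  assumes "bij_betw \<nu> {1..n} UNIV"
  shows "U_gl \<nu> n = (U_proper :: ('a, 'b) Ugl set)"
proof -
  have *: "\<exists>i. s = \<nu> i \<and> i \<in> {1..n}" for s
    using assms by (metis UNIV_I bij_betw_imp_surj_on imageE)
  have "{e (Proper (\<nu> i)) (Proper (\<nu> j)) :: ('a, 'b) Ugl |i j. i \<in> {1..n} \<and> j \<in> {1..n}} =
        {e (Proper s) (Proper t) |s t. True}" (is "?A = ?B")
  proof
    show "?B \<subseteq> ?A"
    proof
      fix x assume "x \<in> ?B"
      then obtain s t where "x = e (Proper s) (Proper t)"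
        by blast
      with *[of s] *[of t] show "x \<in> ?A"
        by blast
    qed
  qed blast
  then show ?thesis
    by (simp only: U_gl_def U_proper_def)
qed


section \<open>Capelli elements\<close>

definition cdet :: "nat \<Rightarrow> (nat \<Rightarrow> nat \<Rightarrow> 'a::ring_1) \<Rightarrow> 'a" where
  "cdet j M = (\<Sum>\<sigma> | \<sigma> permutes {1..j}. of_int (sign \<sigma>) * prod_list (map (\<lambda>s. M (\<sigma> s) s) [1..<Suc j]))"

text \<open>The increasing sequences \<open>i\<^sub>1 < \<dots> < i\<^sub>j\<close> in \<open>{1..k}\<close> are the sorted enumerations of
  the \<open>j\<close>-element subsets of \<open>{1..k}\<close>.\<close>

definition capelli_H :: "(nat \<Rightarrow> 'n) \<Rightarrow> nat \<Rightarrow> nat \<Rightarrow> ('m, 'n) Ugl" where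
  "capelli_H \<nu> k j =
     (\<Sum>A | A \<subseteq> {1..k} \<and> card A = j.
        let i = (\<lambda>r. sorted_list_of_set A ! (r - 1))
        in cdet j (\<lambda>r s. e (Proper (\<nu> (i r))) (Proper (\<nu> (i s))) + (if r = s then of_nat (j - r) else 0)))"

lemma capelli_H_0: "capelli_H \<nu> k 0 = 1"
proof -
  have "{A. A \<subseteq> {1..k} \<and> card A = 0} = {{}}"
    by (auto dest: finite_subset)
  then show ?thesis
    by (simp add: capelli_H_def cdet_def)
qed

definition falling :: "int \<Rightarrow> nat \<Rightarrow> int" where
  "falling q k = (\<Prod>l<k. q - int l)"

definition capelli_C :: "(nat \<Rightarrow> 'n) \<Rightarrow> nat \<Rightarrow> int \<Rightarrow> ('m, 'n) Ugl" where
  "capelli_C \<nu> k q = (\<Sum>j=0..k. (-1) ^ (k - j) * of_int (falling q (k - j)) * capelli_H \<nu> k j)"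


section \<open>Capelli bitableaux\<close>

definition e_monomial :: "('m, 'n) gl_index list \<Rightarrow> ('m, 'n) Ugl" where
  "e_monomial w = prod_list (map (\<lambda>(a, b). e a b) w)"

text \<open>The factors of a product are numbered from the right, starting with \<open>0\<close>.\<close>

definition irregular :: "('m, 'n) gl_index list \<Rightarrow> bool" where
  "irregular w \<longleftrightarrow>
     (\<exists>i<length w. \<exists>\<gamma>. card {j. j \<le> i \<and> snd (rev w ! j) = Virtual \<gamma>} >
                       card {j. j < i \<and> fst (rev w ! j) = Virtual \<gamma>})"

definition Irr :: "('m, 'n) Ugl set" where
  "Irr = left_ideal {e_monomial w |w. irregular w}"

text \<open>The projection of \<open>U_proper \<oplus> Irr\<close> onto \<open>U_proper\<close>; outside this direct sum the value
  is irrelevant.\<close>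

definition devirtualization :: "('m, 'n) Ugl \<Rightarrow> ('m, 'n) Ugl" where
  "devirtualization x = (THE u. u \<in> U_proper \<and> x - u \<in> Irr)"

text \<open>Tableaux are lists of rows; row \<open>i\<close>, counted from \<open>0\<close>, is attached to the virtual
  symbol \<open>\<alpha> i\<close>.\<close>

definition capelli_bitableau :: "(nat \<Rightarrow> 'm) \<Rightarrow> 'n list list \<Rightarrow> 'n list list \<Rightarrow> ('m, 'n) Ugl" where
  "capelli_bitableau \<alpha> S T =
     devirtualization
       (prod_list (map (\<lambda>i. prod_list (map (\<lambda>s. e (Proper s) (Virtual (\<alpha> i))) (S ! i))) [0..<length S]) *
        prod_list (map (\<lambda>i. prod_list (map (\<lambda>t. e (Virtual (\<alpha> i)) (Proper t)) (T ! i))) [0..<length T]))"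

definition capelli_deruyts :: "(nat \<Rightarrow> 'n) \<Rightarrow> (nat \<Rightarrow> 'm) \<Rightarrow> nat list \<Rightarrow> ('m, 'n) Ugl" where
  "capelli_deruyts \<nu> \<alpha> lam =
     capelli_bitableau \<alpha>
       (map (\<lambda>k. map \<nu> (rev [1..<Suc k])) lam)
       (map (\<lambda>k. map \<nu> [1..<Suc k]) lam)"

end

theory Submission
  imports Defs
begin

text \<open>
  The projection is well defined because \<open>gl(m|n)\<close> acts on the tensor product of an exterior
  algebra on \<open>m \<cdot> n\<close> generators with \<open>U(gl(m|n))\<close> in such a way that the vacuum is killed
  by \<open>Irr\<close>, while an element \<open>u\<close> of \<open>U(gl(n))\<close> sends the vacuum to \<open>u\<close> itself; so the
  Poincare-Birkhoff-Witt theorem is not needed.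

  Let \<open>A\<^sub>i\<close> and \<open>B\<^sub>i\<close> be the row products of \<open>e\<^bsub>s,\<alpha>\<^sub>i\<^esub>\<close> and \<open>e\<^bsub>\<alpha>\<^sub>i,t\<^esub>\<close>. Modulo \<open>Irr\<close>, and
  with any word free of \<open>\<alpha>\<^sub>p\<close> on the right, \<open>A\<^sub>p B\<^sub>p\<close> is the column determinant \<open>D(0)\<close>, where
  \<open>D(q) = cdet [e\<^bsub>r,s\<^esub> + \<delta>\<^bsub>r,s\<^esub> (\<lambda>\<^sub>p - r - q)]\<close>. Moving \<open>B\<^sub>p\<close> to the left past
  \<open>B\<^sub>1 \<cdots> B\<^bsub>p-1\<^esub>\<close> gives the sign. The
  product \<open>A\<^sub>i\<close> is a top exterior form for \<open>gl(\<lambda>\<^sub>p)\<close>, so \<open>e\<^bsub>r,s\<^esub> A\<^sub>i = A\<^sub>i (e\<^bsub>r,s\<^esub> + \<delta>\<^bsub>r,s\<^esub>)\<close>, and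
  \<open>D(0)\<close> becomes \<open>D(p - 1)\<close> when it is moved to the left past \<open>A\<^sub>1 \<cdots> A\<^bsub>p-1\<^esub>\<close>. Expanding along
  the diagonal shows that \<open>D(q)\<close> is the alternating sum of Capelli elements with falling factorial
  coefficients. Finally, \<open>D(0)\<close> is central because \<open>A\<^sub>p B\<^sub>p\<close> commutes with \<open>gl(\<lambda>\<^sub>p)\<close>, and
  \<open>D(q)\<close> is its image under a shift of the generators.
\<close>

text \<open>\<open>Irr\<close> is only a left ideal: a congruence modulo it survives multiplication
  on the left, not on the right. Hence the statements about one row carry a word free of its virtual
  symbol on the right, and the last row is removed first: its creators can be brought next to its
  annihilators, with the earlier creators as that word and the earlier annihilators harmlessly on
  the left.

  The determinant arises by contracting one column at a time. The innermost pair of row r and column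
  c gives the entry in position (r, c). If r = c it also gives the virtual diagonal generator, which
  counts the k - c creators still on its right; this is the origin of the diagonal constant.
  Contractions with the other rows supply the rest of the expansion along column c. The creator that
  crosses all remaining annihilators leaves more annihilators than creators behind, an irregular
  product.

  For the falling factorials, k - r is read as the number of elements above r in the index set. This
  form makes sense for every principal minor and matches the constants of the Capelli
  elements.\<close>

lemma keys_single_subset: "Poly_Mapping.keys (Poly_Mapping.single k v) \<subseteq> {k}"
  by (auto simp: in_keys_iff lookup_single when_def)

text \<open>In this additive form, claims about linear or bilinear expressions in the free algebra
  reduce to monomials.\<close>

lemma poly_mapping_induct_plus [case_names zero plus]:
  fixes f :: "'k \<Rightarrow>\<^sub>0 'v::comm_monoid_add"
  assumes "P 0" and "\<And>k v f. P f \<Longrightarrow> P (Poly_Mapping.single k v + f)"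
  shows "P f"
proof (induction f rule: update_induct)
  case const
  then show ?case
    using assms(1) by simp
next
  case (update f a b)
  have "Poly_Mapping.update a b f = Poly_Mapping.single a b + f"
    using update.hyps
    by (intro poly_mapping_eqI)
      (auto simp: lookup_add lookup_single update.rep_eq in_keys_iff when_def)
  then show ?case
    using assms(2) update by simp
qed

section \<open>Scalars and the defining relations\<close>

lemma single_zero_commute:
  fixes f :: "'g free_alg"
  shows "Poly_Mapping.single 0 c * f = f * Poly_Mapping.single 0 c"
  by (induction f rule: poly_mapping_induct_plus) (simp_all add: algebra_simps mult_single)

text \<open>Scalars become the central ring elements \<open>cscale c 1\<close>, to which the laws of
  \<open>ring_1\<close> apply.\<close>

lemma cscale_eq_mult: "cscale c x = cscale c 1 * x"
  by transfer (simp add: enveloping_rel_eqI)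

lemma cscale_one_commute: "cscale c 1 * x = x * cscale c 1"
  by transfer (simp add: enveloping_rel_eqI single_zero_commute)

lemma cscale_mult_left: "cscale c x * y = cscale c (x * y)"
  by (metis cscale_eq_mult mult.assoc)

lemma cscale_mult_right: "x * cscale c y = cscale c (x * y)"
  by (metis cscale_eq_mult cscale_one_commute mult.assoc)

lemma cscale_add_scalar: "cscale (c + d) x = cscale c x + cscale d x"
  by transfer (simp add: enveloping_rel_eqI single_add algebra_simps)

lemma cscale_cscale: "cscale (c * d) x = cscale c (cscale d x)"
  by transfer (rule enveloping_rel_eqI, simp add: mult_single flip: mult.assoc)

lemma cscale_one [simp]: "cscale 1 x = x"
  by transfer (simp add: enveloping_rel_eqI)

lemma cscale_zero [simp]: "cscale c 0 = 0"
  by (metis cscale_eq_mult mult_zero_right)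

lemma cscale_minus_one [simp]: "cscale (- 1) x = - x"
proof -
  have "cscale 0 x = 0"
    using cscale_add_scalar[of 0 0 x] by simp
  then show ?thesis
    using cscale_add_scalar[of "- 1" 1 x] by (simp add: eq_neg_iff_add_eq_0)
qed

lemma super_sign_cases:
  "super_sign (a, b) (c, d) =
     (if odd (parity a + parity b) \<and> odd (parity c + parity d) then - 1 else 1)"
  by (simp add: super_sign_def minus_one_power_iff)

lemma e_superbracket:
  "e a b * e c d - cscale (super_sign (a, b) (c, d)) (e c d * e a b) =
     (if b = c then e a d else 0)
     - cscale (super_sign (a, b) (c, d)) (if a = d then e c b else 0)"
proof -
  have "enveloping_relator (a, b) (c, d) \<in> enveloping_ideal"
    unfolding enveloping_ideal_def
    using two_sided_ideal.step[OF _ two_sided_ideal.zero, of "enveloping_relator (a, b) (c, d)"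
      "{enveloping_relator x y |x y. True}" 1 1] by simp blast
  then have *: "enveloping_rel (free_gen (a, b) * free_gen (c, d)
      - Poly_Mapping.single 0 (super_sign (a, b) (c, d)) * (free_gen (c, d) * free_gen (a, b)))
      (superbracket (a, b) (c, d))"
    by (simp only: enveloping_rel_def enveloping_relator_def)
  have "e a b * e c d - cscale (super_sign (a, b) (c, d)) (e c d * e a b) = abs_Ugl (superbracket (a, b) (c, d))"
    using * by (simp only: e.abs_eq times_Ugl.abs_eq minus_Ugl.abs_eq cscale.abs_eq Ugl.abs_eq_iff)
  also have "\<dots> = (if b = c then e a d else 0)
      - cscale (super_sign (a, b) (c, d)) (if a = d then e c b else 0)"
    by (simp only: superbracket.simps minus_Ugl.abs_eq[symmetric] cscale.abs_eq[symmetric]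
        if_distrib[of abs_Ugl] e.abs_eq[symmetric] zero_Ugl.abs_eq[symmetric])
  finally show ?thesis .
qed

lemma e_even_commute:
  assumes "even (parity a + parity b) \<or> even (parity c + parity d)"
  shows "e a b * e c d = e c d * e a b + (if b = c then e a d else 0) - (if a = d then e c b else 0)"
  using e_superbracket[of a b c d] assms by (auto simp: super_sign_cases algebra_simps)

lemma e_odd_anticommute:
  assumes "odd (parity a + parity b)" "odd (parity c + parity d)"
  shows "e a b * e c d = - (e c d * e a b) + (if b = c then e a d else 0) + (if a = d then e c b else 0)"
  using e_superbracket[of a b c d] assms by (auto simp: super_sign_cases algebra_simps split: if_splits)

section \<open>The universal property of the enveloping algebra\<close>

text \<open>Data of a homomorphism from the enveloping algebra to a ring without a complex structure
  of its own: \<open>scal\<close> supplies the images of the scalars. It serves twice, for the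
  oscillator representation and for the shift of the generators by multiples of the
  supertrace.\<close>

locale ugl_family =
  fixes scal :: "complex \<Rightarrow> 'r::ring_1"
    and T :: "('m, 'n) symbol \<Rightarrow> ('m, 'n) symbol \<Rightarrow> 'r"
  assumes scal_add: "scal (z + z') = scal z + scal z'"
    and scal_mult: "scal (z * z') = scal z * scal z'"
    and scal_one: "scal 1 = 1"
    and scal_commute: "scal z * T a b = T a b * scal z"
    and superbracket:
      "T a b * T c d - scal (super_sign (a, b) (c, d)) * (T c d * T a b) =
         (if b = c then T a d else 0)
         - scal (super_sign (a, b) (c, d)) * (if a = d then T c b else 0)"
begin

lemma scal_zero [simp]: "scal 0 = 0"
  using scal_add[of 0 0] by simp

definition word_val :: "('m, 'n) gl_index free_word \<Rightarrow> 'r" where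
  "word_val w = prod_list (map (\<lambda>(a, b). T a b) (letters w))"

lemma word_val_add: "word_val (v + w) = word_val v * word_val w"
  by (simp add: word_val_def plus_free_word_def)

lemma scal_word_val: "scal c * word_val w = word_val w * scal c"
proof -
  have "scal c * prod_list (map (\<lambda>(a, b). T a b) l) = prod_list (map (\<lambda>(a, b). T a b) l) * scal c" for l
  proof (induction l)
    case (Cons x l)
    then show ?case
      by (cases x) (simp add: mult.assoc, metis mult.assoc scal_commute)
  qed simp
  then show ?thesis
    by (simp add: word_val_def)
qed

definition free_val :: "('m, 'n) gl_index free_alg \<Rightarrow> 'r" where
  "free_val f = (\<Sum>w\<in>Poly_Mapping.keys f. scal (Poly_Mapping.lookup f w) * word_val w)"

lemma free_val_superset:
  assumes "finite A" "Poly_Mapping.keys f \<subseteq> A"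
  shows "free_val f = (\<Sum>w\<in>A. scal (Poly_Mapping.lookup f w) * word_val w)"
  unfolding free_val_def
  by (rule sum.mono_neutral_left) (use assms in \<open>auto simp: in_keys_iff\<close>)

lemma free_val_add: "free_val (f + g) = free_val f + free_val g"
proof -
  let ?A = "Poly_Mapping.keys f \<union> Poly_Mapping.keys g"
  have "Poly_Mapping.keys (f + g) \<subseteq> ?A"
    by (rule Poly_Mapping.keys_add)
  then have "free_val (f + g) = (\<Sum>w\<in>?A. scal (Poly_Mapping.lookup (f + g) w) * word_val w)"
    by (intro free_val_superset) auto
  also have "\<dots> = free_val f + free_val g"
    using free_val_superset[of ?A f] free_val_superset[of ?A g]
    by (simp add: lookup_add scal_add distrib_right sum.distrib)
  finally show ?thesis .
qed

lemma free_val_single: "free_val (Poly_Mapping.single w c) = scal c * word_val w"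
  by (subst free_val_superset[OF _ keys_single_subset]) auto

lemma free_val_zero [simp]: "free_val 0 = 0"
  by (simp add: free_val_def)

lemma free_val_mult: "free_val (f * g) = free_val f * free_val g"
proof (induction f rule: poly_mapping_induct_plus)
  case (plus v c f)
  have "free_val (Poly_Mapping.single v c * g) = scal c * word_val v * free_val g"
  proof (induction g rule: poly_mapping_induct_plus)
    case (plus w d g)
    have "free_val (Poly_Mapping.single v c * Poly_Mapping.single w d)
        = scal c * word_val v * (scal d * word_val w)"
      by (simp add: mult_single free_val_single scal_mult word_val_add mult.assoc)
        (metis mult.assoc scal_word_val)
    then show ?case
      using plus by (simp add: distrib_left free_val_add free_val_single)
  qed simp
  then show ?case
    using plus by (simp add: distrib_right free_val_add free_val_single)
qed simp

lemma free_val_uminus: "free_val (- f) = - free_val f"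
  using free_val_add[of f "- f"] by (simp add: eq_neg_iff_add_eq_0 add.commute)

lemma free_val_diff: "free_val (f - g) = free_val f - free_val g"
  using free_val_add[of f "- g"] by (simp add: free_val_uminus)

lemma free_val_gen: "free_val (free_gen (a, b)) = T a b"
  by (simp add: free_gen_def free_val_single scal_one word_val_def)

lemma free_val_scalar: "free_val (Poly_Mapping.single 0 c * f) = scal c * free_val f"
  by (simp add: free_val_mult free_val_single word_val_def zero_free_word_def)

lemma free_val_relator: "free_val (enveloping_relator x y) = 0"
proof (cases x; cases y)
  fix a b c d
  assume *: "x = (a, b)" "y = (c, d)"
  have "free_val (superbracket (a, b) (c, d)) =
      T a b * T c d - scal (super_sign (a, b) (c, d)) * (T c d * T a b)"
    unfolding superbracket
    by (simp only: superbracket.simps free_val_diff free_val_scalar if_distrib[of free_val]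
        free_val_gen free_val_zero)
  with * show ?thesis
    by (simp only: enveloping_relator_def free_val_diff free_val_scalar) (simp add: free_val_mult free_val_gen)
qed

lemma free_val_ideal: "f \<in> enveloping_ideal \<Longrightarrow> free_val f = 0"
  unfolding enveloping_ideal_def
  by (induction rule: two_sided_ideal.induct)
    (auto simp: free_val_add free_val_mult free_val_relator)

lift_definition val :: "('m, 'n) Ugl \<Rightarrow> 'r" is free_val
  using free_val_ideal free_val_diff by (fastforce simp: enveloping_rel_def)

lemma val_add: "val (x + y) = val x + val y"
  by transfer (rule free_val_add)

lemma val_mult: "val (x * y) = val x * val y"
  by transfer (rule free_val_mult)

lemma val_one: "val 1 = 1"
  by transfer (simp add: single_one[symmetric] free_val_single scal_one word_val_def zero_free_word_def del: single_one)

lemma val_zero: "val 0 = 0"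
  by transfer simp

lemma val_diff: "val (x - y) = val x - val y"
  by transfer (rule free_val_diff)

lemma val_cscale: "val (cscale c x) = scal c * val x"
  by transfer (rule free_val_scalar)

lemma val_e: "val (e a b) = T a b"
  by transfer (rule free_val_gen)

end

section \<open>Clifford operators and an oscillator representation\<close>

text \<open>Additive operators form a type with composition as product, so that algebras of
  operators belong to the class \<open>ring_1\<close>. A function on the subsets of a finite set of
  generators stands for an element of the exterior algebra with coefficients in a ring, read off in
  the basis of ordered monomials.\<close>

typedef (overloaded) ('i, 'a::ab_group_add) endo =
  "{T :: ('i \<Rightarrow> 'a) \<Rightarrow> 'i \<Rightarrow> 'a. \<forall>f g. T (\<lambda>i. f i + g i) = (\<lambda>i. T f i + T g i)}"
  by (rule exI[of _ "\<lambda>f. f"]) simp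

setup_lifting type_definition_endo

instantiation endo :: (type, ab_group_add) ring
begin

lift_definition zero_endo :: "('a, 'b) endo" is "\<lambda>f i. 0"
  by simp

lift_definition plus_endo :: "('a, 'b) endo \<Rightarrow> ('a, 'b) endo \<Rightarrow> ('a, 'b) endo"
  is "\<lambda>S T f i. S f i + T f i"
  by (simp add: algebra_simps)

lift_definition uminus_endo :: "('a, 'b) endo \<Rightarrow> ('a, 'b) endo" is "\<lambda>T f i. - T f i"
  by simp

lift_definition minus_endo :: "('a, 'b) endo \<Rightarrow> ('a, 'b) endo \<Rightarrow> ('a, 'b) endo"
  is "\<lambda>S T f i. S f i - T f i"
  by (simp add: algebra_simps)

lift_definition times_endo :: "('a, 'b) endo \<Rightarrow> ('a, 'b) endo \<Rightarrow> ('a, 'b) endo"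
  is "\<lambda>S T f. S (T f)"
  by simp

instance
  by standard (transfer, simp add: algebra_simps)+

end

instantiation endo :: (type, ring_1) ring_1
begin

lift_definition one_endo :: "('a, 'b) endo" is "\<lambda>f. f"
  by simp

instance
proof
  show "(0 :: ('a, 'b) endo) \<noteq> 1"
    by transfer (metis zero_neq_one)
qed (transfer, simp)+

end

lemma Rep_endo_zero: "Rep_endo T (\<lambda>i. 0) = (\<lambda>i. 0)"
proof -
  have "Rep_endo T (\<lambda>i. 0 + 0) = (\<lambda>i. Rep_endo T (\<lambda>i. 0) i + Rep_endo T (\<lambda>i. 0) i)"
    using Rep_endo[of T] by (elim CollectE allE)
  then show ?thesis
    by (simp add: fun_eq_iff)
qed

lemma Rep_endo_sum: "Rep_endo (\<Sum>x\<in>A. T x) f i = (\<Sum>x\<in>A. Rep_endo (T x) f i)"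
  by (induction A rule: infinite_finite_induct) (simp_all add: zero_endo.rep_eq plus_endo.rep_eq)

lift_definition left_mult :: "'a::ring_1 \<Rightarrow> ('i, 'a) endo" is "\<lambda>a f i. a * f i"
  by (simp add: algebra_simps)

lemma left_mult_add: "left_mult (a + b) = left_mult a + left_mult b"
  by transfer (simp add: algebra_simps)

lemma left_mult_diff: "left_mult (a - b) = left_mult a - left_mult b"
  by transfer (simp add: algebra_simps)

lemma left_mult_zero [simp]: "left_mult 0 = 0"
  by transfer simp

lemma left_mult_one [simp]: "left_mult 1 = 1"
  by transfer simp

lemma left_mult_mult: "left_mult (a * b) = left_mult a * left_mult b"
  by transfer (simp add: mult.assoc)

section \<open>Clifford relations for signed creation and annihilation operators\<close>

definition clifford_sign :: "'x::finite \<Rightarrow> 'x set \<Rightarrow> 'a::ring_1" where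
  "clifford_sign x S = (- 1) ^ card {y\<in>S. to_nat y < to_nat x}"

lemma clifford_sign_cases: "clifford_sign x S = 1 \<or> clifford_sign x S = - 1"
  by (simp add: clifford_sign_def minus_one_power_iff)

lemma clifford_sign_mult:
  fixes a :: "'a::ring_1"
  shows "a * (clifford_sign x S * b) = clifford_sign x S * (a * b)"
proof -
  have "clifford_sign x S = (1 :: 'a) \<or> clifford_sign x S = (- 1 :: 'a)"
    by (rule clifford_sign_cases)
  then show ?thesis
    by auto
qed

lemma clifford_sign_left_commute:
  "clifford_sign x S * (clifford_sign y R * b) = clifford_sign y R * (clifford_sign x S * b)"
  by (rule clifford_sign_mult)

lemma clifford_sign_square:
  fixes b :: "'a::ring_1"
  shows "clifford_sign x S * (clifford_sign x S * b) = b"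
proof -
  have "clifford_sign x S = (1 :: 'a) \<or> clifford_sign x S = (- 1 :: 'a)"
    by (rule clifford_sign_cases)
  then show ?thesis
    by auto
qed

lemma clifford_sign_insert:
  assumes "y \<notin> S"
  shows "clifford_sign x (insert y S) =
    (if to_nat y < to_nat x then - clifford_sign x S else clifford_sign x S)"
proof -
  have "{z \<in> insert y S. to_nat z < to_nat x} =
      (if to_nat y < to_nat x then insert y {z\<in>S. to_nat z < to_nat x} else {z\<in>S. to_nat z < to_nat x})"
    by auto
  then show ?thesis
    using assms by (simp add: clifford_sign_def)
qed

lemma clifford_sign_remove:
  assumes "y \<in> S"
  shows "clifford_sign x (S - {y}) =
    (if to_nat y < to_nat x then - clifford_sign x S else clifford_sign x S :: 'a::ring_1)"
proof -
  have "clifford_sign x S = (if to_nat y < to_nat x then - clifford_sign x (S - {y}) else clifford_sign x (S - {y}) :: 'a)"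
    using clifford_sign_insert[of y "S - {y}" x, where 'b = 'a] assms by (auto simp: insert_absorb)
  then show ?thesis
    by simp
qed

text \<open>Left exterior multiplication by the generator \<open>x\<close>, in coefficients: the
  monomial of \<open>S\<close> arises from that of \<open>S - {x}\<close>, and
  \<open>clifford_sign\<close> records moving \<open>x\<close> to its place in the order given by
  \<open>to_nat\<close>. The matrix of \<open>annihilation\<close> is the transpose.\<close>

lift_definition creation :: "'x::finite \<Rightarrow> ('x set, 'a::ring_1) endo"
  is "\<lambda>x f S. if x \<in> S then clifford_sign x S * f (S - {x}) else 0"
  by (auto simp: algebra_simps)

lift_definition annihilation :: "'x::finite \<Rightarrow> ('x set, 'a::ring_1) endo"
  is "\<lambda>x f S. if x \<notin> S then clifford_sign x S * f (insert x S) else 0"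
  by (auto simp: algebra_simps)

lemma endo_eqI: "(\<And>f i. Rep_endo S f i = Rep_endo T f i) \<Longrightarrow> S = T"
  by (simp add: Rep_endo_inject[symmetric] fun_eq_iff)

lemmas endo_rep_eqs = times_endo.rep_eq plus_endo.rep_eq uminus_endo.rep_eq one_endo.rep_eq
  zero_endo.rep_eq creation.rep_eq annihilation.rep_eq left_mult.rep_eq

lemma to_nat_neq_cases:
  assumes "x \<noteq> y"
  obtains "to_nat x < to_nat y" "\<not> to_nat y < to_nat x" | "to_nat y < to_nat x" "\<not> to_nat x < to_nat y"
  using assms inj_to_nat[THEN injD, of x y] by (metis linorder_cases order_less_asym)


text \<open>Removing \<open>y\<close> flips the sign at \<open>x\<close> exactly when
  \<open>y\<close> precedes \<open>x\<close>. Of two distinct generators exactly one precedes the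
  other, so the two orders of application differ by one sign.\<close>

lemma creation_anticommute: "creation x * creation y = - (creation y * creation x)"
proof (cases "x = y")
  case True
  then show ?thesis
    by (intro endo_eqI) (simp add: endo_rep_eqs)
next
  case False
  show ?thesis
  proof (rule endo_eqI)
    fix f :: "'a set \<Rightarrow> 'b" and i
    have *: "i - {x} - {y} = i - {y} - {x}"
      by blast
    show "Rep_endo (creation x * creation y) f i = Rep_endo (- (creation y * creation x)) f i"
      using False
      by (rule to_nat_neq_cases; cases "x \<in> i"; cases "y \<in> i")
        (simp_all add: endo_rep_eqs clifford_sign_remove False False[symmetric] * clifford_sign_left_commute[of x i y i])
  qed
qed

lemma annihilation_anticommute: "annihilation x * annihilation y = - (annihilation y * annihilation x)"
proof (cases "x = y")
  case True
  then show ?thesis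
    by (intro endo_eqI) (simp add: endo_rep_eqs)
next
  case False
  show ?thesis
  proof (rule endo_eqI)
    fix f :: "'a set \<Rightarrow> 'b" and i
    have *: "insert y (insert x i) = insert x (insert y i)"
      by blast
    show "Rep_endo (annihilation x * annihilation y) f i = Rep_endo (- (annihilation y * annihilation x)) f i"
      using False
      by (rule to_nat_neq_cases; cases "x \<in> i"; cases "y \<in> i")
        (simp_all add: endo_rep_eqs clifford_sign_insert False False[symmetric] * clifford_sign_left_commute[of x i y i])
  qed
qed

text \<open>For \<open>x = y\<close> only one of the two products can contribute at a given subset,
  depending on whether \<open>x\<close> lies in it, and its two signs cancel. For distinct
  generators the signs are counted as for two creators.\<close>

lemma annihilation_creation:
  fixes x y :: "'a::finite"
  shows "annihilation x * creation y =
    - (creation y * annihilation x) + (if x = y then 1 else 0 :: ('a set, 'b::ring_1) endo)"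
proof (cases "x = y")
  case True
  have "annihilation x * creation x + creation x * annihilation x = (1 :: ('a set, 'b) endo)"
  proof (rule endo_eqI)
    fix f :: "'a set \<Rightarrow> 'b" and i
    show "Rep_endo (annihilation x * creation x + creation x * annihilation x) f i = Rep_endo 1 f i"
      by (cases "x \<in> i")
        (simp_all add: endo_rep_eqs clifford_sign_insert clifford_sign_remove clifford_sign_square insert_absorb)
  qed
  with True show ?thesis
    by (simp add: algebra_simps)
next
  case False
  have "annihilation x * creation y = - (creation y * annihilation x :: ('a set, 'b) endo)"
  proof (rule endo_eqI)
    fix f :: "'a set \<Rightarrow> 'b" and i
    have *: "insert x i - {y} = insert x (i - {y})"
      using False by blast
    show "Rep_endo (annihilation x * creation y) f i = Rep_endo (- (creation y * annihilation x)) f i"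
      using False
      by (rule to_nat_neq_cases; cases "x \<in> i"; cases "y \<in> i")
        (simp_all add: endo_rep_eqs clifford_sign_insert clifford_sign_remove False False[symmetric] *
          clifford_sign_left_commute[of x i y i])
  qed
  with False show ?thesis
    by simp
qed

lemma left_mult_creation: "left_mult a * creation x = creation x * left_mult a"
  by (rule endo_eqI) (simp add: endo_rep_eqs clifford_sign_mult[of a])

lemma left_mult_annihilation: "left_mult a * annihilation x = annihilation x * left_mult a"
  by (rule endo_eqI) (simp add: endo_rep_eqs clifford_sign_mult[of a])

text \<open>This is the module induced from the trivial module of the subalgebra of all
  \<open>e\<^bsub>a,\<gamma>\<^esub>\<close> with \<open>\<gamma>\<close> virtual, written with creation operators \<open>\<psi>\<close> for the \<open>e\<^bsub>\<gamma>,i\<^esub>\<close>; the cubic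
  terms of \<open>e\<^bsub>i,\<gamma>\<^esub>\<close> are hidden in the factor \<open>E_pp\<close> of \<open>E_pv\<close>.\<close>

locale oscillator =
  fixes \<psi> d :: "'m::finite \<Rightarrow> 'n::finite \<Rightarrow> 'r::ring_1" and L :: "'n \<Rightarrow> 'n \<Rightarrow> 'r"
  assumes \<psi>_\<psi>: "\<psi> \<gamma> i * \<psi> \<delta> j = - (\<psi> \<delta> j * \<psi> \<gamma> i)"
    and d_d: "d \<gamma> i * d \<delta> j = - (d \<delta> j * d \<gamma> i)"
    and d_\<psi>: "d \<gamma> i * \<psi> \<delta> j = - (\<psi> \<delta> j * d \<gamma> i) + (if \<gamma> = \<delta> \<and> i = j then 1 else 0)"
    and L_\<psi>: "L i j * \<psi> \<gamma> k = \<psi> \<gamma> k * L i j"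
    and L_d: "L i j * d \<gamma> k = d \<gamma> k * L i j"
    and L_L: "L i j * L k l = L k l * L i j + (if j = k then L i l else 0) - (if i = l then L k j else 0)"
begin

definition E_vv :: "'m \<Rightarrow> 'm \<Rightarrow> 'r" where
  "E_vv \<gamma> \<delta> = (\<Sum>j\<in>UNIV. \<psi> \<gamma> j * d \<delta> j)"

text \<open>The subtracted sum is the adjoint action on the creators: bracketing the proper
  generator (i, j) with the creator (\<gamma>, k) gives minus the creator (\<gamma>, j) when
  \<open>i = k\<close>.\<close>

definition E_pp :: "'n \<Rightarrow> 'n \<Rightarrow> 'r" where
  "E_pp i j = L i j - (\<Sum>\<gamma>\<in>UNIV. \<psi> \<gamma> j * d \<gamma> i)"

definition E_pv :: "'n \<Rightarrow> 'm \<Rightarrow> 'r" where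
  "E_pv i \<gamma> = (\<Sum>j\<in>UNIV. E_pp i j * d \<gamma> j)"

text \<open>A product of two odd operators commutes with a third up to the contraction, since the
  two signs cancel.\<close>

lemma \<psi>d_\<psi>: "\<psi> \<gamma> i * d \<delta> j * \<psi> \<epsilon> k =
    \<psi> \<epsilon> k * (\<psi> \<gamma> i * d \<delta> j) + (if \<delta> = \<epsilon> \<and> j = k then \<psi> \<gamma> i else 0)"
proof -
  have "\<psi> \<gamma> i * d \<delta> j * \<psi> \<epsilon> k =
      - (\<psi> \<gamma> i * \<psi> \<epsilon> k) * d \<delta> j + (if \<delta> = \<epsilon> \<and> j = k then \<psi> \<gamma> i else 0)"
    by (simp add: d_\<psi> mult.assoc algebra_simps)
  then show ?thesis
    by (simp add: \<psi>_\<psi>[of \<gamma> i \<epsilon> k] mult.assoc)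
qed

lemma \<psi>d_d: "\<psi> \<gamma> i * d \<delta> j * d \<epsilon> k =
    d \<epsilon> k * (\<psi> \<gamma> i * d \<delta> j) - (if \<gamma> = \<epsilon> \<and> i = k then d \<delta> j else 0)"
proof -
  have "\<psi> \<gamma> i * d \<delta> j * d \<epsilon> k = - (\<psi> \<gamma> i * d \<epsilon> k) * d \<delta> j"
    by (simp add: mult.assoc d_d[of \<delta> j \<epsilon> k])
  also have "- (\<psi> \<gamma> i * d \<epsilon> k) = d \<epsilon> k * \<psi> \<gamma> i - (if \<gamma> = \<epsilon> \<and> i = k then 1 else 0)"
    by (auto simp: d_\<psi>)
  finally show ?thesis
    by (auto simp: algebra_simps mult.assoc)
qed

lemma E_vv_\<psi>: "E_vv \<gamma> \<delta> * \<psi> \<epsilon> k = \<psi> \<epsilon> k * E_vv \<gamma> \<delta> + (if \<delta> = \<epsilon> then \<psi> \<gamma> k else 0)"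
  by (cases "\<delta> = \<epsilon>") (simp_all add: E_vv_def sum_distrib_left sum_distrib_right \<psi>d_\<psi> sum.distrib)

lemma E_vv_d: "E_vv \<gamma> \<delta> * d \<epsilon> k = d \<epsilon> k * E_vv \<gamma> \<delta> - (if \<gamma> = \<epsilon> then d \<delta> k else 0)"
  by (cases "\<gamma> = \<epsilon>") (simp_all add: E_vv_def sum_distrib_left sum_distrib_right \<psi>d_d sum_subtractf)

text \<open>The creator part of \<open>E_pp\<close>. It commutes with every \<open>L i j\<close>,
  and its negative satisfies the relations imposed on \<open>L\<close>, so the difference
  \<open>E_pp\<close> satisfies them too.\<close>

definition N :: "'n \<Rightarrow> 'n \<Rightarrow> 'r" where
  "N i j = (\<Sum>\<gamma>\<in>UNIV. \<psi> \<gamma> j * d \<gamma> i)"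

lemma N_\<psi>: "N i j * \<psi> \<gamma> k = \<psi> \<gamma> k * N i j + (if i = k then \<psi> \<gamma> j else 0)"
  by (cases "i = k") (simp_all add: N_def sum_distrib_left sum_distrib_right \<psi>d_\<psi> sum.distrib)

lemma N_d: "N i j * d \<gamma> k = d \<gamma> k * N i j - (if j = k then d \<gamma> i else 0)"
  by (cases "j = k") (simp_all add: N_def sum_distrib_left sum_distrib_right \<psi>d_d sum_subtractf)

lemma N_N: "N i j * N k l = N k l * N i j - (if j = k then N i l else 0) + (if i = l then N k j else 0)"
proof -
  have "N i j * (\<psi> \<gamma> l * d \<gamma> k) =
      \<psi> \<gamma> l * d \<gamma> k * N i j - (if j = k then \<psi> \<gamma> l * d \<gamma> i else 0) + (if i = l then \<psi> \<gamma> j * d \<gamma> k else 0)" for \<gamma>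
  proof -
    have "N i j * (\<psi> \<gamma> l * d \<gamma> k) = \<psi> \<gamma> l * (N i j * d \<gamma> k) + (if i = l then \<psi> \<gamma> j * d \<gamma> k else 0)"
      by (simp add: N_\<psi> mult.assoc[symmetric] distrib_right)
    then show ?thesis
      by (auto simp: N_d algebra_simps mult.assoc)
  qed
  note step = this
  have "N i j * N k l = (\<Sum>\<gamma>\<in>UNIV. N i j * (\<psi> \<gamma> l * d \<gamma> k))"
    by (simp add: N_def[of k l] sum_distrib_left)
  also have "\<dots> = (\<Sum>\<gamma>\<in>UNIV. \<psi> \<gamma> l * d \<gamma> k) * N i j
      - (if j = k then \<Sum>\<gamma>\<in>UNIV. \<psi> \<gamma> l * d \<gamma> i else 0)
      + (if i = l then \<Sum>\<gamma>\<in>UNIV. \<psi> \<gamma> j * d \<gamma> k else 0)"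
    by (simp only: step) (simp add: sum.distrib sum_subtractf sum_distrib_right)
  finally show ?thesis
    by (simp only: N_def)
qed

lemma L_N: "L i j * N k l = N k l * L i j"
proof -
  have "L i j * (\<psi> \<gamma> l * d \<gamma> k) = \<psi> \<gamma> l * d \<gamma> k * L i j" for \<gamma>
    by (metis L_\<psi> L_d mult.assoc)
  then show ?thesis
    by (simp add: N_def sum_distrib_left sum_distrib_right)
qed

lemma E_pp_eq: "E_pp i j = L i j - N i j"
  by (simp add: E_pp_def N_def)

lemma E_pp_\<psi>: "E_pp i j * \<psi> \<gamma> k = \<psi> \<gamma> k * E_pp i j - (if i = k then \<psi> \<gamma> j else 0)"
  by (simp add: E_pp_eq algebra_simps L_\<psi> N_\<psi>)

lemma E_pp_d: "E_pp i j * d \<gamma> k = d \<gamma> k * E_pp i j + (if j = k then d \<gamma> i else 0)"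
  by (simp add: E_pp_eq algebra_simps L_d N_d)

lemma E_pp_E_pp:
  "E_pp i j * E_pp k l = E_pp k l * E_pp i j + (if j = k then E_pp i l else 0) - (if i = l then E_pp k j else 0)"
  by (simp add: E_pp_eq algebra_simps L_L[of i j k l] N_N[of i j k l] L_N)

lemma E_vv_E_vv:
  "E_vv \<gamma> \<delta> * E_vv \<epsilon> \<zeta> =
     E_vv \<epsilon> \<zeta> * E_vv \<gamma> \<delta> + (if \<delta> = \<epsilon> then E_vv \<gamma> \<zeta> else 0) - (if \<gamma> = \<zeta> then E_vv \<epsilon> \<delta> else 0)"
proof -
  have "E_vv \<gamma> \<delta> * (\<psi> \<epsilon> k * d \<zeta> k) =
      \<psi> \<epsilon> k * d \<zeta> k * E_vv \<gamma> \<delta> + (if \<delta> = \<epsilon> then \<psi> \<gamma> k * d \<zeta> k else 0) - (if \<gamma> = \<zeta> then \<psi> \<epsilon> k * d \<delta> k else 0)" for k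
  proof -
    have "E_vv \<gamma> \<delta> * (\<psi> \<epsilon> k * d \<zeta> k) = \<psi> \<epsilon> k * (E_vv \<gamma> \<delta> * d \<zeta> k) + (if \<delta> = \<epsilon> then \<psi> \<gamma> k * d \<zeta> k else 0)"
      by (simp add: E_vv_\<psi> mult.assoc[symmetric] distrib_right)
    then show ?thesis
      by (auto simp: E_vv_d algebra_simps mult.assoc)
  qed
  note step = this
  have "E_vv \<gamma> \<delta> * E_vv \<epsilon> \<zeta> = (\<Sum>k\<in>UNIV. E_vv \<gamma> \<delta> * (\<psi> \<epsilon> k * d \<zeta> k))"
    by (simp add: E_vv_def[of \<epsilon> \<zeta>] sum_distrib_left)
  also have "\<dots> = (\<Sum>k\<in>UNIV. \<psi> \<epsilon> k * d \<zeta> k) * E_vv \<gamma> \<delta>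
      + (if \<delta> = \<epsilon> then \<Sum>k\<in>UNIV. \<psi> \<gamma> k * d \<zeta> k else 0)
      - (if \<gamma> = \<zeta> then \<Sum>k\<in>UNIV. \<psi> \<epsilon> k * d \<delta> k else 0)"
    by (simp only: step) (simp add: sum.distrib sum_subtractf sum_distrib_right)
  finally show ?thesis
    by (simp only: E_vv_def)
qed

text \<open>The two operators act on different indices of a creator: the corrections at \<epsilon> =
  \<delta> and at \<epsilon> = \<gamma> are both \<open>\<psi> \<gamma> j * d \<delta> i\<close>,
  with opposite signs.\<close>

lemma E_vv_E_pp: "E_vv \<gamma> \<delta> * E_pp i j = E_pp i j * E_vv \<gamma> \<delta>"
proof -
  have "L i j * (\<psi> \<gamma> k * d \<delta> k) = \<psi> \<gamma> k * d \<delta> k * L i j" for k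
    by (metis L_\<psi> L_d mult.assoc)
  then have L: "L i j * E_vv \<gamma> \<delta> = E_vv \<gamma> \<delta> * L i j"
    by (simp add: E_vv_def sum_distrib_left sum_distrib_right)
  have "E_vv \<gamma> \<delta> * (\<psi> \<epsilon> j * d \<epsilon> i) =
      \<psi> \<epsilon> j * d \<epsilon> i * E_vv \<gamma> \<delta> + (if \<delta> = \<epsilon> then \<psi> \<gamma> j * d \<epsilon> i else 0) - (if \<gamma> = \<epsilon> then \<psi> \<epsilon> j * d \<delta> i else 0)" for \<epsilon>
  proof -
    have "E_vv \<gamma> \<delta> * (\<psi> \<epsilon> j * d \<epsilon> i) = \<psi> \<epsilon> j * (E_vv \<gamma> \<delta> * d \<epsilon> i) + (if \<delta> = \<epsilon> then \<psi> \<gamma> j * d \<epsilon> i else 0)"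
      by (simp add: E_vv_\<psi> mult.assoc[symmetric] distrib_right)
    then show ?thesis
      by (auto simp: E_vv_d algebra_simps mult.assoc)
  qed
  then have "E_vv \<gamma> \<delta> * N i j = N i j * E_vv \<gamma> \<delta>"
    by (simp add: N_def sum_distrib_left sum_distrib_right sum.distrib sum_subtractf)
  with L show ?thesis
    by (simp add: E_pp_eq algebra_simps)
qed

lemma E_vv_E_pv: "E_vv \<gamma> \<delta> * E_pv i \<epsilon> = E_pv i \<epsilon> * E_vv \<gamma> \<delta> - (if \<gamma> = \<epsilon> then E_pv i \<delta> else 0)"
proof -
  have "E_vv \<gamma> \<delta> * (E_pp i j * d \<epsilon> j) =
      E_pp i j * d \<epsilon> j * E_vv \<gamma> \<delta> - (if \<gamma> = \<epsilon> then E_pp i j * d \<delta> j else 0)" for j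
  proof -
    have "E_vv \<gamma> \<delta> * (E_pp i j * d \<epsilon> j) = E_pp i j * (E_vv \<gamma> \<delta> * d \<epsilon> j)"
      by (metis E_vv_E_pp mult.assoc)
    then show ?thesis
      by (auto simp: E_vv_d algebra_simps mult.assoc)
  qed
  then show ?thesis
    unfolding E_pv_def
    by (cases "\<gamma> = \<epsilon>") (simp_all add: sum_distrib_left sum_distrib_right sum_subtractf)
qed

lemma E_pp_E_pv: "E_pp i j * E_pv k \<gamma> = E_pv k \<gamma> * E_pp i j + (if j = k then E_pv i \<gamma> else 0)"
proof -
  have "E_pp i j * (E_pp k l * d \<gamma> l) = E_pp k l * d \<gamma> l * E_pp i j
      + (if j = l then E_pp k l * d \<gamma> i else 0)
      + (if j = k then E_pp i l * d \<gamma> l else 0) - (if i = l then E_pp k j * d \<gamma> l else 0)" for l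
  proof -
    have "E_pp i j * (E_pp k l * d \<gamma> l) = (E_pp k l * E_pp i j
        + (if j = k then E_pp i l else 0) - (if i = l then E_pp k j else 0)) * d \<gamma> l"
      by (simp only: mult.assoc[symmetric] E_pp_E_pp[of i j k l])
    also have "\<dots> = E_pp k l * (E_pp i j * d \<gamma> l)
        + (if j = k then E_pp i l * d \<gamma> l else 0) - (if i = l then E_pp k j * d \<gamma> l else 0)"
      by (simp add: distrib_right left_diff_distrib mult.assoc)
    finally show ?thesis
      by (simp add: E_pp_d[of i j \<gamma> l] distrib_left mult.assoc)
  qed
  then show ?thesis
    unfolding E_pv_def
    by (cases "j = k") (simp_all add: sum_distrib_left sum_distrib_right sum.distrib sum_subtractf)
qed

text \<open>Contracting \<open>d \<gamma> j\<close> with \<open>\<psi> \<delta> k\<close> leaves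
  \<open>E_pp i k\<close>, and moving \<open>E_pp i j\<close> past \<open>\<psi> \<delta> k\<close>
  leaves the summands of \<open>E_vv \<delta> \<gamma>\<close>. Thus the factor \<open>E_pp\<close>
  in \<open>E_pv\<close> produces both terms of the superbracket.\<close>

lemma E_pv_\<psi>: "E_pv i \<gamma> * \<psi> \<delta> k =
    - (\<psi> \<delta> k * E_pv i \<gamma>) + (if i = k then E_vv \<delta> \<gamma> else 0) + (if \<gamma> = \<delta> then E_pp i k else 0)"
proof -
  have "E_pp i j * d \<gamma> j * \<psi> \<delta> k = - (\<psi> \<delta> k * (E_pp i j * d \<gamma> j))
      + (if i = k then \<psi> \<delta> j * d \<gamma> j else 0) + (if j = k then (if \<gamma> = \<delta> then E_pp i k else 0) else 0)" for j
  proof -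
    have "E_pp i j * d \<gamma> j * \<psi> \<delta> k = - (E_pp i j * \<psi> \<delta> k * d \<gamma> j)
        + (if j = k then (if \<gamma> = \<delta> then E_pp i k else 0) else 0)"
      by (auto simp: d_\<psi> mult.assoc algebra_simps)
    then show ?thesis
      by (auto simp: E_pp_\<psi> mult.assoc algebra_simps)
  qed
  note step = this
  have "E_pv i \<gamma> * \<psi> \<delta> k = (\<Sum>j\<in>UNIV. E_pp i j * d \<gamma> j * \<psi> \<delta> k)"
    by (simp add: E_pv_def sum_distrib_right)
  also have "\<dots> = - (\<psi> \<delta> k * (\<Sum>j\<in>UNIV. E_pp i j * d \<gamma> j))
      + (if i = k then \<Sum>j\<in>UNIV. \<psi> \<delta> j * d \<gamma> j else 0) + (if \<gamma> = \<delta> then E_pp i k else 0)"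
    by (simp only: step) (simp add: sum.distrib sum_negf sum_subtractf sum_distrib_left)
  finally show ?thesis
    by (simp only: E_pv_def E_vv_def)
qed

text \<open>Moving \<open>E_pv i \<gamma>\<close> across \<open>E_pp k l\<close> and across
  \<open>d \<delta> l\<close> leaves one extra term each. Exchanging two annihilators shows that
  these cancel after summation.\<close>

lemma E_pv_E_pv: "E_pv i \<gamma> * E_pv k \<delta> = - (E_pv k \<delta> * E_pv i \<gamma>)"
proof -
  have *: "E_pv i \<gamma> * d \<delta> l = - (d \<delta> l * E_pv i \<gamma>) - d \<delta> i * d \<gamma> l" for l
  proof -
    have "E_pp i j * d \<gamma> j * d \<delta> l = - (d \<delta> l * (E_pp i j * d \<gamma> j)) - (if j = l then d \<delta> i * d \<gamma> l else 0)" for j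
    proof -
      have "E_pp i j * d \<gamma> j * d \<delta> l = - (E_pp i j * d \<delta> l * d \<gamma> j)"
        by (simp add: d_d[of \<gamma> j] mult.assoc)
      then show ?thesis
        by (auto simp: E_pp_d mult.assoc algebra_simps)
    qed
    then show ?thesis
      by (simp add: E_pv_def sum_distrib_left sum_distrib_right sum_subtractf sum_negf)
  qed
  have "E_pv i \<gamma> * (E_pp k l * d \<delta> l) = - (E_pp k l * d \<delta> l * E_pv i \<gamma>) - E_pp k l * d \<delta> i * d \<gamma> l
      - (if l = i then E_pv k \<gamma> * d \<delta> i else 0)" for l
  proof -
    have "E_pv i \<gamma> * E_pp k l = E_pp k l * E_pv i \<gamma> - (if l = i then E_pv k \<gamma> else 0)"
      using E_pp_E_pv[of k l i \<gamma>] by simp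
    then have "E_pv i \<gamma> * (E_pp k l * d \<delta> l) = (E_pp k l * E_pv i \<gamma> - (if l = i then E_pv k \<gamma> else 0)) * d \<delta> l"
      by (simp only: mult.assoc[symmetric])
    also have "\<dots> = E_pp k l * (E_pv i \<gamma> * d \<delta> l) - (if l = i then E_pv k \<gamma> * d \<delta> l else 0)"
      by (simp add: left_diff_distrib mult.assoc)
    finally show ?thesis
      by (auto simp: * right_diff_distrib mult.assoc)
  qed
  then have "E_pv i \<gamma> * E_pv k \<delta> = - (E_pv k \<delta> * E_pv i \<gamma>)
      - (\<Sum>l\<in>UNIV. E_pp k l * d \<delta> i * d \<gamma> l) - E_pv k \<gamma> * d \<delta> i"
    by (simp add: E_pv_def[of k \<delta>] sum_distrib_left sum_distrib_right sum_subtractf sum_negf)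
  moreover have "(\<Sum>l\<in>UNIV. E_pp k l * d \<delta> i * d \<gamma> l) = - (E_pv k \<gamma> * d \<delta> i)"
    by (simp add: E_pv_def sum_distrib_right mult.assoc d_d[of \<delta> i] flip: sum_negf)
  ultimately show ?thesis
    by simp
qed

fun E :: "('m, 'n) symbol \<Rightarrow> ('m, 'n) symbol \<Rightarrow> 'r" where
  "E (Virtual \<gamma>) (Virtual \<delta>) = E_vv \<gamma> \<delta>"
| "E (Virtual \<gamma>) (Proper j) = \<psi> \<gamma> j"
| "E (Proper i) (Virtual \<gamma>) = E_pv i \<gamma>"
| "E (Proper i) (Proper j) = E_pp i j"

text \<open>The relation is symmetric in its two generators, so stating it as a predicate cuts the
  sixteen patterns of virtual and proper symbols to ten.\<close>

definition superbracket_at :: "('m, 'n) symbol \<Rightarrow> ('m, 'n) symbol \<Rightarrow> ('m, 'n) symbol \<Rightarrow> ('m, 'n) symbol \<Rightarrow> bool" where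
  "superbracket_at a b c c' \<longleftrightarrow>
     (let s = if odd (parity a + parity b) \<and> odd (parity c + parity c') then - 1 else 1
      in E a b * E c c' - s * (E c c' * E a b) = (if b = c then E a c' else 0) - s * (if a = c' then E c b else 0))"

lemma superbracket_at_commute: "superbracket_at a b c c' \<Longrightarrow> superbracket_at c c' a b"
  by (auto simp: superbracket_at_def Let_def algebra_simps split: if_splits)

lemma E_superbracket: "superbracket_at a b c c'"
proof -
  note defs = superbracket_at_def Let_def
  have 1: "superbracket_at (Virtual \<gamma>) (Virtual \<delta>) (Virtual \<epsilon>) (Virtual \<zeta>)" for \<gamma> \<delta> \<epsilon> \<zeta>
    by (simp add: defs E_vv_E_vv[of \<gamma> \<delta>])
  have 2: "superbracket_at (Virtual \<gamma>) (Virtual \<delta>) (Proper i) (Proper j)" for \<gamma> \<delta> i j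
    by (simp add: defs E_vv_E_pp)
  have 3: "superbracket_at (Virtual \<gamma>) (Virtual \<delta>) (Proper i) (Virtual \<epsilon>)" for \<gamma> \<delta> i \<epsilon>
    by (simp add: defs E_vv_E_pv)
  have 4: "superbracket_at (Virtual \<gamma>) (Virtual \<delta>) (Virtual \<epsilon>) (Proper i)" for \<gamma> \<delta> i \<epsilon>
    by (simp add: defs E_vv_\<psi>)
  have 5: "superbracket_at (Proper i) (Proper j) (Proper k) (Proper l)" for i j k l
    by (simp add: defs E_pp_E_pp[of i j])
  have 6: "superbracket_at (Proper i) (Proper j) (Proper k) (Virtual \<gamma>)" for i j k \<gamma>
    by (simp add: defs E_pp_E_pv)
  have 7: "superbracket_at (Proper i) (Proper j) (Virtual \<gamma>) (Proper k)" for i j k \<gamma>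
    by (simp add: defs E_pp_\<psi>)
  have 8: "superbracket_at (Proper i) (Virtual \<gamma>) (Proper k) (Virtual \<delta>)" for i \<gamma> k \<delta>
    by (simp add: defs E_pv_E_pv[of i])
  have 9: "superbracket_at (Proper i) (Virtual \<gamma>) (Virtual \<delta>) (Proper k)" for i \<gamma> k \<delta>
    by (simp add: defs E_pv_\<psi>)
  have 10: "superbracket_at (Virtual \<gamma>) (Proper i) (Virtual \<delta>) (Proper k)" for i \<gamma> k \<delta>
    by (simp add: defs \<psi>_\<psi>[of \<gamma>])
  show ?thesis
    by (cases a; cases b; cases c; cases c')
      (simp_all add: 1 2 3 4 5 6 7 8 9 10 superbracket_at_commute[OF 2] superbracket_at_commute[OF 3]
        superbracket_at_commute[OF 4] superbracket_at_commute[OF 6] superbracket_at_commute[OF 7]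
        superbracket_at_commute[OF 9])
qed

end

section \<open>Irregular words\<close>

text \<open>The position counted from the right becomes a splitting of the word: \<open>v\<close> is
  the part acting before the letter \<open>(a, b)\<close>, and \<open>length v\<close> is the index
  \<open>i\<close> of the definition.\<close>

lemma irregular_iff:
  "irregular w \<longleftrightarrow> (\<exists>u a b v \<gamma>. w = u @ (a, b) # v \<and>
     length (filter (\<lambda>x. fst x = Virtual \<gamma>) v) < length (filter (\<lambda>x. snd x = Virtual \<gamma>) ((a, b) # v)))"
proof -
  have count: "card {j. j < length v \<and> P (rev w ! j)} = length (filter P v)"
    if "w = u @ v" for u v and P :: "('a, 'b) gl_index \<Rightarrow> bool"
  proof -
    have "{j. j < length v \<and> P (rev w ! j)} = {j. j < length (rev v) \<and> P (rev v ! j)}"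
      using that by (auto simp: nth_append)
    then show ?thesis
      by (metis length_filter_conv_card length_rev rev_filter)
  qed
  have split: "card {j. j < length v \<and> fst (rev w ! j) = Virtual \<gamma>} = length (filter (\<lambda>x. fst x = Virtual \<gamma>) v)"
    "card {j. j \<le> length v \<and> snd (rev w ! j) = Virtual \<gamma>} = length (filter (\<lambda>x. snd x = Virtual \<gamma>) (x # v))"
    if "w = u @ x # v" for u x v \<gamma>
    using count[of "u @ [x]" v "\<lambda>x. fst x = Virtual \<gamma>"] count[of u "x # v" "\<lambda>x. snd x = Virtual \<gamma>"] that
    by (simp_all add: less_Suc_eq_le)
  show ?thesis
  proof
    assume "irregular w"
    then obtain i \<gamma> where i: "i < length w"
      "card {j. j < i \<and> fst (rev w ! j) = Virtual \<gamma>} < card {j. j \<le> i \<and> snd (rev w ! j) = Virtual \<gamma>}"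
      by (auto simp: irregular_def)
    let ?k = "length w - Suc i"
    have w: "w = take ?k w @ w ! ?k # drop (Suc ?k) w"
      using i(1) by (intro id_take_nth_drop) simp
    let ?v = "drop (Suc ?k) w"
    obtain a b where ab: "w ! ?k = (a, b)"
      by fastforce
    have "length ?v = i"
      using i(1) by simp
    then have "length (filter (\<lambda>x. fst x = Virtual \<gamma>) ?v) < length (filter (\<lambda>x. snd x = Virtual \<gamma>) (w ! ?k # ?v))"
      using i(2) by (simp only: split[OF w, symmetric])
    then have "length (filter (\<lambda>x. fst x = Virtual \<gamma>) ?v) < length (filter (\<lambda>x. snd x = Virtual \<gamma>) ((a, b) # ?v))"
      by (simp only: ab)
    moreover have "w = take ?k w @ (a, b) # ?v"
      using w ab by simp
    ultimately show "\<exists>u a b v \<gamma>. w = u @ (a, b) # v \<and>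
     length (filter (\<lambda>x. fst x = Virtual \<gamma>) v) < length (filter (\<lambda>x. snd x = Virtual \<gamma>) ((a, b) # v))"
      by (intro exI conjI)
  next
    assume "\<exists>u a b v \<gamma>. w = u @ (a, b) # v \<and>
     length (filter (\<lambda>x. fst x = Virtual \<gamma>) v) < length (filter (\<lambda>x. snd x = Virtual \<gamma>) ((a, b) # v))"
    then obtain u a b v \<gamma> where w: "w = u @ (a, b) # v"
      and less: "length (filter (\<lambda>x. fst x = Virtual \<gamma>) v) < length (filter (\<lambda>x. snd x = Virtual \<gamma>) ((a, b) # v))"
      by blast
    have "length v < length w"
      using w by simp
    moreover have "card {j. j < length v \<and> fst (rev w ! j) = Virtual \<gamma>} < card {j. j \<le> length v \<and> snd (rev w ! j) = Virtual \<gamma>}"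
      using less by (simp only: split[OF w])
    ultimately show "irregular w"
      unfolding irregular_def by (intro exI[of _ "length v"] conjI exI[of _ \<gamma>])
  qed
qed

section \<open>The oscillator representation separates the proper part from the irregular ideal\<close>

text \<open>The three operators are those of the locale for the Clifford operators, with
  \<open>L i j\<close> multiplying the coefficients on the left by the generator itself. This choice
  lets the vacuum recover an element of U(gl(n)).\<close>

definition osc_vv :: "'m::finite \<Rightarrow> 'm \<Rightarrow> (('m \<times> 'n::finite) set, ('m, 'n) Ugl) endo" where
  "osc_vv \<gamma> \<delta> = (\<Sum>j\<in>UNIV. creation (\<gamma>, j) * annihilation (\<delta>, j))"

definition osc_pp :: "'n::finite \<Rightarrow> 'n \<Rightarrow> (('m::finite \<times> 'n) set, ('m, 'n) Ugl) endo" where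
  "osc_pp i j = left_mult (e (Proper i) (Proper j)) - (\<Sum>\<gamma>\<in>UNIV. creation (\<gamma>, j) * annihilation (\<gamma>, i))"

definition osc_pv :: "'n::finite \<Rightarrow> 'm::finite \<Rightarrow> (('m \<times> 'n) set, ('m, 'n) Ugl) endo" where
  "osc_pv i \<gamma> = (\<Sum>j\<in>UNIV. osc_pp i j * annihilation (\<gamma>, j))"

fun osc_E :: "('m::finite, 'n::finite) symbol \<Rightarrow> ('m, 'n) symbol \<Rightarrow> (('m \<times> 'n) set, ('m, 'n) Ugl) endo" where
  "osc_E (Virtual \<gamma>) (Virtual \<delta>) = osc_vv \<gamma> \<delta>"
| "osc_E (Virtual \<gamma>) (Proper j) = creation (\<gamma>, j)"
| "osc_E (Proper i) (Virtual \<gamma>) = osc_pv i \<gamma>"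
| "osc_E (Proper i) (Proper j) = osc_pp i j"

lemma oscillator_Ugl:
  "oscillator
    (\<lambda>\<gamma> i. creation (\<gamma> :: 'm::finite, i :: 'n::finite))
    (\<lambda>\<gamma> i. annihilation (\<gamma>, i))
    (\<lambda>i j. left_mult (e (Proper i) (Proper j) :: ('m, 'n) Ugl))"
proof
  fix \<gamma> \<delta> :: 'm and i j k l :: 'n
  show "creation (\<gamma>, i) * creation (\<delta>, j) = - (creation (\<delta>, j) * (creation (\<gamma>, i) :: (('m \<times> 'n) set, ('m, 'n) Ugl) endo))"
    by (rule creation_anticommute)
  show "annihilation (\<gamma>, i) * annihilation (\<delta>, j) =
      - (annihilation (\<delta>, j) * (annihilation (\<gamma>, i) :: (('m \<times> 'n) set, ('m, 'n) Ugl) endo))"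
    by (rule annihilation_anticommute)
  show "annihilation (\<gamma>, i) * creation (\<delta>, j) =
      - (creation (\<delta>, j) * annihilation (\<gamma>, i)) +
      (if \<gamma> = \<delta> \<and> i = j then 1 else 0 :: (('m \<times> 'n) set, ('m, 'n) Ugl) endo)"
    by (simp add: annihilation_creation)
  show "left_mult (e (Proper i) (Proper j) :: ('m, 'n) Ugl) * creation (\<gamma>, k) =
      creation (\<gamma>, k) * left_mult (e (Proper i) (Proper j))"
    by (rule left_mult_creation)
  show "left_mult (e (Proper i) (Proper j) :: ('m, 'n) Ugl) * annihilation (\<gamma>, k) =
      annihilation (\<gamma>, k) * left_mult (e (Proper i) (Proper j))"
    by (rule left_mult_annihilation)
  have "e (Proper i) (Proper j) * e (Proper k) (Proper l) =
      (e (Proper k) (Proper l) * e (Proper i) (Proper j) +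
      (if j = k then e (Proper i) (Proper l) else 0) - (if i = l then e (Proper k) (Proper j) else 0) :: ('m, 'n) Ugl)"
    using e_even_commute[of "Proper i" "Proper j" "Proper k" "Proper l"] by simp
  then show "left_mult (e (Proper i) (Proper j) :: ('m, 'n) Ugl) * left_mult (e (Proper k) (Proper l)) =
       left_mult (e (Proper k) (Proper l)) * left_mult (e (Proper i) (Proper j)) +
       (if j = k then left_mult (e (Proper i) (Proper l)) else 0) -
       (if i = l then left_mult (e (Proper k) (Proper j)) else (0 :: (('m \<times> 'n) set, ('m, 'n) Ugl) endo))"
    by (simp add: left_mult_mult[symmetric]) (simp add: left_mult_add left_mult_diff left_mult_mult)
qed

lemma osc_E_superbracket:
  fixes a b c c' :: "('m::finite, 'n::finite) symbol"
  defines "s \<equiv> if odd (parity a + parity b) \<and> odd (parity c + parity c') then - 1 else 1"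
  shows "osc_E a b * osc_E c c' - s * (osc_E c c' * osc_E a b) =
    (if b = c then osc_E a c' else 0) - s * (if a = c' then osc_E c b else 0)"
proof -
  interpret oscillator
    "\<lambda>\<gamma> i. creation (\<gamma> :: 'm, i :: 'n)" "\<lambda>\<gamma> i. annihilation (\<gamma>, i)"
    "\<lambda>i j. left_mult (e (Proper i) (Proper j) :: ('m, 'n) Ugl)"
    by (rule oscillator_Ugl)
  have "E a b = osc_E a b" for a b
    by (cases a; cases b) (simp_all add: E_vv_def E_pp_def E_pv_def osc_vv_def osc_pp_def osc_pv_def)
  then show ?thesis
    using E_superbracket[of a b c c'] by (simp only: superbracket_at_def Let_def s_def)
qed

lemma cscale_osc_E_commute:
  "left_mult (cscale z 1) * osc_E a b = osc_E a b * (left_mult (cscale z 1) :: (('m::finite \<times> 'n::finite) set, ('m, 'n) Ugl) endo)"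
proof -
  let ?z = "left_mult (cscale z 1) :: (('m \<times> 'n) set, ('m, 'n) Ugl) endo"
  have prod: "?z * (S * T) = S * T * ?z" if "?z * S = S * ?z" "?z * T = T * ?z" for S T
    by (simp add: mult.assoc[symmetric] that(1)) (simp add: mult.assoc that(2))
  note [simp] = left_mult_creation[of "cscale z 1"] left_mult_annihilation[of "cscale z 1"]
  have "?z * left_mult x = left_mult x * ?z" for x
    by (simp add: left_mult_mult[symmetric] cscale_one_commute)
  then have pp: "?z * osc_pp i j = osc_pp i j * ?z" for i j
    by (simp add: osc_pp_def right_diff_distrib left_diff_distrib sum_distrib_left sum_distrib_right prod)
  have vv: "?z * osc_vv \<gamma> \<delta> = osc_vv \<gamma> \<delta> * ?z" for \<gamma> \<delta>
    by (simp add: osc_vv_def sum_distrib_left sum_distrib_right prod)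
  have pv: "?z * osc_pv i \<gamma> = osc_pv i \<gamma> * ?z" for i \<gamma>
    by (simp add: osc_pv_def sum_distrib_left sum_distrib_right prod pp)
  show ?thesis
    by (cases a; cases b) (simp_all add: pp vv pv)
qed

interpretation osc: ugl_family
  "\<lambda>z. left_mult (cscale z 1) :: (('m::finite \<times> 'n::finite) set, ('m, 'n) Ugl) endo" osc_E
proof
  fix z z' and a b c d :: "('m, 'n) symbol"
  show "left_mult (cscale (z + z') 1) = left_mult (cscale z 1) + (left_mult (cscale z' 1) :: (('m \<times> 'n) set, ('m, 'n) Ugl) endo)"
    by (simp add: cscale_add_scalar left_mult_add)
  show "left_mult (cscale (z * z') 1) = left_mult (cscale z 1) * (left_mult (cscale z' 1) :: (('m \<times> 'n) set, ('m, 'n) Ugl) endo)"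
    by (simp add: cscale_mult_left cscale_cscale flip: left_mult_mult)
  show "left_mult (cscale 1 1) = (1 :: (('m \<times> 'n) set, ('m, 'n) Ugl) endo)"
    by simp
  show "left_mult (cscale z 1) * osc_E a b = osc_E a b * (left_mult (cscale z 1) :: (('m \<times> 'n) set, ('m, 'n) Ugl) endo)"
    by (rule cscale_osc_E_commute)
  have "left_mult (cscale (super_sign (a, b) (c, d)) 1) =
      ((if odd (parity a + parity b) \<and> odd (parity c + parity d) then - 1 else 1) :: (('m \<times> 'n) set, ('m, 'n) Ugl) endo)"
    using left_mult_diff[of 0 1] by (auto simp: super_sign_cases)
  then show "osc_E a b * osc_E c d -
       left_mult (cscale (super_sign (a, b) (c, d)) 1) * (osc_E c d * osc_E a b) =
       (if b = c then osc_E a d else 0) -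
       left_mult (cscale (super_sign (a, b) (c, d)) 1) * (if a = d then osc_E c b else (0 :: (('m \<times> 'n) set, ('m, 'n) Ugl) endo))"
    using osc_E_superbracket[of a b c d] by (simp only:)
qed

definition osc_val :: "('m::finite, 'n::finite) Ugl \<Rightarrow> (('m \<times> 'n) set, ('m, 'n) Ugl) endo" where
  "osc_val = osc.val"

lemmas osc_val_simps = osc.val_add osc.val_mult osc.val_one osc.val_zero osc.val_cscale osc.val_e

lemmas osc_val = osc_val_simps[folded osc_val_def]

section \<open>Grading by the occurrences of one virtual symbol\<close>

definition has_degree :: "'m \<Rightarrow> (('m \<times> 'n) set \<Rightarrow> 'a::zero) \<Rightarrow> int \<Rightarrow> bool" where
  "has_degree \<gamma> f k \<longleftrightarrow> (\<forall>S. f S \<noteq> 0 \<longrightarrow> int (card {x\<in>S. fst x = \<gamma>}) = k)"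

text \<open>Degrees are integers because annihilators may lower them below zero, where only the zero
  function is homogeneous.\<close>

definition shifts_degree :: "'m \<Rightarrow> (('m \<times> 'n) set, 'a::ring_1) endo \<Rightarrow> int \<Rightarrow> bool" where
  "shifts_degree \<gamma> T k \<longleftrightarrow> (\<forall>f l. has_degree \<gamma> f l \<longrightarrow> has_degree \<gamma> (Rep_endo T f) (l + k))"

lemma has_degreeD: "has_degree \<gamma> f k \<Longrightarrow> int (card {x\<in>S. fst x = \<gamma>}) \<noteq> k \<Longrightarrow> f S = 0"
  by (auto simp: has_degree_def)

lemma has_degreeI: "(\<And>S. f S \<noteq> 0 \<Longrightarrow> int (card {x\<in>S. fst x = \<gamma>}) = k) \<Longrightarrow> has_degree \<gamma> f k"
  by (simp add: has_degree_def)

lemma has_degree_nonzero: "has_degree \<gamma> f k \<Longrightarrow> f S \<noteq> 0 \<Longrightarrow> int (card {x\<in>S. fst x = \<gamma>}) = k"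
  by (simp add: has_degree_def)

lemma shifts_degreeD: "shifts_degree \<gamma> T k \<Longrightarrow> has_degree \<gamma> f l \<Longrightarrow> has_degree \<gamma> (Rep_endo T f) (l + k)"
  by (simp add: shifts_degree_def)

lemma shifts_degree_nonzero:
  assumes T: "shifts_degree \<gamma> T k" and f: "has_degree \<gamma> f l"
  shows "Rep_endo T f X \<noteq> 0 \<Longrightarrow> int (card {x \<in> X. fst x = \<gamma>}) = l + k"
  using has_degree_nonzero[of \<gamma> "Rep_endo T f" "l + k" X] shifts_degreeD[OF T f] by simp

lemma shifts_degree_creation:
  "shifts_degree \<gamma> (creation (\<delta> :: 'm::finite, j :: 'n::finite) :: (_, 'a::ring_1) endo) (of_bool (\<delta> = \<gamma>))"
  unfolding shifts_degree_def
proof (intro allI impI)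
  fix f :: "('m \<times> 'n) set \<Rightarrow> 'a" and l assume f: "has_degree \<gamma> f l"
  have "int (card {x\<in>S. fst x = \<gamma>}) = l + of_bool (\<delta> = \<gamma>)" if "(\<delta>, j) \<in> S" "f (S - {(\<delta>, j)}) \<noteq> 0" for S
  proof -
    have "{x\<in>S. fst x = \<gamma>} = (if \<delta> = \<gamma> then insert (\<delta>, j) {x \<in> S - {(\<delta>, j)}. fst x = \<gamma>} else {x \<in> S - {(\<delta>, j)}. fst x = \<gamma>})"
      using that(1) by auto
    then have "card {x\<in>S. fst x = \<gamma>} = card {x \<in> S - {(\<delta>, j)}. fst x = \<gamma>} + of_bool (\<delta> = \<gamma>)"
      by simp
    moreover have "int (card {x \<in> S - {(\<delta>, j)}. fst x = \<gamma>}) = l"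
      using f that(2) by (auto simp: has_degree_def)
    ultimately show ?thesis
      by simp
  qed
  then show "has_degree \<gamma> (Rep_endo (creation (\<delta>, j)) f) (l + of_bool (\<delta> = \<gamma>))"
    by (auto simp: has_degree_def creation.rep_eq dest!: mult_not_zero split: if_splits)
qed

lemma shifts_degree_annihilation:
  "shifts_degree \<gamma> (annihilation (\<delta> :: 'm::finite, j :: 'n::finite) :: (_, 'a::ring_1) endo) (- of_bool (\<delta> = \<gamma>))"
  unfolding shifts_degree_def
proof (intro allI impI)
  fix f :: "('m \<times> 'n) set \<Rightarrow> 'a" and l assume f: "has_degree \<gamma> f l"
  have "int (card {x\<in>S. fst x = \<gamma>}) = l + - of_bool (\<delta> = \<gamma>)" if "(\<delta>, j) \<notin> S" "f (insert (\<delta>, j) S) \<noteq> 0" for S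
  proof -
    have *: "{x \<in> insert (\<delta>, j) S. fst x = \<gamma>} = (if \<delta> = \<gamma> then insert (\<delta>, j) {x \<in> S. fst x = \<gamma>} else {x \<in> S. fst x = \<gamma>})"
      by auto
    have "card {x \<in> insert (\<delta>, j) S. fst x = \<gamma>} = card {x \<in> S. fst x = \<gamma>} + of_bool (\<delta> = \<gamma>)"
      by (subst *) (use that(1) in auto)
    moreover have "int (card {x \<in> insert (\<delta>, j) S. fst x = \<gamma>}) = l"
      using f that(2) unfolding has_degree_def by blast
    ultimately show ?thesis
      by simp
  qed
  then show "has_degree \<gamma> (Rep_endo (annihilation (\<delta>, j)) f) (l + - of_bool (\<delta> = \<gamma>))"
    by (auto simp: has_degree_def annihilation.rep_eq dest!: mult_not_zero split: if_splits)
qed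

lemma shifts_degree_left_mult: "shifts_degree \<gamma> (left_mult x) 0"
proof -
  have "x * f S \<noteq> 0 \<Longrightarrow> f S \<noteq> 0" for f :: "('a \<times> 'b) set \<Rightarrow> 'c" and S
    by auto
  then show ?thesis
    by (simp add: shifts_degree_def has_degree_def left_mult.rep_eq)
qed

lemma shifts_degree_diff:
  assumes S: "shifts_degree \<gamma> S k" and T: "shifts_degree \<gamma> T k"
  shows "shifts_degree \<gamma> (S - T) k"
  unfolding shifts_degree_def
proof (intro allI impI has_degreeI)
  fix f l X
  assume f: "has_degree \<gamma> f l" and "Rep_endo (S - T) f X \<noteq> 0"
  then have "Rep_endo S f X - Rep_endo T f X \<noteq> 0"
    by (simp only: minus_endo.rep_eq not_False_eq_True)
  then have "Rep_endo S f X \<noteq> 0 \<or> Rep_endo T f X \<noteq> 0"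
    by (metis diff_self)
  then show "int (card {x \<in> X. fst x = \<gamma>}) = l + k"
    by (rule disjE) (erule shifts_degree_nonzero[OF S f, of X] shifts_degree_nonzero[OF T f, of X])+
qed

lemma shifts_degree_sum:
  assumes "\<And>x. x \<in> A \<Longrightarrow> shifts_degree \<gamma> (T x) k"
  shows "shifts_degree \<gamma> (\<Sum>x\<in>A. T x) k"
  unfolding shifts_degree_def
proof (intro allI impI has_degreeI)
  fix f l X
  assume f: "has_degree \<gamma> f l" and "Rep_endo (\<Sum>x\<in>A. T x) f X \<noteq> 0"
  then have "(\<Sum>x\<in>A. Rep_endo (T x) f X) \<noteq> 0"
    by (simp only: Rep_endo_sum not_False_eq_True)
  then obtain x where x: "x \<in> A" "Rep_endo (T x) f X \<noteq> 0"
    by (rule sum.not_neutral_contains_not_neutral)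
  show "int (card {x \<in> X. fst x = \<gamma>}) = l + k"
    by (rule shifts_degree_nonzero[OF assms[OF x(1)] f x(2)])
qed

lemma shifts_degree_mult:
  assumes S: "shifts_degree \<gamma> S k" and T: "shifts_degree \<gamma> T l"
  shows "shifts_degree \<gamma> (S * T) (k + l)"
  unfolding shifts_degree_def
proof (intro allI impI)
  fix f :: "('a \<times> 'b) set \<Rightarrow> 'c" and r
  assume "has_degree \<gamma> f r"
  from shifts_degreeD[OF S shifts_degreeD[OF T this]]
  show "has_degree \<gamma> (Rep_endo (S * T) f) (r + (k + l))"
    by (simp add: times_endo.rep_eq add.assoc add.commute[of k])
qed

lemma shifts_degree_E_pp: "shifts_degree \<gamma> (osc_pp i j) 0"
proof -
  have "shifts_degree \<gamma> (creation (\<delta>, j) * annihilation (\<delta>, i)) 0" for \<delta>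
    using shifts_degree_mult[OF shifts_degree_creation[of \<gamma> \<delta> j] shifts_degree_annihilation[of \<gamma> \<delta> i]] by simp
  then show ?thesis
    unfolding osc_pp_def by (intro shifts_degree_diff shifts_degree_left_mult shifts_degree_sum)
qed

lemma shifts_degree_E: "shifts_degree \<gamma> (osc_E a b) (of_bool (a = Virtual \<gamma>) - of_bool (b = Virtual \<gamma>))"
proof -
  have vv: "shifts_degree \<gamma> (osc_vv \<delta> \<epsilon>) (of_bool (\<delta> = \<gamma>) - of_bool (\<epsilon> = \<gamma>))" for \<delta> \<epsilon>
    unfolding osc_vv_def diff_conv_add_uminus
    by (intro shifts_degree_sum shifts_degree_mult shifts_degree_creation shifts_degree_annihilation)
  have *: "shifts_degree \<gamma> (osc_pv i \<delta>) (0 + - of_bool (\<delta> = \<gamma>))" for i \<delta>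
    unfolding osc_pv_def
    by (intro shifts_degree_sum shifts_degree_mult shifts_degree_E_pp shifts_degree_annihilation)
  have pv: "shifts_degree \<gamma> (osc_pv i \<gamma>) (- 1)" for i
    using *[of i \<gamma>] by simp
  have pv': "shifts_degree \<gamma> (osc_pv i \<delta>) 0" if "\<delta> \<noteq> \<gamma>" for i \<delta>
    using *[of i \<delta>] that by simp
  show ?thesis
    by (cases a; cases b) (simp_all add: vv pv pv' shifts_degree_E_pp shifts_degree_creation)
qed

text \<open>The value at \<open>S\<close> reads \<open>f\<close> at a set containing
  \<open>(\<gamma>, j)\<close>. Such a set has positive degree, so \<open>f\<close> vanishes
  there.\<close>

lemma annihilation_degree_nonpos:
  assumes "has_degree \<gamma> f k" "k \<le> 0"
  shows "Rep_endo (annihilation (\<gamma>, j)) f = (\<lambda>S. 0)"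
proof -
  have "f (insert (\<gamma>, j) S) = 0" if "(\<gamma>, j) \<notin> S" for S
  proof (rule has_degreeD[OF assms(1)])
    have "(\<gamma>, j) \<in> {x \<in> insert (\<gamma>, j) S. fst x = \<gamma>}"
      by simp
    then have "card {x \<in> insert (\<gamma>, j) S. fst x = \<gamma>} > 0"
      by (subst card_gt_0_iff) auto
    with assms(2) show "int (card {x \<in> insert (\<gamma>, j) S. fst x = \<gamma>}) \<noteq> k"
      by linarith
  qed
  then show ?thesis
    by (simp add: annihilation.rep_eq fun_eq_iff)
qed

text \<open>In \<open>osc_vv\<close> and \<open>osc_pv\<close> the annihilator of \<gamma> stands on
  the right, hence acts first.\<close>

lemma E_degree_nonpos:
  assumes "has_degree \<gamma> f k" "k \<le> 0"
  shows "Rep_endo (osc_E a (Virtual \<gamma>)) f = (\<lambda>S. 0)"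
  by (cases a) (simp_all add: fun_eq_iff osc_vv_def osc_pv_def Rep_endo_sum times_endo.rep_eq
      annihilation_degree_nonpos[OF assms] Rep_endo_zero)

definition vacuum :: "'a::ring_1 \<Rightarrow> ('m \<times> 'n) set \<Rightarrow> 'a" where
  "vacuum x S = (if S = {} then x else 0)"

lemma has_degree_vacuum: "has_degree \<gamma> (vacuum x) 0"
  by (simp add: has_degree_def vacuum_def)


lemma has_degree_word:
  "has_degree \<gamma> (Rep_endo (osc_val (e_monomial w)) (vacuum 1))
    (int (length (filter (\<lambda>x. fst x = Virtual \<gamma>) w)) - int (length (filter (\<lambda>x. snd x = Virtual \<gamma>) w)))"
proof (induction w)
  case Nil
  then show ?case
    by (simp add: e_monomial_def osc_val one_endo.rep_eq has_degree_vacuum)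
next
  case (Cons x w)
  obtain a b where x: "x = (a, b)"
    by fastforce
  have val: "osc_val (e_monomial (x # w)) = osc_E a b * osc_val (e_monomial w)"
    by (simp add: x e_monomial_def osc_val)
  have degree: "int (length (filter (\<lambda>x. fst x = Virtual \<gamma>) (x # w))) - int (length (filter (\<lambda>x. snd x = Virtual \<gamma>) (x # w)))
      = int (length (filter (\<lambda>x. fst x = Virtual \<gamma>) w)) - int (length (filter (\<lambda>x. snd x = Virtual \<gamma>) w))
        + (of_bool (a = Virtual \<gamma>) - of_bool (b = Virtual \<gamma>))"
    by (simp add: x)
  show ?case
    unfolding val degree times_endo.rep_eq by (rule shifts_degreeD[OF shifts_degree_E Cons])
qed

text \<open>The vector produced by \<open>v\<close> has degree at most zero in \<gamma>. If
  \<open>b\<close> is \<gamma>, the letter \<open>(a, b)\<close> kills it; otherwise the degree is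
  already negative and the vector is zero.\<close>

lemma irregular_vacuum:
  assumes "irregular w"
  shows "Rep_endo (osc_val (e_monomial w)) (vacuum 1) = (\<lambda>S. 0)"
proof -
  obtain u a b v \<gamma> where w: "w = u @ (a, b) # v"
    and less: "length (filter (\<lambda>x. fst x = Virtual \<gamma>) v) < length (filter (\<lambda>x. snd x = Virtual \<gamma>) ((a, b) # v))"
    using assms unfolding irregular_iff by (elim exE conjE)
  let ?f = "Rep_endo (osc_val (e_monomial v)) (vacuum 1)"
  have "Rep_endo (osc_E a b) ?f = (\<lambda>S. 0)"
  proof (cases "b = Virtual \<gamma>")
    case True
    with less show ?thesis
      by (simp only: True, intro E_degree_nonpos[OF has_degree_word]) auto
  next
    case False
    have "?f = (\<lambda>S. 0)"
    proof
      fix S show "?f S = 0"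
        by (rule has_degreeD[OF has_degree_word[of \<gamma>]]) (use less False in auto)
    qed
    then show ?thesis
      by (simp add: Rep_endo_zero)
  qed
  moreover have "osc_val (e_monomial w) = osc_val (e_monomial u) * (osc_E a b * osc_val (e_monomial v))"
    by (simp add: w e_monomial_def osc_val)
  ultimately show ?thesis
    by (simp add: times_endo.rep_eq Rep_endo_zero)
qed

lemma Irr_vacuum:
  assumes "x \<in> Irr"
  shows "Rep_endo (osc_val x) (vacuum 1) = (\<lambda>S. 0)"
  using assms unfolding Irr_def
proof induction
  case zero
  then show ?case
    by (simp add: osc_val zero_endo.rep_eq)
next
  case (step r y u)
  then show ?case
    by (auto simp: osc_val plus_endo.rep_eq times_endo.rep_eq irregular_vacuum Rep_endo_zero)
qed

lemma mult_vacuum: "x * vacuum y S = vacuum (x * y) S"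
  by (simp add: vacuum_def)

text \<open>The coefficient \<open>y\<close> is arbitrary so that a product can be treated factor by
  factor. On the vacuum the creator part of \<open>osc_pp\<close> vanishes and left multiplication
  remains.\<close>

lemma U_proper_vacuum:
  assumes "x \<in> U_proper"
  shows "Rep_endo (osc_val x) (vacuum y) = vacuum (x * y)"
  using assms unfolding U_proper_def
proof (induction arbitrary: y)
  case (gen x)
  then obtain i j where x: "x = e (Proper i) (Proper j)"
    by blast
  have *: "Rep_endo (annihilation (\<gamma>, i)) (vacuum y) = (\<lambda>S. 0)" for \<gamma>
    by (rule annihilation_degree_nonpos[OF has_degree_vacuum]) simp
  have "Rep_endo (osc_val x) (vacuum y) S = x * vacuum y S" for S
    by (simp add: x osc_val osc_pp_def minus_endo.rep_eq left_mult.rep_eq Rep_endo_sum times_endo.rep_eq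
        * Rep_endo_zero)
  then show ?case
    by (simp add: fun_eq_iff mult_vacuum)
next
  case one
  then show ?case
    by (simp add: osc_val one_endo.rep_eq)
next
  case (add x x')
  then show ?case
    by (simp add: osc_val plus_endo.rep_eq add.IH) (simp add: fun_eq_iff vacuum_def distrib_right)
next
  case (mult x x')
  then show ?case
    by (simp add: osc_val times_endo.rep_eq mult.assoc)
next
  case (scale x c)
  then show ?case
    by (simp add: osc_val times_endo.rep_eq left_mult.rep_eq scale.IH cscale_mult_left)
      (simp add: fun_eq_iff vacuum_def)
qed

lemma U_proper_Int_Irr:
  fixes u :: "('m::finite, 'n::finite) Ugl"
  assumes "u \<in> U_proper" "u \<in> Irr"
  shows "u = 0"
proof -
  have "vacuum u = (\<lambda>S :: ('m \<times> 'n) set. 0)"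
    using Irr_vacuum[OF assms(2)] U_proper_vacuum[OF assms(1), of 1] by simp
  then have "vacuum u ({} :: ('m \<times> 'n) set) = 0"
    by (rule fun_cong)
  then show ?thesis
    by (simp add: vacuum_def)
qed

section \<open>Column determinants\<close>

text \<open>Indexing by a set of naturals lets a principal minor keep the original numbering of its
  entries.\<close>

definition set_cdet :: "nat set \<Rightarrow> (nat \<Rightarrow> nat \<Rightarrow> 'a::ring_1) \<Rightarrow> 'a" where
  "set_cdet S M = (\<Sum>\<sigma> | \<sigma> permutes S. of_int (sign \<sigma>) * prod_list (map (\<lambda>s. M (\<sigma> s) s) (sorted_list_of_set S)))"

lemma cdet_eq_set_cdet: "cdet j M = set_cdet {1..j} M"
proof -
  have "sorted_list_of_set {1..j} = [1..<Suc j]"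
    by (metis atLeastLessThanSuc_atLeastAtMost sorted_list_of_set_range)
  then show ?thesis
    by (simp only: cdet_def set_cdet_def)
qed

text \<open>Conjugation by the increasing enumeration of \<open>A\<close> identifies the
  permutations, preserves their signs and keeps the order of the columns.\<close>

lemma set_cdet_reindex:
  assumes "finite A"
  defines "i \<equiv> \<lambda>r. sorted_list_of_set A ! (r - 1)"
  shows "cdet (card A) (\<lambda>r s. M (i r) (i s)) = set_cdet A M"
proof -
  let ?J = "{1..card A}"
  have len: "length (sorted_list_of_set A) = card A"
    using assms by simp
  have list: "map i [1..<Suc (card A)] = sorted_list_of_set A"
    by (rule nth_equalityI) (simp_all add: i_def len del: upt_Suc)
  have inj: "inj_on i ?J"
    using assms by (auto simp: inj_on_def i_def nth_eq_iff_index_eq)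
  have img: "i ` ?J = A"
  proof -
    have "i ` ?J = set (map i [1..<Suc (card A)])"
      by (auto simp del: upt_Suc)
    then show ?thesis
      using assms(1) by (simp only: list set_sorted_list_of_set)
  qed
  have bij: "bij_betw i ?J A"
    using inj img by (simp add: bij_betw_def)
  have "map_permutation ?J i = (\<lambda>\<pi> x. if x \<in> A then i (\<pi> (inv_into ?J i x)) else x)"
    by (intro ext) (simp only: map_permutation_def restrict_id_def img o_apply)
  then have bij': "bij_betw (map_permutation ?J i) {\<sigma>. \<sigma> permutes ?J} {\<sigma>. \<sigma> permutes A}"
    using bij_betw_permutations[OF bij] by simp
  have "set_cdet A M = (\<Sum>\<sigma> | \<sigma> permutes ?J. of_int (sign (map_permutation ?J i \<sigma>)) *
      prod_list (map (\<lambda>s. M (map_permutation ?J i \<sigma> s) s) (sorted_list_of_set A)))"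
    unfolding set_cdet_def by (rule sum.reindex_bij_betw[OF bij', symmetric])
  also have "\<dots> = cdet (card A) (\<lambda>r s. M (i r) (i s))"
    unfolding cdet_def
  proof (rule sum.cong[OF refl])
    fix \<sigma> assume "\<sigma> \<in> {\<sigma>. \<sigma> permutes ?J}"
    then have \<sigma>: "\<sigma> permutes ?J"
      by simp
    have "map (\<lambda>s. M (map_permutation ?J i \<sigma> s) s) (sorted_list_of_set A) =
        map (\<lambda>s. M (i (\<sigma> s)) (i s)) [1..<Suc (card A)]"
      unfolding list[symmetric] map_map
      by (rule map_cong[OF refl]) (use \<sigma> inj in \<open>auto simp: map_permutation_apply\<close>)
    with \<sigma> inj show "of_int (sign (map_permutation ?J i \<sigma>)) *
        prod_list (map (\<lambda>s. M (map_permutation ?J i \<sigma> s) s) (sorted_list_of_set A)) =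
      of_int (sign \<sigma>) * prod_list (map (\<lambda>s. M (i (\<sigma> s)) (i s)) [1..<Suc (card A)])"
      by (simp add: sign_map_permutation)
  qed
  finally show ?thesis
    by simp
qed

text \<open>This turns the constant \<open>j - r\<close> of a Capelli element into the number of
  larger elements of the index set, which no longer refers to an enumeration.\<close>

lemma card_greater_sorted_list_of_set:
  assumes "finite A" "r \<in> {1..card A}"
  shows "card {s\<in>A. sorted_list_of_set A ! (r - 1) < s} = card A - r"
proof -
  let ?l = "sorted_list_of_set A"
  have len: "length ?l = card A" and set: "set ?l = A" and sorted: "sorted_wrt (<) ?l"
    using assms by (simp_all add: strict_sorted_list_of_set)
  have less: "?l ! a < ?l ! b \<longleftrightarrow> a < b" if "a < card A" "b < card A" for a b
    using sorted_wrt_nth_less[OF sorted, of a b] sorted_wrt_nth_less[OF sorted, of b a] that len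
    by (cases a b rule: linorder_cases) auto
  have "{s\<in>A. ?l ! (r - 1) < s} = (!) ?l ` {r..<card A}"
  proof
    show "{s\<in>A. ?l ! (r - 1) < s} \<subseteq> (!) ?l ` {r..<card A}"
    proof
      fix s assume s: "s \<in> {s\<in>A. ?l ! (r - 1) < s}"
      then obtain b where b: "b < card A" "s = ?l ! b"
        using set len by (metis (mono_tags, lifting) in_set_conv_nth mem_Collect_eq)
      moreover have "r - 1 < card A"
        using assms(2) by auto
      ultimately have "r \<le> b"
        using s less[of "r - 1" b] by auto
      with b show "s \<in> (!) ?l ` {r..<card A}"
        by (auto intro!: imageI)
    qed
    show "(!) ?l ` {r..<card A} \<subseteq> {s\<in>A. ?l ! (r - 1) < s}"
    proof
      fix s assume "s \<in> (!) ?l ` {r..<card A}"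
      then obtain b where b: "r \<le> b" "b < card A" "s = ?l ! b"
        by auto
      then have "s \<in> A"
        using set len nth_mem by metis
      with b less[of "r - 1" b] assms show "s \<in> {s\<in>A. ?l ! (r - 1) < s}"
        by auto
    qed
  qed
  moreover have "inj_on ((!) ?l) {r..<card A}"
    using assms by (auto simp: inj_on_def nth_eq_iff_index_eq)
  ultimately show ?thesis
    by (simp add: card_image)
qed

lemma sum_Pow_insert:
  assumes "finite F" "x \<notin> F"
  shows "sum f (Pow (insert x F)) = sum f (Pow F) + (\<Sum>A\<in>Pow F. f (insert x A))"
proof -
  have "inj_on (insert x) (Pow F)"
    using assms(2) by (auto simp: inj_on_def)
  then have "sum f (insert x ` Pow F) = (\<Sum>A\<in>Pow F. f (insert x A))"
    by (simp add: sum.reindex)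
  moreover have "sum f (Pow F \<union> insert x ` Pow F) = sum f (Pow F) + sum f (insert x ` Pow F)"
    using assms by (intro sum.union_disjoint) auto
  ultimately show ?thesis
    by (simp add: Pow_insert)
qed

lemma of_int_mult_left_commute: "of_int m * (x * y) = x * (of_int m * (y :: 'a::ring_1))"
  by (metis mult.assoc mult_of_int_commute)

text \<open>Multiply out: \<open>A\<close> is the set of factors from which \<open>a\<close> is
  taken, and the central integers are collected in front.\<close>

lemma prod_list_add_int:
  fixes a :: "'i \<Rightarrow> 'a::ring_1"
  assumes "distinct l"
  shows "prod_list (map (\<lambda>s. a s + of_int (b s)) l) =
    (\<Sum>A\<in>Pow (set l). of_int (\<Prod>s\<in>set l - A. b s) * prod_list (map a (filter (\<lambda>s. s \<in> A) l)))"
  using assms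
proof (induction l)
  case (Cons x l)
  let ?G = "\<lambda>A. of_int (\<Prod>s\<in>set (x # l) - A. b s) * prod_list (map a (filter (\<lambda>s. s \<in> A) (x # l)))"
  let ?f = "\<lambda>A. of_int (\<Prod>s\<in>set l - A. b s) * prod_list (map a (filter (\<lambda>s. s \<in> A) l))"
  have 1: "?G A = of_int (b x) * ?f A"
    if "A \<in> Pow (set l)" for A
  proof -
    have "set (x # l) - A = insert x (set l - A)"
      using that Cons.prems by auto
    moreover have "x \<notin> A"
      using that Cons.prems by auto
    ultimately show ?thesis
      using Cons.prems by (simp add: mult.assoc)
  qed
  have 2: "?G (insert x A) = a x * ?f A"
    if "A \<in> Pow (set l)" for A
  proof -
    have "set (x # l) - insert x A = set l - A"
      using Cons.prems by auto
    moreover have "filter (\<lambda>s. s \<in> insert x A) l = filter (\<lambda>s. s \<in> A) l"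
      using Cons.prems by (intro filter_cong) auto
    ultimately show ?thesis
      by (simp add: mult.assoc of_int_mult_left_commute[of _ "a x"])
  qed
  have "prod_list (map (\<lambda>s. a s + of_int (b s)) (x # l)) = (\<Sum>A\<in>Pow (set l). of_int (b x) * ?f A) + (\<Sum>A\<in>Pow (set l). a x * ?f A)"
    using Cons by (simp add: distrib_right sum_distrib_left sum.distrib)
  moreover have "sum ?G (Pow (set (x # l))) = sum ?G (Pow (set l)) + (\<Sum>A\<in>Pow (set l). ?G (insert x A))"
    using Cons.prems sum_Pow_insert[of "set l" x ?G] by (simp only: list.set distinct.simps finite_set simp_thms)
  moreover have "sum ?G (Pow (set l)) = (\<Sum>A\<in>Pow (set l). of_int (b x) * ?f A)"
    by (rule sum.cong[OF refl 1])
  moreover have "(\<Sum>A\<in>Pow (set l). ?G (insert x A)) = (\<Sum>A\<in>Pow (set l). a x * ?f A)"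
    by (rule sum.cong[OF refl 2])
  ultimately show ?case
    by (simp only:)
qed simp

lemma filter_sorted_list_of_set:
  assumes "finite S" "A \<subseteq> S"
  shows "filter (\<lambda>s. s \<in> A) (sorted_list_of_set S) = sorted_list_of_set A"
proof -
  have "finite A"
    using assms finite_subset by blast
  moreover have "set (filter (\<lambda>s. s \<in> A) (sorted_list_of_set S)) = A"
    using assms by auto
  ultimately show ?thesis
    using assms(1) by (intro sorted_distinct_set_unique) (auto intro: sorted_wrt_filter)
qed

text \<open>\<open>A\<close> is the set of columns in which the entry of \<open>N\<close> is taken.
  In the other columns a scalar occurs only on the diagonal, so the permutation must fix the
  complement of \<open>A\<close>, and a principal minor on \<open>A\<close> remains.\<close>

lemma set_cdet_add_diagonal:
  fixes N :: "nat \<Rightarrow> nat \<Rightarrow> 'a::ring_1"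
  assumes S: "finite S"
  shows "set_cdet S (\<lambda>r s. N r s + (if r = s then of_int (x r) else 0)) =
    (\<Sum>A\<in>Pow S. of_int (\<Prod>s\<in>S - A. x s) * set_cdet A N)"
proof -
  let ?g = "\<lambda>A \<sigma>. of_int (sign \<sigma>) * prod_list (map (\<lambda>s. N (\<sigma> s) s) (sorted_list_of_set A))"
  let ?p = "\<lambda>A \<sigma>. of_int (\<Prod>s\<in>S - A. if \<sigma> s = s then x s else 0) :: 'a"
  have "set_cdet S (\<lambda>r s. N r s + (if r = s then of_int (x r) else 0)) =
      (\<Sum>\<sigma> | \<sigma> permutes S. \<Sum>A\<in>Pow S. ?p A \<sigma> * ?g A \<sigma>)"
    unfolding set_cdet_def
  proof (rule sum.cong[OF refl])
    fix \<sigma> assume "\<sigma> \<in> {\<sigma>. \<sigma> permutes S}"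
    have "map (\<lambda>s. N (\<sigma> s) s + (if \<sigma> s = s then of_int (x (\<sigma> s)) else 0)) (sorted_list_of_set S) =
        map (\<lambda>s. N (\<sigma> s) s + of_int (if \<sigma> s = s then x s else 0)) (sorted_list_of_set S)"
      by (rule map_cong[OF refl]) simp
    then have "prod_list (map (\<lambda>s. N (\<sigma> s) s + (if \<sigma> s = s then of_int (x (\<sigma> s)) else 0)) (sorted_list_of_set S)) =
        (\<Sum>A\<in>Pow S. ?p A \<sigma> * prod_list (map (\<lambda>s. N (\<sigma> s) s) (sorted_list_of_set A)))"
      using S by (simp only: prod_list_add_int distinct_sorted_list_of_set set_sorted_list_of_set)
        (simp add: filter_sorted_list_of_set)
    then show "of_int (sign \<sigma>) * prod_list (map (\<lambda>s. N (\<sigma> s) s + (if \<sigma> s = s then of_int (x (\<sigma> s)) else 0)) (sorted_list_of_set S)) =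
      (\<Sum>A\<in>Pow S. ?p A \<sigma> * ?g A \<sigma>)"
      by (simp only: sum_distrib_left of_int_mult_left_commute[of "sign \<sigma>"])
  qed
  also have "\<dots> = (\<Sum>A\<in>Pow S. \<Sum>\<sigma> | \<sigma> permutes S. ?p A \<sigma> * ?g A \<sigma>)"
    by (rule sum.swap)
  also have "\<dots> = (\<Sum>A\<in>Pow S. of_int (\<Prod>s\<in>S - A. x s) * set_cdet A N)"
  proof (rule sum.cong[OF refl])
    fix A assume "A \<in> Pow S"
    then have A: "A \<subseteq> S"
      by simp
    have "(\<Sum>\<sigma> | \<sigma> permutes S. ?p A \<sigma> * ?g A \<sigma>) = (\<Sum>\<sigma> | \<sigma> permutes A. ?p A \<sigma> * ?g A \<sigma>)"
    proof (rule sum.mono_neutral_right)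
      show "finite {\<sigma>. \<sigma> permutes S}"
        using S by (rule finite_permutations)
      show "{\<sigma>. \<sigma> permutes A} \<subseteq> {\<sigma>. \<sigma> permutes S}"
        using A permutes_subset by blast
      show "\<forall>\<sigma>\<in>{\<sigma>. \<sigma> permutes S} - {\<sigma>. \<sigma> permutes A}. ?p A \<sigma> * ?g A \<sigma> = 0"
      proof
        fix \<sigma> assume \<sigma>: "\<sigma> \<in> {\<sigma>. \<sigma> permutes S} - {\<sigma>. \<sigma> permutes A}"
        then obtain s where "s \<in> S - A" "\<sigma> s \<noteq> s"
          using permutes_superset[of \<sigma> S A] by auto
        then have "(\<Prod>s\<in>S - A. if \<sigma> s = s then x s else 0) = 0"
          using S by (intro prod_zero) auto
        then show "?p A \<sigma> * ?g A \<sigma> = 0"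
          by simp
      qed
    qed
    also have "\<dots> = (\<Sum>\<sigma> | \<sigma> permutes A. of_int (\<Prod>s\<in>S - A. x s) * ?g A \<sigma>)"
    proof (rule sum.cong[OF refl])
      fix \<sigma> assume "\<sigma> \<in> {\<sigma>. \<sigma> permutes A}"
      then have "(\<Prod>s\<in>S - A. if \<sigma> s = s then x s else 0) = (\<Prod>s\<in>S - A. x s)"
        by (intro prod.cong) (auto simp: permutes_not_in)
      then show "?p A \<sigma> * ?g A \<sigma> = of_int (\<Prod>s\<in>S - A. x s) * ?g A \<sigma>"
        by simp
    qed
    finally show "(\<Sum>\<sigma> | \<sigma> permutes S. ?p A \<sigma> * ?g A \<sigma>) = of_int (\<Prod>s\<in>S - A. x s) * set_cdet A N"
      by (simp add: set_cdet_def sum_distrib_left)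
  qed
  finally show ?thesis .
qed

section \<open>Diagonal shifts and falling factorials\<close>

lemma falling_Suc: "falling q (Suc k) = falling q k * (q - int k)"
  by (simp add: falling_def)

text \<open>The two sides are the coefficients of the minor on \<open>A\<close> in two expansions.
  The induction adds a new smallest element \<open>b\<close>, which leaves the other counts
  unchanged and itself has count \<open>card S\<close>. If \<open>b\<close> lies in
  \<open>A\<close>, only sets containing \<open>b\<close> contribute. Otherwise its factor
  \<open>card S - q\<close> is split as \<open>(card S - card B - q) + card B\<close>: the first
  summand extends the falling factorial belonging to \<open>B\<close>, the second is the new
  diagonal factor of \<open>insert b B\<close>.\<close>

lemma prod_diagonal_falling:
  fixes A S :: "nat set"
  assumes "finite S" "A \<subseteq> S"
  shows "(\<Prod>r\<in>S - A. int (card {s\<in>S. r < s}) - q) =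
    (\<Sum>B\<in>Pow S. if A \<subseteq> B then (- 1) ^ (card S - card B) * falling q (card S - card B) *
      (\<Prod>r\<in>B - A. int (card {s\<in>B. r < s})) else 0)"
  using assms
proof (induction S arbitrary: A rule: finite_linorder_min_induct)
  case empty
  then show ?case
    by (simp add: falling_def)
next
  case (insert b S)
  let ?A = "A - {b}"
  let ?G = "\<lambda>B. if A \<subseteq> B then (- 1) ^ (card (insert b S) - card B) * falling q (card (insert b S) - card B) *
      (\<Prod>r\<in>B - A. int (card {s\<in>B. r < s})) else 0"
  let ?P = "\<lambda>B. \<Prod>r\<in>B - ?A. int (card {s\<in>B. r < s})"
  let ?t = "\<lambda>B. (- 1) ^ (card S - card B) * falling q (card S - card B) * ?P B"
  have b: "b \<notin> S"
    using insert.hyps by auto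
  have A: "?A \<subseteq> S"
    using insert.prems by auto
  have IH: "(\<Prod>r\<in>S - ?A. int (card {s\<in>S. r < s}) - q) = (\<Sum>B\<in>Pow S. if ?A \<subseteq> B then ?t B else 0)"
    by (rule insert.IH[OF A])
  have greater: "{s \<in> insert b B. r < s} = {s\<in>B. r < s}" if "r \<in> S" for r B
    using insert.hyps that by auto
  have greater_b: "{s \<in> insert b B. b < s} = B" if "B \<subseteq> S" for B
    using insert.hyps that by auto
  have card: "card (insert b S) - card (insert b B) = card S - card B" if "B \<subseteq> S" for B
  proof -
    have "b \<notin> B" "finite B"
      using that b insert.hyps(1) by (auto intro: finite_subset)
    then show ?thesis
      using b insert.hyps(1) by simp
  qed
  have split: "sum ?G (Pow (insert b S)) = sum ?G (Pow S) + (\<Sum>B\<in>Pow S. ?G (insert b B))"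
    by (rule sum_Pow_insert[OF insert.hyps(1) b])
  show ?case
  proof (cases "b \<in> A")
    case True
    have "insert b S - A = S - ?A"
      using True b by auto
    then have lhs: "(\<Prod>r\<in>insert b S - A. int (card {s \<in> insert b S. r < s}) - q) =
        (\<Prod>r\<in>S - ?A. int (card {s\<in>S. r < s}) - q)"
      by (intro prod.cong) (simp_all only: greater Diff_iff)
    have 1: "?G B = 0" if "B \<in> Pow S" for B
      using that True b by auto
    have 2: "?G (insert b B) =
        (if ?A \<subseteq> B then ?t B else 0)" if "B \<in> Pow S" for B
    proof -
      have "insert b B - A = B - ?A"
        using True that b by auto
      moreover have "(\<Prod>r\<in>B - ?A. int (card {s\<in>insert b B. r < s})) = ?P B"
        using that by (intro prod.cong) (auto simp only: greater Diff_iff)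
      moreover have "A \<subseteq> insert b B \<longleftrightarrow> ?A \<subseteq> B"
        by auto
      ultimately show ?thesis
        using card[of B] that by simp
    qed
    have "sum ?G (Pow S) = 0"
      by (rule sum.neutral) (use 1 in blast)
    moreover have "(\<Sum>B\<in>Pow S. ?G (insert b B)) = (\<Sum>B\<in>Pow S. if ?A \<subseteq> B then ?t B else 0)"
      by (rule sum.cong[OF refl 2])
    ultimately show ?thesis
      by (simp only: lhs IH split add_0)
  next
    case False
    then have A_eq: "?A = A"
      by simp
    have "insert b S - A = insert b (S - ?A)"
      using False by auto
    moreover have "(\<Prod>r\<in>S - ?A. int (card {s \<in> insert b S. r < s}) - q) = (\<Prod>r\<in>S - ?A. int (card {s\<in>S. r < s}) - q)"
      by (intro prod.cong) (simp_all only: greater Diff_iff)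
    ultimately have lhs: "(\<Prod>r\<in>insert b S - A. int (card {s \<in> insert b S. r < s}) - q) =
        (int (card S) - q) * (\<Sum>B\<in>Pow S. if ?A \<subseteq> B then ?t B else 0)"
      using b insert.hyps(1) greater_b[of S] by (simp add: IH)
    have 1: "?G B =
        (int (card S) - int (card B) - q) * (if ?A \<subseteq> B then ?t B else 0)" if "B \<in> Pow S" for B
    proof -
      have le: "card B \<le> card S"
        using that insert.hyps(1) by (intro card_mono) auto
      then have "card (insert b S) - card B = Suc (card S - card B)"
        using b insert.hyps(1) by simp
      with le show ?thesis
        by (simp add: A_eq falling_Suc of_nat_diff algebra_simps)
    qed
    have 2: "?G (insert b B) =
        int (card B) * (if ?A \<subseteq> B then ?t B else 0)" if "B \<in> Pow S" for B
    proof -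
      have fin: "finite (B - ?A)" and nb: "b \<notin> B - ?A"
        using that insert.hyps(1) b by (auto intro: finite_subset)
      have "insert b B - A = insert b (B - ?A)"
        using False by auto
      then have "(\<Prod>r\<in>insert b B - A. int (card {s\<in>insert b B. r < s})) =
          int (card B) * (\<Prod>r\<in>B - ?A. int (card {s\<in>insert b B. r < s}))"
        using fin nb greater_b[of B] that by simp
      moreover have "(\<Prod>r\<in>B - ?A. int (card {s\<in>insert b B. r < s})) = ?P B"
        using that by (intro prod.cong) (auto simp only: greater Diff_iff)
      moreover have "A \<subseteq> insert b B \<longleftrightarrow> ?A \<subseteq> B"
        using False by auto
      ultimately show ?thesis
        using card[of B] that by simp
    qed
    have s1: "sum ?G (Pow S) = (\<Sum>B\<in>Pow S. (int (card S) - int (card B) - q) * (if ?A \<subseteq> B then ?t B else 0))"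
      by (rule sum.cong[OF refl 1])
    have s2: "(\<Sum>B\<in>Pow S. ?G (insert b B)) = (\<Sum>B\<in>Pow S. int (card B) * (if ?A \<subseteq> B then ?t B else 0))"
      by (rule sum.cong[OF refl 2])
    have "(int (card S) - q) * z = (int (card S) - int (card B) - q) * z + int (card B) * z" for B :: "nat set" and z
      by (simp add: algebra_simps)
    then show ?thesis
      by (simp only: lhs split s1 s2 sum_distrib_left sum.distrib[symmetric])
  qed
qed

lemma set_cdet_cong:
  assumes "finite S" "\<And>r s. r \<in> S \<Longrightarrow> s \<in> S \<Longrightarrow> M r s = M' r s"
  shows "set_cdet S M = set_cdet S M'"
  unfolding set_cdet_def
proof (rule sum.cong[OF refl])
  fix \<sigma> assume "\<sigma> \<in> {\<sigma>. \<sigma> permutes S}"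
  then have "map (\<lambda>s. M (\<sigma> s) s) (sorted_list_of_set S) = map (\<lambda>s. M' (\<sigma> s) s) (sorted_list_of_set S)"
    using assms by (intro map_cong[OF refl]) (auto simp: permutes_in_image)
  then show "of_int (sign \<sigma>) * prod_list (map (\<lambda>s. M (\<sigma> s) s) (sorted_list_of_set S)) =
      of_int (sign \<sigma>) * prod_list (map (\<lambda>s. M' (\<sigma> s) s) (sorted_list_of_set S))"
    by (simp only:)
qed

text \<open>Both sides are expanded in the principal minors of \<open>N\<close>; the coefficients
  agree by \<open>prod_diagonal_falling\<close>.\<close>

lemma set_cdet_falling:
  fixes N :: "nat \<Rightarrow> nat \<Rightarrow> 'a::ring_1"
  assumes S: "finite S"
  shows "set_cdet S (\<lambda>r s. N r s + (if r = s then of_int (int (card {t\<in>S. r < t}) - q) else 0)) =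
    (\<Sum>B\<in>Pow S. of_int ((- 1) ^ (card S - card B) * falling q (card S - card B)) *
      set_cdet B (\<lambda>r s. N r s + (if r = s then of_int (int (card {t\<in>B. r < t})) else 0)))"
proof -
  let ?c = "\<lambda>B. (- 1) ^ (card S - card B) * falling q (card S - card B)"
  let ?P = "\<lambda>A B. \<Prod>r\<in>B - A. int (card {t\<in>B. r < t})"
  have "set_cdet S (\<lambda>r s. N r s + (if r = s then of_int (int (card {t\<in>S. r < t}) - q) else 0)) =
      (\<Sum>A\<in>Pow S. of_int (\<Prod>r\<in>S - A. int (card {t\<in>S. r < t}) - q) * set_cdet A N)"
    by (rule set_cdet_add_diagonal[OF S])
  also have "\<dots> = (\<Sum>A\<in>Pow S. \<Sum>B\<in>Pow S. if A \<subseteq> B then of_int (?c B) * (of_int (?P A B) * set_cdet A N) else 0)"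
  proof (rule sum.cong[OF refl])
    fix A assume "A \<in> Pow S"
    then have "of_int (\<Prod>r\<in>S - A. int (card {t\<in>S. r < t}) - q) * set_cdet A N =
        of_int (\<Sum>B\<in>Pow S. if A \<subseteq> B then ?c B * ?P A B else 0) * set_cdet A N"
      using prod_diagonal_falling[OF S, of A q] by simp
    also have "\<dots> = (\<Sum>B\<in>Pow S. of_int (if A \<subseteq> B then ?c B * ?P A B else 0) * set_cdet A N)"
      by (simp only: of_int_sum sum_distrib_right)
    also have "\<dots> = (\<Sum>B\<in>Pow S. if A \<subseteq> B then of_int (?c B) * (of_int (?P A B) * set_cdet A N) else 0)"
      by (rule sum.cong[OF refl]) (simp add: mult.assoc)
    finally show "of_int (\<Prod>r\<in>S - A. int (card {t\<in>S. r < t}) - q) * set_cdet A N =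
        (\<Sum>B\<in>Pow S. if A \<subseteq> B then of_int (?c B) * (of_int (?P A B) * set_cdet A N) else 0)" .
  qed
  also have "\<dots> = (\<Sum>B\<in>Pow S. \<Sum>A\<in>Pow S. if A \<subseteq> B then of_int (?c B) * (of_int (?P A B) * set_cdet A N) else 0)"
    by (rule sum.swap)
  also have "\<dots> = (\<Sum>B\<in>Pow S. of_int (?c B) *
      set_cdet B (\<lambda>r s. N r s + (if r = s then of_int (int (card {t\<in>B. r < t})) else 0)))"
  proof (rule sum.cong[OF refl])
    fix B assume "B \<in> Pow S"
    then have B: "finite B" "B \<subseteq> S"
      using S by (auto intro: finite_subset)
    have "(\<Sum>A\<in>Pow S. if A \<subseteq> B then of_int (?c B) * (of_int (?P A B) * set_cdet A N) else 0) =
        (\<Sum>A\<in>Pow B. of_int (?c B) * (of_int (?P A B) * set_cdet A N))"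
      using S B by (intro sum.mono_neutral_cong_right) auto
    then show "(\<Sum>A\<in>Pow S. if A \<subseteq> B then of_int (?c B) * (of_int (?P A B) * set_cdet A N) else 0) =
      of_int (?c B) * set_cdet B (\<lambda>r s. N r s + (if r = s then of_int (int (card {t\<in>B. r < t})) else 0))"
      by (simp only: sum_distrib_left set_cdet_add_diagonal[OF B(1)])
  qed
  finally show ?thesis .
qed

section \<open>Capelli elements as sums of principal minors\<close>

definition proper_gen :: "(nat \<Rightarrow> 'n) \<Rightarrow> nat \<Rightarrow> nat \<Rightarrow> ('m, 'n) Ugl" where
  "proper_gen \<nu> r s = e (Proper (\<nu> r)) (Proper (\<nu> s))"

definition shifted_cdet :: "(nat \<Rightarrow> 'n) \<Rightarrow> nat \<Rightarrow> int \<Rightarrow> ('m, 'n) Ugl" where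
  "shifted_cdet \<nu> k q = cdet k (\<lambda>r s. proper_gen \<nu> r s + (if r = s then of_int (int k - int r - q) else 0))"

lemma capelli_H_eq_set_cdet:
  "(capelli_H \<nu> k j :: ('m, 'n) Ugl) = (\<Sum>B | B \<subseteq> {1..k} \<and> card B = j.
     set_cdet B (\<lambda>r s. proper_gen \<nu> r s + (if r = s then of_int (int (card {t\<in>B. r < t})) else 0)))"
  unfolding capelli_H_def Let_def
proof (rule sum.cong[OF refl])
  fix B assume "B \<in> {B. B \<subseteq> {1..k} \<and> card B = j}"
  then have B: "finite B" "card B = j"
    by (auto intro: finite_subset)
  let ?i = "\<lambda>r. sorted_list_of_set B ! (r - 1)"
  let ?M = "\<lambda>r s. proper_gen \<nu> r s + (if r = s then of_int (int (card {t\<in>B. r < t})) else 0) :: ('m, 'n) Ugl"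
  have "set_cdet B ?M = cdet j (\<lambda>r s. ?M (?i r) (?i s))"
    using set_cdet_reindex[OF B(1), of ?M] B(2) by simp
  also have "\<dots> = cdet j (\<lambda>r s. e (Proper (\<nu> (?i r))) (Proper (\<nu> (?i s))) + (if r = s then of_nat (j - r) else 0))"
    unfolding cdet_eq_set_cdet
  proof (rule set_cdet_cong)
    fix r s assume rs: "r \<in> {1..j}" "s \<in> {1..j}"
    then have "?i r = ?i s \<longleftrightarrow> r = s"
      using B by (auto simp: nth_eq_iff_index_eq)
    moreover have "card {t\<in>B. ?i r < t} = j - r"
      using card_greater_sorted_list_of_set[OF B(1), of r] rs B(2) by simp
    ultimately show "?M (?i r) (?i s) = e (Proper (\<nu> (?i r))) (Proper (\<nu> (?i s))) + (if r = s then of_nat (j - r) else 0)"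
      by (cases "r = s") (simp_all add: proper_gen_def)
  qed simp
  finally show "cdet j (\<lambda>r s. e (Proper (\<nu> (?i r))) (Proper (\<nu> (?i s))) + (if r = s then of_nat (j - r) else 0)) = set_cdet B ?M"
    by simp
qed

text \<open>In the full index set the number of elements above \<open>r\<close> is
  \<open>k - r\<close>. Subsets of equal size share their coefficient, so grouping by size produces
  the Capelli elements.\<close>

lemma capelli_C_eq_shifted_cdet: "capelli_C \<nu> k q = shifted_cdet \<nu> k q"
proof -
  let ?D = "\<lambda>B. set_cdet B (\<lambda>r s. proper_gen \<nu> r s + (if r = s then of_int (int (card {t\<in>B. r < t})) else 0)) :: ('a, 'b) Ugl"
  let ?c = "\<lambda>j. (- 1) ^ (k - j) * falling q (k - j)"
  have "{t \<in> {1..k}. r < t} = {r<..k}" if "r \<in> {1..k}" for r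
    using that by auto
  then have "shifted_cdet \<nu> k q = set_cdet {1..k} (\<lambda>r s. proper_gen \<nu> r s +
      (if r = s then of_int (int (card {t \<in> {1..k}. r < t}) - q) else 0) :: ('a, 'b) Ugl)"
    unfolding shifted_cdet_def cdet_eq_set_cdet by (intro set_cdet_cong) (auto simp: of_nat_diff)
  also have "\<dots> = (\<Sum>B\<in>Pow {1..k}. of_int (?c (card B)) * ?D B)"
    using set_cdet_falling[of "{1..k}" "proper_gen \<nu>" q] by simp
  also have "\<dots> = (\<Sum>j=0..k. \<Sum>B\<in>{B \<in> Pow {1..k}. card B = j}. of_int (?c (card B)) * ?D B)"
  proof (rule sum.group[symmetric])
    show "card ` Pow {1..k} \<subseteq> {0..k}"
      using card_mono[of "{1..k}"] by force
  qed simp_all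
  also have "\<dots> = (\<Sum>j=0..k. of_int (?c j) * capelli_H \<nu> k j)"
    by (rule sum.cong[OF refl]) (simp add: capelli_H_eq_set_cdet sum_distrib_left)
  finally show ?thesis
    by (simp add: capelli_C_def)
qed

lemma e_monomial_Nil [simp]: "e_monomial [] = 1"
  by (simp add: e_monomial_def)

lemma e_monomial_Cons [simp]: "e_monomial ((a, b) # w) = e a b * e_monomial w"
  by (simp add: e_monomial_def)

lemma e_monomial_append: "e_monomial (v @ w) = e_monomial v * e_monomial w"
  by (simp add: e_monomial_def)

section \<open>The left ideal of irregular elements\<close>

lemma Irr_zero: "0 \<in> Irr"
  by (simp add: Irr_def left_ideal.zero)

lemma Irr_monomial: "irregular w \<Longrightarrow> e_monomial w \<in> Irr"
  using left_ideal.step[OF _ left_ideal.zero, of "e_monomial w" "{e_monomial w |w. irregular w}" 1]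
  by (auto simp: Irr_def)

lemma Irr_add:
  assumes "x \<in> Irr" "y \<in> Irr"
  shows "x + y \<in> Irr"
  using assms unfolding Irr_def by induction (auto simp: add.assoc intro: left_ideal.step)

lemma Irr_mult_left:
  assumes "x \<in> Irr"
  shows "z * x \<in> Irr"
  using assms unfolding Irr_def
proof induction
  case (step r y u)
  then show ?case
    using left_ideal.step[of r "{e_monomial w |w. irregular w}" "z * y" "z * u"] by (simp add: algebra_simps)
qed (auto intro: left_ideal.zero)

lemma Irr_uminus: "x \<in> Irr \<Longrightarrow> - x \<in> Irr"
  using Irr_mult_left[of x "- 1"] by simp

lemma Irr_diff: "x \<in> Irr \<Longrightarrow> y \<in> Irr \<Longrightarrow> x - y \<in> Irr"
  using Irr_add[of x "- y"] Irr_uminus[of y] by simp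

lemma Irr_sum: "(\<And>x. x \<in> A \<Longrightarrow> f x \<in> Irr) \<Longrightarrow> sum f A \<in> Irr"
  by (induction A rule: infinite_finite_induct) (simp_all add: Irr_zero Irr_add)

section \<open>Words that annihilate or create one virtual symbol\<close>

definition ann_word :: "'m \<Rightarrow> 'n list \<Rightarrow> ('m, 'n) gl_index list" where
  "ann_word a l = map (\<lambda>u. (Proper u, Virtual a)) l"

definition cre_word :: "'m \<Rightarrow> 'n list \<Rightarrow> ('m, 'n) gl_index list" where
  "cre_word a l = map (\<lambda>u. (Virtual a, Proper u)) l"

definition avoids :: "'m \<Rightarrow> ('m, 'n) gl_index list \<Rightarrow> bool" where
  "avoids a w \<longleftrightarrow> (\<forall>x\<in>set w. fst x \<noteq> Virtual a \<and> snd x \<noteq> Virtual a)"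

lemma ann_word_simps [simp]:
  "ann_word a [] = []" "ann_word a (u # l) = (Proper u, Virtual a) # ann_word a l"
  "length (ann_word a l) = length l"
  by (simp_all add: ann_word_def)

lemma cre_word_simps [simp]:
  "cre_word a [] = []" "cre_word a (u # l) = (Virtual a, Proper u) # cre_word a l"
  "length (cre_word a l) = length l"
  by (simp_all add: cre_word_def)

lemma word_append:
  "ann_word a (l @ l') = ann_word a l @ ann_word a l'" "cre_word a (l @ l') = cre_word a l @ cre_word a l'"
  by (simp_all add: ann_word_def cre_word_def)

lemma filter_words:
  "filter (\<lambda>x. fst x = Virtual a) (cre_word a l) = cre_word a l"
  "filter (\<lambda>x. snd x = Virtual a) (cre_word a l) = []"
  "filter (\<lambda>x. fst x = Virtual a) (ann_word a l) = []"
  "filter (\<lambda>x. snd x = Virtual a) (ann_word a l) = ann_word a l"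
  "avoids a w \<Longrightarrow> filter (\<lambda>x. fst x = Virtual a) w = []"
  "avoids a w \<Longrightarrow> filter (\<lambda>x. snd x = Virtual a) w = []"
  by (auto simp: cre_word_def ann_word_def avoids_def filter_empty_conv filter_id_conv)

lemma irregular_Cons:
  assumes "length (filter (\<lambda>x. fst x = Virtual a) w) \<le> length (filter (\<lambda>x. snd x = Virtual a) w)"
  shows "irregular ((b, Virtual a) # w)"
  unfolding irregular_iff
  by (rule exI[of _ "[]"], rule exI[of _ b], rule exI[of _ "Virtual a"], rule exI[of _ w], rule exI[of _ a])
    (use assms in simp)

text \<open>The leftmost annihilator is the witness: the letters to its right create
  \<open>a\<close> no more often than they annihilate it.\<close>

lemma irregular_ann_cre:
  assumes "length l' < length l" "avoids a w"
  shows "e_monomial (ann_word a l) * e_monomial (cre_word a l') * e_monomial w \<in> Irr"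
proof -
  obtain u l0 where l: "l = u # l0"
    using assms(1) by (cases l) auto
  have "irregular ((Proper u, Virtual a) # ann_word a l0 @ cre_word a l' @ w)"
    using assms by (intro irregular_Cons) (simp add: l filter_words)
  then have "e_monomial (ann_word a l @ cre_word a l' @ w) \<in> Irr"
    by (intro Irr_monomial) (simp add: l)
  then show ?thesis
    by (simp add: e_monomial_append mult.assoc)
qed

lemma irregular_virtual:
  assumes "avoids a w"
  shows "e (Virtual a) (Virtual a) * e_monomial w \<in> Irr"
proof -
  have "irregular ((Virtual a, Virtual a) # w)"
    using assms by (intro irregular_Cons) (simp add: filter_words)
  then show ?thesis
    using Irr_monomial by fastforce
qed

section \<open>Commutation relations of letters and words\<close>

lemma ann_ann: "e (Proper u) (Virtual a) * e (Proper v) (Virtual b) = - (e (Proper v) (Virtual b) * e (Proper u) (Virtual a))"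
  using e_odd_anticommute[of "Proper u" "Virtual a" "Proper v" "Virtual b"] by simp

lemma cre_cre: "e (Virtual a) (Proper u) * e (Virtual b) (Proper v) = - (e (Virtual b) (Proper v) * e (Virtual a) (Proper u))"
  using e_odd_anticommute[of "Virtual a" "Proper u" "Virtual b" "Proper v"] by simp

lemma ann_cre: "e (Proper u) (Virtual a) * e (Virtual a) (Proper v) =
    - (e (Virtual a) (Proper v) * e (Proper u) (Virtual a)) + e (Proper u) (Proper v)
    + (if u = v then e (Virtual a) (Virtual a) else 0)"
  using e_odd_anticommute[of "Proper u" "Virtual a" "Virtual a" "Proper v"] by simp

lemma proper_ann: "e (Proper s) (Proper t) * e (Proper u) (Virtual a) =
    e (Proper u) (Virtual a) * e (Proper s) (Proper t) + (if t = u then e (Proper s) (Virtual a) else 0)"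
  using e_even_commute[of "Proper s" "Proper t" "Proper u" "Virtual a"] by simp

lemma proper_cre: "e (Proper s) (Proper t) * e (Virtual a) (Proper u) =
    e (Virtual a) (Proper u) * e (Proper s) (Proper t) - (if s = u then e (Virtual a) (Proper t) else 0)"
  using e_even_commute[of "Proper s" "Proper t" "Virtual a" "Proper u"] by simp

lemma virtual_cre: "e (Virtual a) (Virtual a) * e (Virtual a) (Proper u) =
    e (Virtual a) (Proper u) * e (Virtual a) (Virtual a) + e (Virtual a) (Proper u)"
  using e_even_commute[of "Virtual a" "Virtual a" "Virtual a" "Proper u"] by simp

text \<open>Division by two is the complex scalar \<open>1 / 2\<close>; it turns antisymmetry into
  the vanishing of words with a repeated letter.\<close>

lemma Ugl_double_zero:
  fixes x :: "('m, 'n) Ugl"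
  assumes "x = - x"
  shows "x = 0"
proof -
  have "cscale 2 x = cscale 1 x + cscale 1 x"
    by (simp only: cscale_add_scalar[symmetric] one_add_one)
  also have "\<dots> = 0"
    using assms by (metis cscale_one left_minus)
  finally have "cscale (1 / 2) (cscale 2 x) = 0"
    by simp
  then show ?thesis
    by (simp add: cscale_cscale[symmetric])
qed

lemma anticommute_prod_list:
  fixes y :: "'a::ring_1"
  assumes "\<And>x. x \<in> set l \<Longrightarrow> x * y = - (y * x)"
  shows "prod_list l * y = (- 1) ^ length l * (y * prod_list l)"
  using assms
proof (induction l)
  case (Cons x l)
  have "prod_list (x # l) * y = x * ((- 1) ^ length l * (y * prod_list l))"
    using Cons by (simp add: mult.assoc)
  also have "\<dots> = (- 1) ^ length l * (x * y * prod_list l)"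
    by (cases "even (length l)") (simp_all add: mult.assoc)
  also have "x * y = - (y * x)"
    using Cons.prems by simp
  finally show ?case
    by (simp add: mult.assoc)
qed simp

lemma anticommute_prod_list_prod_list:
  fixes l l' :: "'a::ring_1 list"
  assumes "\<And>x y. x \<in> set l \<Longrightarrow> y \<in> set l' \<Longrightarrow> x * y = - (y * x)"
  shows "prod_list l * prod_list l' = (- 1) ^ (length l * length l') * (prod_list l' * prod_list l)"
  using assms
proof (induction l')
  case (Cons y l')
  have "prod_list l * prod_list (y # l') = prod_list l * y * prod_list l'"
    by (simp add: mult.assoc)
  also have "\<dots> = (- 1) ^ length l * (y * (prod_list l * prod_list l'))"
    using Cons.prems by (subst anticommute_prod_list) (simp_all add: mult.assoc)
  also have "prod_list l * prod_list l' = (- 1) ^ (length l * length l') * (prod_list l' * prod_list l)"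
    using Cons by simp
  finally show ?case
    by (cases "even (length l)"; cases "even (length l')") (simp_all add: mult.assoc)
qed simp

lemma ann_word_ann:
  "e_monomial (ann_word a l) * e (Proper u) (Virtual a) = (- 1) ^ length l * (e (Proper u) (Virtual a) * e_monomial (ann_word a l))"
proof -
  let ?l = "map (\<lambda>v. e (Proper v) (Virtual a)) l"
  have "prod_list ?l * e (Proper u) (Virtual a) = (- 1) ^ length ?l * (e (Proper u) (Virtual a) * prod_list ?l)"
    by (rule anticommute_prod_list) (auto intro: ann_ann)
  then show ?thesis
    by (simp add: e_monomial_def ann_word_def o_def)
qed

text \<open>The sign for crossing the middle word occurs on both sides, so only the sign of
  exchanging the two outer letters is left.\<close>

lemma ann_swap:
  "e (Proper u) (Virtual a) * e_monomial (ann_word a l) * e (Proper v) (Virtual a) =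
    - (e (Proper v) (Virtual a) * e_monomial (ann_word a l) * e (Proper u) (Virtual a))"
proof -
  let ?E = "e_monomial (ann_word a l)"
  have "e (Proper u) (Virtual a) * ?E * e (Proper v) (Virtual a) =
      (- 1) ^ length l * (e (Proper u) (Virtual a) * e (Proper v) (Virtual a) * ?E)"
    by (cases "even (length l)") (simp_all add: mult.assoc ann_word_ann)
  also have "\<dots> = - ((- 1) ^ length l * (e (Proper v) (Virtual a) * e (Proper u) (Virtual a) * ?E))"
    by (simp add: ann_ann[of u a v])
  also have "\<dots> = - (e (Proper v) (Virtual a) * ?E * e (Proper u) (Virtual a))"
    by (cases "even (length l)") (simp_all add: mult.assoc ann_word_ann)
  finally show ?thesis .
qed

lemma ann_word_not_distinct:
  assumes "\<not> distinct l"
  shows "e_monomial (ann_word a l) = 0"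
proof -
  obtain xs u ys zs where l: "l = xs @ [u] @ ys @ [u] @ zs"
    using not_distinct_decomp[OF assms] by blast
  have "e (Proper u) (Virtual a) * e_monomial (ann_word a ys) * e (Proper u) (Virtual a) = 0"
    by (rule Ugl_double_zero) (rule ann_swap)
  then show ?thesis
    by (simp add: l word_append e_monomial_append) (metis mult.assoc mult_zero_left mult_zero_right)
qed

lemma cre_word_not_distinct:
  assumes "\<not> distinct l"
  shows "e_monomial (cre_word a l) = 0"
proof -
  obtain xs u ys zs where l: "l = xs @ [u] @ ys @ [u] @ zs"
    using not_distinct_decomp[OF assms] by blast
  let ?u = "e (Virtual a) (Proper u)" and ?E = "e_monomial (cre_word a ys)"
  let ?l = "map (\<lambda>v. e (Virtual a) (Proper v)) ys"
  have "prod_list ?l * ?u = (- 1) ^ length ?l * (?u * prod_list ?l)"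
    by (rule anticommute_prod_list) (auto intro: cre_cre)
  then have swap: "?E * ?u = (- 1) ^ length ys * (?u * ?E)"
    by (simp add: e_monomial_def cre_word_def o_def)
  have "?u * ?u = 0"
    by (rule Ugl_double_zero) (rule cre_cre)
  then have "?u * ?E * ?u = 0"
    by (cases "even (length ys)") (simp_all add: mult.assoc swap flip: mult.assoc[of ?u ?u])
  then show ?thesis
    by (simp add: l word_append e_monomial_append) (metis mult.assoc mult_zero_left mult_zero_right)
qed

section \<open>Action of the proper symbols\<close>

lemma proper_ann_word:
  assumes "distinct l"
  shows "e (Proper s) (Proper t) * e_monomial (ann_word a l) = e_monomial (ann_word a l) * e (Proper s) (Proper t)
    + (if t \<in> set l then e_monomial (ann_word a (map (\<lambda>u. if u = t then s else u) l)) else 0)"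
  using assms
proof (induction l)
  case (Cons u l)
  have "e (Proper s) (Proper t) * e_monomial (ann_word a (u # l)) =
      e (Proper u) (Virtual a) * (e (Proper s) (Proper t) * e_monomial (ann_word a l))
      + (if t = u then e (Proper s) (Virtual a) * e_monomial (ann_word a l) else 0)"
    by (simp add: mult.assoc[symmetric] proper_ann distrib_right)
  moreover have "map (\<lambda>v. if v = u then s else v) l = l"
    using Cons.prems by (intro map_idI) auto
  ultimately show ?case
    using Cons by (auto simp: distrib_left mult.assoc)
qed simp

lemma proper_ann_word_notin:
  "t \<notin> set l \<Longrightarrow> e (Proper s) (Proper t) * e_monomial (ann_word a l) = e_monomial (ann_word a l) * e (Proper s) (Proper t)"
proof (induction l)
  case (Cons u l)
  then show ?case
    by (simp add: mult.assoc[symmetric] proper_ann) (simp add: mult.assoc)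
qed simp

lemma proper_cre_word:
  assumes "distinct l"
  shows "e (Proper s) (Proper t) * e_monomial (cre_word a l) = e_monomial (cre_word a l) * e (Proper s) (Proper t)
    - (if s \<in> set l then e_monomial (cre_word a (map (\<lambda>u. if u = s then t else u) l)) else 0)"
  using assms
proof (induction l)
  case (Cons u l)
  have "e (Proper s) (Proper t) * e_monomial (cre_word a (u # l)) =
      e (Virtual a) (Proper u) * (e (Proper s) (Proper t) * e_monomial (cre_word a l))
      - (if s = u then e (Virtual a) (Proper t) * e_monomial (cre_word a l) else 0)"
    by (simp add: mult.assoc[symmetric] proper_cre left_diff_distrib)
  moreover have "map (\<lambda>v. if v = u then t else v) l = l"
    using Cons.prems by (intro map_idI) auto
  ultimately show ?case
    using Cons by (auto simp: right_diff_distrib mult.assoc)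
qed simp

text \<open>Replacing \<open>t\<close> by another letter \<open>s\<close> of the word repeats
  \<open>s\<close>, and the word vanishes by antisymmetry. So a proper generator acts on a word
  containing both its letters only through the diagonal case \<open>s = t\<close>.\<close>

lemma map_replace_not_distinct:
  assumes "s \<in> set l" "t \<in> set l" "s \<noteq> t"
  shows "\<not> distinct (map (\<lambda>u. if u = t then s else u) l)"
  using assms by (auto simp: distinct_map inj_on_def)

lemma proper_ann_word_full:
  assumes "distinct l" "s \<in> set l" "t \<in> set l"
  shows "e (Proper s) (Proper t) * e_monomial (ann_word a l) =
    e_monomial (ann_word a l) * (e (Proper s) (Proper t) + (if s = t then 1 else 0))"
proof (cases "s = t")
  case True
  then have "map (\<lambda>u. if u = t then s else u) l = l"
    by (intro map_idI) auto
  then show ?thesis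
    using True assms by (simp add: proper_ann_word distrib_left)
next
  case False
  then show ?thesis
    using assms by (simp add: proper_ann_word ann_word_not_distinct map_replace_not_distinct)
qed

lemma proper_cre_word_full:
  assumes "distinct l" "s \<in> set l" "t \<in> set l"
  shows "e (Proper s) (Proper t) * e_monomial (cre_word a l) =
    e_monomial (cre_word a l) * (e (Proper s) (Proper t) - (if s = t then 1 else 0))"
proof (cases "s = t")
  case True
  then have "map (\<lambda>u. if u = s then t else u) l = l"
    by (intro map_idI) auto
  then show ?thesis
    using True assms by (simp add: proper_cre_word right_diff_distrib)
next
  case False
  then show ?thesis
    using assms map_replace_not_distinct[of t l s] by (simp add: proper_cre_word cre_word_not_distinct)
qed

lemma virtual_cre_word:
  "e (Virtual a) (Virtual a) * e_monomial (cre_word a l) =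
    e_monomial (cre_word a l) * (e (Virtual a) (Virtual a) + of_nat (length l))"
proof (induction l)
  case (Cons u l)
  have "e (Virtual a) (Virtual a) * e_monomial (cre_word a (u # l)) =
      e (Virtual a) (Proper u) * (e (Virtual a) (Virtual a) * e_monomial (cre_word a l)) + e_monomial (cre_word a (u # l))"
    by (simp add: mult.assoc[symmetric] virtual_cre distrib_right)
  then show ?case
    using Cons by (simp add: distrib_left mult.assoc algebra_simps)
qed simp

section \<open>The Capelli determinant as a virtual element\<close>

text \<open>The creator moves left through the word and may be contracted at each position
  \<open>b\<close>. The emitted proper generator passes the other annihilators because
  \<open>c\<close> is none of their letters. The annihilator of \<open>t\<close> is carried into the
  vacated place, which keeps the words at full length; its sign for moving there cancels the sign
  collected by the creator.\<close>

lemma contraction: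
  fixes f :: "nat \<Rightarrow> 'n"
  assumes "distinct l" "c \<notin> f ` set l"
  shows "e_monomial (ann_word a (map f l)) * (e (Virtual a) (Proper c) * e (Proper t) (Virtual a)) =
    (- 1) ^ length l * (e (Virtual a) (Proper c) * (e_monomial (ann_word a (map f l)) * e (Proper t) (Virtual a)))
    + (\<Sum>b\<in>set l. e (Proper (f b)) (Proper c) * e_monomial (ann_word a (map (f(b := t)) l)))"
  using assms
proof (induction l)
  case (Cons i l)
  let ?c = "e (Virtual a) (Proper c)" and ?t = "e (Proper t) (Virtual a)" and ?i = "e (Proper (f i)) (Virtual a)"
  let ?W = "e_monomial (ann_word a (map f l))"
  have ne: "c \<noteq> f i" and i: "i \<notin> set l"
    using Cons.prems by auto
  have IH: "?W * (?c * ?t) = (- 1) ^ length l * (?c * (?W * ?t))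
    + (\<Sum>b\<in>set l. e (Proper (f b)) (Proper c) * e_monomial (ann_word a (map (f(b := t)) l)))"
    by (rule Cons.IH) (use Cons.prems in auto)
  have tW: "(- 1) ^ length l * (?W * ?t) = ?t * ?W"
    by (cases "even (length l)") (simp_all add: ann_word_ann)
  have replace_i: "map (f(i := t)) (i # l) = t # map f l"
    using i by (auto simp: fun_upd_def)
  have "?i * ((- 1) ^ length l * (?c * (?W * ?t))) = (- 1) ^ length l * (?i * ?c * (?W * ?t))"
    by (cases "even (length l)") (simp_all add: mult.assoc)
  also have "?i * ?c = - (?c * ?i) + e (Proper (f i)) (Proper c)"
    using ne by (simp add: ann_cre)
  also have "(- 1) ^ length l * ((- (?c * ?i) + e (Proper (f i)) (Proper c)) * (?W * ?t)) =
      (- 1) ^ length (i # l) * (?c * (?i * ?W * ?t)) + e (Proper (f i)) (Proper c) * ((- 1) ^ length l * (?W * ?t))"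
    by (cases "even (length l)") (simp_all add: mult.assoc distrib_right left_diff_distrib)
  also have "(- 1) ^ length l * (?W * ?t) = e_monomial (ann_word a (map (f(i := t)) (i # l)))"
    by (simp only: tW replace_i ann_word_simps e_monomial_Cons)
  finally have 1: "?i * ((- 1) ^ length l * (?c * (?W * ?t))) =
      (- 1) ^ length (i # l) * (?c * (?i * ?W * ?t))
      + e (Proper (f i)) (Proper c) * e_monomial (ann_word a (map (f(i := t)) (i # l)))" .
  have 2: "?i * (e (Proper (f b)) (Proper c) * e_monomial (ann_word a (map (f(b := t)) l))) =
      e (Proper (f b)) (Proper c) * e_monomial (ann_word a (map (f(b := t)) (i # l)))" if "b \<in> set l" for b
  proof -
    have "b \<noteq> i"
      using that i by auto
    moreover have "?i * e (Proper (f b)) (Proper c) = e (Proper (f b)) (Proper c) * ?i"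
      using ne by (simp add: proper_ann)
    ultimately show ?thesis
      by (simp add: mult.assoc[symmetric])
  qed
  have 3: "(\<Sum>b\<in>set l. ?i * (e (Proper (f b)) (Proper c) * e_monomial (ann_word a (map (f(b := t)) l)))) =
      (\<Sum>b\<in>set l. e (Proper (f b)) (Proper c) * e_monomial (ann_word a (map (f(b := t)) (i # l))))"
    by (rule sum.cong[OF refl 2])
  have "e_monomial (ann_word a (map f (i # l))) * (?c * ?t) = ?i * (?W * (?c * ?t))"
    by (simp add: mult.assoc)
  also have "\<dots> = (- 1) ^ length (i # l) * (?c * (?i * ?W * ?t))
      + (e (Proper (f i)) (Proper c) * e_monomial (ann_word a (map (f(i := t)) (i # l)))
      + (\<Sum>b\<in>set l. e (Proper (f b)) (Proper c) * e_monomial (ann_word a (map (f(b := t)) (i # l)))))"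
    by (simp only: IH distrib_left[of ?i] 1 sum_distrib_left 3 add.assoc)
  also have "?i * ?W = e_monomial (ann_word a (map f (i # l)))"
    by simp
  finally show ?case
    by (simp only: list.set sum.insert[OF finite_set i])
qed simp

text \<open>The decreasing order puts the letter at position \<open>c\<close> at the right end,
  directly before the letter \<open>c\<close> of \<open>column_word\<close>. The segment from
  \<open>c\<close> to \<open>k\<close> is what remains once the columns below \<open>c\<close> are
  contracted.\<close>

definition row_word :: "'m \<Rightarrow> (nat \<Rightarrow> 'n) \<Rightarrow> nat \<Rightarrow> nat \<Rightarrow> ('m, 'n) Ugl" where
  "row_word a f c k = e_monomial (ann_word a (map f (rev [c..<Suc k])))"

definition column_word :: "'m \<Rightarrow> (nat \<Rightarrow> 'n) \<Rightarrow> nat \<Rightarrow> nat \<Rightarrow> ('m, 'n) Ugl" where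
  "column_word a \<nu> c k = e_monomial (cre_word a (map \<nu> [c..<Suc k]))"

text \<open>Removing a column leaves a minor whose rows depend on the row just used, hence the row
  map \<rho>.\<close>

definition partial_cdet :: "(nat \<Rightarrow> nat \<Rightarrow> 'a::ring_1) \<Rightarrow> (nat \<Rightarrow> nat) \<Rightarrow> nat \<Rightarrow> nat \<Rightarrow> 'a" where
  "partial_cdet M \<rho> c k = (\<Sum>q | q permutes {c..k}. of_int (sign q) * prod_list (map (\<lambda>s. M (\<rho> (q s)) s) [c..<Suc k]))"

lemma partial_cdet_transpose:
  assumes "b \<in> {c..k}" "b \<noteq> c"
  shows "partial_cdet M (\<rho> \<circ> Transposition.transpose c b) c k = - partial_cdet M \<rho> c k"
proof -
  let ?f = "\<lambda>q. of_int (sign q) * prod_list (map (\<lambda>s. M (\<rho> (q s)) s) [c..<Suc k])"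
  have t: "Transposition.transpose c b permutes {c..k}"
    using assms(1) by (intro permutes_swap_id) auto
  have "partial_cdet M \<rho> c k = (\<Sum>q | q permutes {c..k}. ?f (Transposition.transpose c b \<circ> q))"
    unfolding partial_cdet_def by (rule setum_permutations_compose_left[OF t])
  also have "\<dots> = (\<Sum>q | q permutes {c..k}. - (of_int (sign q) * prod_list (map (\<lambda>s. M ((\<rho> \<circ> Transposition.transpose c b) (q s)) s) [c..<Suc k])))"
  proof (rule sum.cong[OF refl])
    fix q assume "q \<in> {q. q permutes {c..k}}"
    then have "permutation q"
      using permutation_permutes by blast
    then have "sign (Transposition.transpose c b \<circ> q) = - sign q"
      using assms(2) by (simp add: sign_compose sign_swap_id permutation_swap_id)
    then show "?f (Transposition.transpose c b \<circ> q) = - (of_int (sign q) * prod_list (map (\<lambda>s. M ((\<rho> \<circ> Transposition.transpose c b) (q s)) s) [c..<Suc k]))"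
      by (simp only: o_apply of_int_minus mult_minus_left)
  qed
  finally show ?thesis
    by (simp add: partial_cdet_def sum_negf)
qed

text \<open>Expansion along the first column: a permutation of \<open>{c..k}\<close> is uniquely a
  transposition of \<open>c\<close> and \<open>b\<close> composed after a permutation fixing
  \<open>c\<close>. The entry of column \<open>c\<close> is the leftmost factor, so it comes out on
  the left without any commutation.\<close>

lemma partial_cdet_expand:
  assumes "c \<le> k"
  shows "partial_cdet M \<rho> c k = M (\<rho> c) c * partial_cdet M \<rho> (Suc c) k
    - (\<Sum>b\<in>{Suc c..k}. M (\<rho> b) c * partial_cdet M (\<rho> \<circ> Transposition.transpose c b) (Suc c) k)"
proof -
  let ?f = "\<lambda>q. of_int (sign q) * prod_list (map (\<lambda>s. M (\<rho> (q s)) s) [c..<Suc k])"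
  have ins: "{c..k} = insert c {Suc c..k}"
    using assms by auto
  have upt: "[c..<Suc k] = c # [Suc c..<Suc k]"
    using assms by (simp add: upt_conv_Cons del: upt_Suc)
  have summand: "(\<Sum>q | q permutes {Suc c..k}. ?f (Transposition.transpose c b \<circ> q)) =
      (if b = c then 1 else - 1) * (M (\<rho> b) c * partial_cdet M (\<rho> \<circ> Transposition.transpose c b) (Suc c) k)" for b
  proof -
    have "?f (Transposition.transpose c b \<circ> q) = (if b = c then 1 else - 1) * (M (\<rho> b) c * (of_int (sign q) *
        prod_list (map (\<lambda>s. M ((\<rho> \<circ> Transposition.transpose c b) (q s)) s) [Suc c..<Suc k])))" if "q permutes {Suc c..k}" for q
    proof -
      have "permutation q"
        using that permutation_permutes by blast
      then have "sign (Transposition.transpose c b \<circ> q) = (if b = c then 1 else - 1) * sign q"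
        by (simp add: sign_compose sign_swap_id permutation_swap_id)
      moreover have "q c = c"
        using that by (auto simp: permutes_not_in)
      ultimately show ?thesis
        unfolding upt by (simp add: of_int_mult_left_commute[of "sign q"] mult.assoc del: upt_Suc)
    qed
    then show ?thesis
      unfolding partial_cdet_def sum_distrib_left by (intro sum.cong[OF refl]) simp
  qed
  have "partial_cdet M \<rho> c k = (\<Sum>b\<in>insert c {Suc c..k}. \<Sum>q | q permutes {Suc c..k}. ?f (Transposition.transpose c b \<circ> q))"
    unfolding partial_cdet_def ins by (rule sum_over_permutations_insert) auto
  also have "\<dots> = M (\<rho> c) c * partial_cdet M \<rho> (Suc c) k
      + (\<Sum>b\<in>{Suc c..k}. (if b = c then 1 else - 1) * (M (\<rho> b) c * partial_cdet M (\<rho> \<circ> Transposition.transpose c b) (Suc c) k))"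
    unfolding summand by simp
  also have "(\<Sum>b\<in>{Suc c..k}. (if b = c then 1 else - 1) * (M (\<rho> b) c * partial_cdet M (\<rho> \<circ> Transposition.transpose c b) (Suc c) k)) =
      - (\<Sum>b\<in>{Suc c..k}. M (\<rho> b) c * partial_cdet M (\<rho> \<circ> Transposition.transpose c b) (Suc c) k)"
    unfolding sum_negf[symmetric] by (rule sum.cong[OF refl]) auto
  finally show ?thesis
    by simp
qed

lemma row_word_transpose:
  assumes "b \<in> {c..k}" "b \<noteq> c"
  shows "row_word a (f \<circ> Transposition.transpose c b) c k = - row_word a f c k"
proof -
  have upt: "[c..<Suc k] = c # [Suc c..<b] @ b # [Suc b..<Suc k]"
  proof -
    have "[c..<Suc k] = [c..<b] @ [b..<Suc k]"
      using assms by (metis atLeastAtMost_iff le_SucI upt_add_eq_append le_Suc_ex)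
    moreover have "[c..<b] = c # [Suc c..<b]"
      using assms by (intro upt_conv_Cons) auto
    moreover have "[b..<Suc k] = b # [Suc b..<Suc k]"
      using assms by (intro upt_conv_Cons) auto
    ultimately show ?thesis
      by simp
  qed
  have same: "map (f \<circ> Transposition.transpose c b) (rev [Suc c..<b]) = map f (rev [Suc c..<b])"
    "map (f \<circ> Transposition.transpose c b) (rev [Suc b..<Suc k]) = map f (rev [Suc b..<Suc k])"
    using assms by (auto intro!: map_cong simp: Transposition.transpose_def)
  have word: "row_word a g c k = e_monomial (ann_word a (map g (rev [Suc b..<Suc k]))) *
      (e (Proper (g b)) (Virtual a) * e_monomial (ann_word a (map g (rev [Suc c..<b]))) * e (Proper (g c)) (Virtual a))" for g
    unfolding row_word_def upt by (simp add: word_append e_monomial_append mult.assoc del: upt_Suc)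
  show ?thesis
    unfolding word[of f] word[of "f \<circ> Transposition.transpose c b"] same
    using ann_swap[of "f b" a "map f (rev [Suc c..<b])" "f c"] by simp
qed

definition capelli_entry :: "(nat \<Rightarrow> 'n) \<Rightarrow> nat \<Rightarrow> nat \<Rightarrow> nat \<Rightarrow> ('m, 'n) Ugl" where
  "capelli_entry \<nu> k r s = proper_gen \<nu> r s + (if r = s then of_int (int k - int r) else 0)"

text \<open>The hypothesis on \<open>c\<close> lets the entries \<open>e\<^bsub>r,c\<^esub>\<close> produced by contracting \<open>e\<^bsub>\<alpha>,c\<^esub>\<close> move freely to
  the left. It costs nothing, because both sides of the final formula are antisymmetric
  in the rows.\<close>

lemma row_column_word_step:
  fixes \<nu> :: "nat \<Rightarrow> 'n" and a :: 'm
  assumes \<nu>: "inj_on \<nu> {1..k}" and c: "1 \<le> c" "c \<le> k" and \<rho>: "\<rho> ` {c..k} \<subseteq> {1..k}"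
    and c_notin: "c \<notin> \<rho> ` {Suc c..k}" and w: "avoids a w"
  shows "(row_word a (\<nu> \<circ> \<rho>) c k * column_word a \<nu> c k
     - (capelli_entry \<nu> k (\<rho> c) c * (row_word a (\<nu> \<circ> \<rho>) (Suc c) k * column_word a \<nu> (Suc c) k)
       - (\<Sum>b\<in>{Suc c..k}. capelli_entry \<nu> k (\<rho> b) c *
           (row_word a (\<nu> \<circ> (\<rho> \<circ> Transposition.transpose c b)) (Suc c) k * column_word a \<nu> (Suc c) k)))) * e_monomial w \<in> Irr"
proof -
  let ?A = "row_word a (\<nu> \<circ> \<rho>) c k" and ?A' = "row_word a (\<nu> \<circ> \<rho>) (Suc c) k"
  let ?B = "column_word a \<nu> c k" and ?B' = "column_word a \<nu> (Suc c) k"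
  let ?t = "e (Proper (\<nu> (\<rho> c))) (Virtual a)" and ?c = "e (Virtual a) (Proper (\<nu> c))"
  let ?g = "proper_gen \<nu> :: nat \<Rightarrow> nat \<Rightarrow> ('m, 'n) Ugl"
  let ?v = "e (Virtual a) (Virtual a)"
  let ?l = "rev [Suc c..<Suc k]"
  let ?S = "\<Sum>b\<in>{Suc c..k}. ?g (\<rho> b) c * row_word a (\<nu> \<circ> (\<rho> \<circ> Transposition.transpose c b)) (Suc c) k"
  have upt: "[c..<Suc k] = c # [Suc c..<Suc k]"
    using c by (simp add: upt_conv_Cons del: upt_Suc)
  have A: "?A = ?A' * ?t" and B: "?B = ?c * ?B'"
    unfolding row_word_def column_word_def upt by (simp_all add: word_append e_monomial_append del: upt_Suc)
  have \<nu>_eq: "\<nu> (\<rho> b) = \<nu> c \<longleftrightarrow> \<rho> b = c" if "b \<in> {c..k}" for b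
    using \<nu> \<rho> c that by (auto simp: inj_on_eq_iff image_subset_iff)
  have \<nu>c: "\<nu> c \<notin> (\<nu> \<circ> \<rho>) ` set ?l"
  proof
    assume "\<nu> c \<in> (\<nu> \<circ> \<rho>) ` set ?l"
    moreover have "set ?l = {Suc c..k}"
      by (simp add: atLeastLessThanSuc_atLeastAtMost del: upt_Suc)
    ultimately obtain b where "b \<in> {Suc c..k}" "\<nu> (\<rho> b) = \<nu> c"
      by force
    then show False
      using \<nu>_eq[of b] c_notin by auto
  qed
  have replace: "map ((\<nu> \<circ> \<rho>)(b := \<nu> (\<rho> c))) ?l = map (\<nu> \<circ> (\<rho> \<circ> Transposition.transpose c b)) ?l" if "b \<in> {Suc c..k}" for b
    using that by (intro map_cong[OF refl]) (auto simp: Transposition.transpose_def simp del: upt_Suc)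
  have contr: "?A' * (?c * ?t) = (- 1) ^ (k - c) * (?c * ?A) + ?S"
  proof -
    have "(\<Sum>b\<in>set ?l. e (Proper ((\<nu> \<circ> \<rho>) b)) (Proper (\<nu> c)) * e_monomial (ann_word a (map ((\<nu> \<circ> \<rho>)(b := \<nu> (\<rho> c))) ?l))) = ?S"
      by (rule sum.cong) (auto simp: proper_gen_def row_word_def replace simp del: upt_Suc)
    then show ?thesis
      using contraction[of ?l "\<nu> c" "\<nu> \<circ> \<rho>" a "\<nu> (\<rho> c)"] \<nu>c
      by (simp add: row_word_def[symmetric] A mult.assoc del: upt_Suc)
  qed
  have comm: "?A' * ?g (\<rho> c) c = ?g (\<rho> c) c * ?A'"
    using proper_ann_word_notin[of "\<nu> c" "map (\<nu> \<circ> \<rho>) ?l" "\<nu> (\<rho> c)" a] \<nu>c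
    by (simp add: proper_gen_def row_word_def del: upt_Suc)
  have len: "length [Suc c..<Suc k] = k - c"
    by (simp del: upt_Suc)
  \<comment> \<open>The virtual generator counts the \<open>k - c\<close> creators of
    \<open>?B'\<close>; this becomes the diagonal constant in column \<open>c\<close>.\<close>
  have vB: "?v * ?B' = ?B' * (?v + of_nat (k - c))"
    unfolding column_word_def using virtual_cre_word[of a "map \<nu> [Suc c..<Suc k]"] by (simp only: length_map len)
  let ?d = "\<lambda>x. if \<rho> c = c then x else 0"
  have "?t * ?c = - (?c * ?t) + ?g (\<rho> c) c + ?d ?v"
    using \<nu>_eq[of c] c by (auto simp: ann_cre proper_gen_def)
  then have "?A * ?B = ?A' * (- (?c * ?t) + ?g (\<rho> c) c + ?d ?v) * ?B'"
    unfolding A B by (metis mult.assoc)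
  also have "\<dots> = - (?A' * (?c * ?t)) * ?B' + ?A' * ?g (\<rho> c) c * ?B' + ?d (?A' * (?v * ?B'))"
    by (simp add: distrib_left distrib_right left_diff_distrib right_diff_distrib mult.assoc)
  also have "\<dots> = - ((- 1) ^ (k - c) * (?c * ?A)) * ?B' - ?S * ?B' + ?g (\<rho> c) c * ?A' * ?B'
      + ?d (?A' * ?B' * ?v + of_nat (k - c) * (?A' * ?B'))"
    unfolding contr comm vB by (simp add: distrib_left distrib_right left_diff_distrib mult.assoc mult_of_nat_commute)
  finally have AB: "?A * ?B = - ((- 1) ^ (k - c) * (?c * ?A)) * ?B' - ?S * ?B' + ?g (\<rho> c) c * ?A' * ?B'
      + ?d (?A' * ?B' * ?v + of_nat (k - c) * (?A' * ?B'))" .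
  have "capelli_entry \<nu> k (\<rho> b) c = ?g (\<rho> b) c" if "b \<in> {Suc c..k}" for b
    using c_notin that by (auto simp: capelli_entry_def)
  then have sum: "(\<Sum>b\<in>{Suc c..k}. capelli_entry \<nu> k (\<rho> b) c *
      (row_word a (\<nu> \<circ> (\<rho> \<circ> Transposition.transpose c b)) (Suc c) k * ?B')) = ?S * ?B'"
    by (simp add: sum_distrib_right mult.assoc)
  have entry: "capelli_entry \<nu> k (\<rho> c) c * (?A' * ?B') = ?g (\<rho> c) c * ?A' * ?B' + ?d (of_nat (k - c) * (?A' * ?B'))"
    using c by (simp add: capelli_entry_def distrib_right mult.assoc of_nat_diff)
  \<comment> \<open>Both remainders lie in \<open>Irr\<close>: in the first,
    \<open>k - c + 1\<close> annihilators meet only \<open>k - c\<close> creators; in the second,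
    the virtual generator acts on \<open>w\<close>, where its symbol is absent.\<close>
  have split: "(?A * ?B - (capelli_entry \<nu> k (\<rho> c) c * (?A' * ?B') - ?S * ?B')) * e_monomial w =
      - ((- 1) ^ (k - c) * ?c) * (?A * ?B' * e_monomial w) + ?d (?A' * ?B' * (?v * e_monomial w))"
    unfolding AB entry by (simp add: distrib_right left_diff_distrib mult.assoc)
  have "?A * ?B' * e_monomial w \<in> Irr"
    unfolding row_word_def column_word_def using c by (intro irregular_ann_cre w) (simp del: upt_Suc)
  moreover have "?d (?A' * ?B' * (?v * e_monomial w)) \<in> Irr"
    by (simp add: Irr_zero Irr_mult_left irregular_virtual[OF w])
  ultimately show ?thesis
    unfolding sum split by (rule Irr_add[OF Irr_mult_left])
qed

text \<open>Expansion along column \<open>c\<close> composes \<rho> with transpositions, so the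
  induction ranges over all injective row maps. The entries taken out stand on the left, where
  congruence modulo \<open>Irr\<close> is preserved.\<close>

lemma row_column_word_partial_cdet:
  fixes \<nu> :: "nat \<Rightarrow> 'n" and a :: 'm
  assumes \<nu>: "inj_on \<nu> {1..k}" and c: "1 \<le> c" "c \<le> Suc k" and \<rho>: "\<rho> ` {c..k} \<subseteq> {1..k}" "inj_on \<rho> {c..k}"
    and w: "avoids a w"
  shows "(row_word a (\<nu> \<circ> \<rho>) c k * column_word a \<nu> c k - partial_cdet (capelli_entry \<nu> k) \<rho> c k) * e_monomial w \<in> Irr"
  using c \<rho>
\<comment> \<open>The induction starts at \<open>c = Suc k\<close>, with empty words and the empty
  determinant \<open>1\<close>.\<close>
proof (induction "Suc k - c" arbitrary: c \<rho>)
  case 0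
  then have "[c..<Suc k] = []" "{c..k} = {}"
    by auto
  then show ?case
    by (simp add: row_word_def column_word_def partial_cdet_def Irr_zero)
next
  case (Suc n)
  let ?M = "capelli_entry \<nu> k :: nat \<Rightarrow> nat \<Rightarrow> ('m, 'n) Ugl"
  have ck: "c \<le> k"
    using Suc.hyps(2) by simp
  have tr: "Transposition.transpose c b permutes {c..k}" if "b \<in> {c..k}" for b
    using that ck by (intro permutes_swap_id) auto
  have comp: "(\<rho> \<circ> Transposition.transpose c b) ` {c..k} \<subseteq> {1..k}" "inj_on (\<rho> \<circ> Transposition.transpose c b) {c..k}"
    if "b \<in> {c..k}" "\<rho> ` {c..k} \<subseteq> {1..k}" "inj_on \<rho> {c..k}" for b and \<rho> :: "nat \<Rightarrow> nat"
  proof -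
    show "(\<rho> \<circ> Transposition.transpose c b) ` {c..k} \<subseteq> {1..k}"
      unfolding image_comp[symmetric] permutes_image[OF tr[OF that(1)]] by (rule that(2))
    show "inj_on (\<rho> \<circ> Transposition.transpose c b) {c..k}"
      using that(3) permutes_image[OF tr[OF that(1)]] permutes_inj_on[OF tr[OF that(1)]]
      by (intro comp_inj_on) auto
  qed
  have main: "(row_word a (\<nu> \<circ> \<rho>) c k * column_word a \<nu> c k - partial_cdet ?M \<rho> c k) * e_monomial w \<in> Irr"
    if \<rho>: "\<rho> ` {c..k} \<subseteq> {1..k}" "inj_on \<rho> {c..k}" and notin: "c \<notin> \<rho> ` {Suc c..k}" for \<rho> :: "nat \<Rightarrow> nat"
  proof -
    let ?X = "\<lambda>\<rho>. row_word a (\<nu> \<circ> \<rho>) (Suc c) k * column_word a \<nu> (Suc c) k"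
    let ?D = "\<lambda>\<rho>. partial_cdet ?M \<rho> (Suc c) k"
    let ?r = "\<lambda>b. \<rho> \<circ> Transposition.transpose c b"
    have IH: "(?X \<sigma> - ?D \<sigma>) * e_monomial w \<in> Irr" if "\<sigma> ` {c..k} \<subseteq> {1..k}" "inj_on \<sigma> {c..k}" for \<sigma>
    proof (rule Suc.hyps(1))
      have sub: "{Suc c..k} \<subseteq> {c..k}"
        by auto
      show "\<sigma> ` {Suc c..k} \<subseteq> {1..k}" "inj_on \<sigma> {Suc c..k}"
        using that sub by (blast, blast intro: inj_on_subset)
    qed (use Suc.hyps(2) Suc.prems ck in auto)
    have "(row_word a (\<nu> \<circ> \<rho>) c k * column_word a \<nu> c k - partial_cdet ?M \<rho> c k) * e_monomial w =
        (row_word a (\<nu> \<circ> \<rho>) c k * column_word a \<nu> c k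
          - (?M (\<rho> c) c * ?X \<rho> - (\<Sum>b\<in>{Suc c..k}. ?M (\<rho> b) c * ?X (?r b)))) * e_monomial w
        + (?M (\<rho> c) c * ((?X \<rho> - ?D \<rho>) * e_monomial w)
          - (\<Sum>b\<in>{Suc c..k}. ?M (\<rho> b) c * ((?X (?r b) - ?D (?r b)) * e_monomial w)))"
      unfolding partial_cdet_expand[OF ck]
      by (simp add: algebra_simps sum_distrib_left sum_distrib_right sum_subtractf)
    also have "\<dots> \<in> Irr"
    proof (intro Irr_add Irr_diff Irr_sum)
      show "(row_word a (\<nu> \<circ> \<rho>) c k * column_word a \<nu> c k
          - (?M (\<rho> c) c * ?X \<rho> - (\<Sum>b\<in>{Suc c..k}. ?M (\<rho> b) c * ?X (?r b)))) * e_monomial w \<in> Irr"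
        by (rule row_column_word_step[OF \<nu> Suc.prems(1) ck \<rho>(1) notin w])
      show "?M (\<rho> c) c * ((?X \<rho> - ?D \<rho>) * e_monomial w) \<in> Irr"
        by (rule Irr_mult_left[OF IH[OF \<rho>]])
      show "?M (\<rho> b) c * ((?X (?r b) - ?D (?r b)) * e_monomial w) \<in> Irr" if "b \<in> {Suc c..k}" for b
        by (rule Irr_mult_left, intro IH comp \<rho>) (use that in auto)
    qed
    finally show ?thesis .
  qed
  show ?case
  proof (cases "c \<in> \<rho> ` {Suc c..k}")
    case False
    then show ?thesis
      using main Suc.prems by blast
  next
    case True
    then obtain b where "b \<in> {Suc c..k}" "\<rho> b = c"
      by (metis imageE)
    then have b: "b \<in> {c..k}" "b \<noteq> c" "\<rho> b = c"
      by auto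
    let ?\<rho> = "\<rho> \<circ> Transposition.transpose c b"
    have inj: "inj_on ?\<rho> {c..k}" and img: "?\<rho> ` {c..k} \<subseteq> {1..k}"
      using comp[OF b(1) Suc.prems(3,4)] by simp_all
    have "?\<rho> c = c"
      using b by simp
    have "c \<notin> ?\<rho> ` {Suc c..k}"
    proof (intro notI)
      assume "c \<in> ?\<rho> ` {Suc c..k}"
      then obtain r where "r \<in> {Suc c..k}" "?\<rho> r = ?\<rho> c"
        using \<open>?\<rho> c = c\<close> by force
      with inj_onD[OF inj, of r c] ck show False
        by simp
    qed
    then have "(row_word a (\<nu> \<circ> ?\<rho>) c k * column_word a \<nu> c k - partial_cdet ?M ?\<rho> c k) * e_monomial w \<in> Irr"
      by (intro main img inj)
    then have "(- (row_word a (\<nu> \<circ> \<rho>) c k * column_word a \<nu> c k) + partial_cdet ?M \<rho> c k) * e_monomial w \<in> Irr"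
      using row_word_transpose[OF b(1,2), of a "\<nu> \<circ> \<rho>"] partial_cdet_transpose[OF b(1,2), of ?M \<rho>]
      by (simp only: o_assoc mult_minus_left diff_minus_eq_add)
    then show ?thesis
      using Irr_uminus by (fastforce simp: algebra_simps)
  qed
qed

lemma row_column_word_capelli:
  fixes \<nu> :: "nat \<Rightarrow> 'n" and a :: 'm
  assumes "inj_on \<nu> {1..k}" "avoids a w"
  shows "(e_monomial (ann_word a (map \<nu> (rev [1..<Suc k]))) * e_monomial (cre_word a (map \<nu> [1..<Suc k]))
    - shifted_cdet \<nu> k 0) * e_monomial w \<in> Irr"
proof -
  have "partial_cdet (capelli_entry \<nu> k) id 1 k = (shifted_cdet \<nu> k 0 :: ('m, 'n) Ugl)"
    by (simp only: partial_cdet_def shifted_cdet_def cdet_def capelli_entry_def id_apply diff_0_right)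
  with row_column_word_partial_cdet[OF assms(1), of 1 id a w] assms(2) show ?thesis
    by (simp add: row_word_def column_word_def del: upt_Suc)
qed

section \<open>Closure properties of subalgebras\<close>

lemma subalgebra_uminus: "x \<in> subalgebra X \<Longrightarrow> - x \<in> subalgebra X"
  using subalgebra.scale[of x X "- 1"] by simp

lemma subalgebra_zero: "0 \<in> subalgebra X"
  using subalgebra.add[OF subalgebra.one subalgebra_uminus[OF subalgebra.one]] by simp

lemma subalgebra_diff: "x \<in> subalgebra X \<Longrightarrow> y \<in> subalgebra X \<Longrightarrow> x - y \<in> subalgebra X"
  using subalgebra.add[of x X "- y"] subalgebra_uminus[of y X] by simp

lemma subalgebra_sum: "(\<And>i. i \<in> A \<Longrightarrow> f i \<in> subalgebra X) \<Longrightarrow> sum f A \<in> subalgebra X"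
  by (induction A rule: infinite_finite_induct) (auto intro: subalgebra_zero subalgebra.add)

lemma subalgebra_prod_list: "(\<And>x. x \<in> set l \<Longrightarrow> x \<in> subalgebra X) \<Longrightarrow> prod_list l \<in> subalgebra X"
  by (induction l) (auto intro: subalgebra.one subalgebra.mult)

lemma subalgebra_of_nat: "of_nat n \<in> subalgebra X"
  by (induction n) (auto intro: subalgebra_zero subalgebra.one subalgebra.add)

lemma subalgebra_of_int: "of_int m \<in> subalgebra X"
  by (cases m) (auto intro: subalgebra_of_nat subalgebra_uminus simp del: of_nat_Suc)

lemma subalgebra_mono:
  assumes "x \<in> subalgebra X" "X \<subseteq> Y"
  shows "x \<in> subalgebra Y"
  using assms by induction (auto intro: subalgebra.intros)

lemma subalgebra_commute:
  assumes "x \<in> subalgebra X" "\<And>y. y \<in> X \<Longrightarrow> z * y = y * z"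
  shows "z * x = x * z"
  using assms(1)
proof induction
  case (mult x y)
  then show ?case
    by (metis mult.assoc)
next
  case (scale x c)
  then show ?case
    by (simp add: cscale_mult_left cscale_mult_right)
qed (simp_all add: assms(2) distrib_left distrib_right)

lemma permutes_atLeastAtMost_upt:
  assumes "\<sigma> permutes {1..k}" "s \<in> set [1..<Suc k]"
  shows "s \<in> {1..k}" "\<sigma> s \<in> {1..k}"
proof -
  show "s \<in> {1..k}"
    using assms(2) by (simp add: less_Suc_eq_le del: upt_Suc)
  then show "\<sigma> s \<in> {1..k}"
    using permutes_in_image[OF assms(1)] by blast
qed

lemma cdet_subalgebra:
  assumes "\<And>r s. r \<in> {1..k} \<Longrightarrow> s \<in> {1..k} \<Longrightarrow> M r s \<in> subalgebra X"
  shows "cdet k M \<in> subalgebra X"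
  unfolding cdet_def
proof (intro subalgebra_sum subalgebra.mult subalgebra_of_int subalgebra_prod_list)
  fix \<sigma> x
  assume "\<sigma> \<in> {\<sigma>. \<sigma> permutes {1..k}}" "x \<in> set (map (\<lambda>s. M (\<sigma> s) s) [1..<Suc k])"
  then obtain s where "\<sigma> permutes {1..k}" "s \<in> set [1..<Suc k]" "x = M (\<sigma> s) s"
    by (auto simp del: upt_Suc)
  with assms permutes_atLeastAtMost_upt[of \<sigma> k s] show "x \<in> subalgebra X"
    by simp
qed

lemma proper_gen_U_gl: "r \<in> {1..k} \<Longrightarrow> s \<in> {1..k} \<Longrightarrow> proper_gen \<nu> r s \<in> U_gl \<nu> k"
  unfolding U_gl_def proper_gen_def by (rule subalgebra.gen) blast

lemma shifted_cdet_U_gl: "shifted_cdet \<nu> k q \<in> U_gl \<nu> k"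
  unfolding shifted_cdet_def U_gl_def
proof (intro cdet_subalgebra subalgebra.add)
  fix r s assume "r \<in> {1..k}" "s \<in> {1..k}"
  then show "proper_gen \<nu> r s \<in> subalgebra {e (Proper (\<nu> i)) (Proper (\<nu> j)) |i j. i \<in> {1..k} \<and> j \<in> {1..k}}"
    by (rule proper_gen_U_gl[unfolded U_gl_def])
  show "(if r = s then of_int (int k - int r - q) else 0) \<in> subalgebra {e (Proper (\<nu> i)) (Proper (\<nu> j)) |i j. i \<in> {1..k} \<and> j \<in> {1..k}}"
    using subalgebra_of_int subalgebra_zero by (cases "r = s") (simp_all only: if_True if_False simp_thms)
qed

lemma U_gl_mono: "x \<in> U_gl \<nu> k \<Longrightarrow> k \<le> n \<Longrightarrow> x \<in> U_gl \<nu> n"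
  unfolding U_gl_def by (erule subalgebra_mono) force

lemma U_gl_subset_U_proper: "x \<in> U_gl \<nu> k \<Longrightarrow> x \<in> U_proper"
  unfolding U_gl_def U_proper_def by (erule subalgebra_mono) blast

section \<open>Centrality\<close>

lemma avoids_Nil [simp]: "avoids a []"
  by (simp add: avoids_def)

lemma avoids_proper [simp]: "avoids a [(Proper s, Proper t)]"
  by (simp add: avoids_def)

text \<open>The diagonal corrections of a proper generator against the annihilating and the creating
  word are opposite, so it commutes with their product. This product is compared with
  \<open>D\<close> twice, with the empty word and with the generator itself on the right, because
  \<open>Irr\<close> absorbs factors on the left only. The commutator then lies in both U(gl(n)) and
  \<open>Irr\<close>.\<close>

lemma capelli_determinant_commute:
  fixes \<nu> :: "nat \<Rightarrow> 'n::finite" and D :: "('m::finite, 'n) Ugl"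
  assumes \<nu>: "inj_on \<nu> {1..k}" and i: "i \<in> {1..k}" and j: "j \<in> {1..k}"
  defines "D \<equiv> shifted_cdet \<nu> k 0"
  shows "D * proper_gen \<nu> i j = proper_gen \<nu> i j * D"
proof -
  fix a :: 'm
  let ?l = "map \<nu> [1..<Suc k]"
  let ?A = "e_monomial (ann_word a (map \<nu> (rev [1..<Suc k])))" and ?B = "e_monomial (cre_word a ?l)"
  let ?g = "proper_gen \<nu> i j :: ('m, 'n) Ugl"
  let ?\<delta> = "if \<nu> i = \<nu> j then 1 else 0 :: ('m, 'n) Ugl"
  have dist: "distinct ?l" "distinct (map \<nu> (rev [1..<Suc k]))"
    using \<nu> by (simp_all add: distinct_map atLeastLessThanSuc_atLeastAtMost del: upt_Suc)
  have mem: "\<nu> i \<in> set ?l" "\<nu> j \<in> set ?l" "\<nu> i \<in> set (map \<nu> (rev [1..<Suc k]))" "\<nu> j \<in> set (map \<nu> (rev [1..<Suc k]))"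
    using i j by (auto simp del: upt_Suc)
  have "?g * (?A * ?B) = ?A * ((?g + ?\<delta>) * ?B)"
    using proper_ann_word_full[OF dist(2) mem(3,4), of a]
    by (simp add: proper_gen_def mult.assoc[symmetric] del: upt_Suc)
  also have "(?g + ?\<delta>) * ?B = ?B * ?g"
    using proper_cre_word_full[OF dist(1) mem(1,2), of a]
    by (cases "\<nu> i = \<nu> j") (simp_all add: proper_gen_def algebra_simps del: upt_Suc)
  finally have AB: "?g * (?A * ?B) = ?A * ?B * ?g"
    by (simp add: mult.assoc)
  have 1: "(?A * ?B - D) * 1 \<in> Irr"
    unfolding D_def using row_column_word_capelli[OF \<nu>, of a "[]"] by (simp del: upt_Suc)
  have 2: "(?A * ?B - D) * ?g \<in> Irr"
    unfolding D_def using row_column_word_capelli[OF \<nu>, of a "[(Proper (\<nu> i), Proper (\<nu> j))]"]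
    by (simp add: proper_gen_def del: upt_Suc)
  have commutator: "D * g - g * D = g * ((X - D) * 1) - (X - D) * g" if "g * X = X * g" for g X
    by (simp add: that right_diff_distrib left_diff_distrib)
  have "D * ?g - ?g * D = ?g * ((?A * ?B - D) * 1) - (?A * ?B - D) * ?g"
    by (rule commutator[OF AB])
  also have "\<dots> \<in> Irr"
    by (rule Irr_diff[OF Irr_mult_left[OF 1] 2])
  finally have "D * ?g - ?g * D \<in> Irr" .
  moreover have "D * ?g - ?g * D \<in> U_gl \<nu> k"
    using shifted_cdet_U_gl[of \<nu> k 0] proper_gen_U_gl[OF i j, of \<nu>]
    unfolding D_def U_gl_def by (intro subalgebra_diff subalgebra.mult)
  ultimately have "D * ?g - ?g * D = 0"
    using U_proper_Int_Irr U_gl_subset_U_proper by blast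
  then show ?thesis
    by simp
qed

text \<open>The supertrace is a character of \<open>gl(m|n)\<close>, so shifting the generators by its multiples
  is an endomorphism of the enveloping algebra.\<close>

definition shift_gen :: "int \<Rightarrow> ('m, 'n) symbol \<Rightarrow> ('m, 'n) symbol \<Rightarrow> ('m, 'n) Ugl" where
  "shift_gen q a b = e a b + (if a = b then (if even (parity a) then of_int q else - of_int q) else 0)"

lemma ugl_family_shift: "ugl_family (\<lambda>z. cscale z 1) (shift_gen q)"
proof
  fix z z' and a b c d :: "('m, 'n) symbol"
  show "cscale (z + z') 1 = cscale z 1 + (cscale z' 1 :: ('m, 'n) Ugl)"
    by (rule cscale_add_scalar)
  show "cscale (z * z') 1 = cscale z 1 * (cscale z' 1 :: ('m, 'n) Ugl)"
    by (simp add: cscale_mult_left cscale_cscale)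
  show "cscale 1 1 = (1 :: ('m, 'n) Ugl)"
    by simp
  show "cscale z 1 * shift_gen q a b = shift_gen q a b * cscale z 1"
    by (rule cscale_one_commute)
  let ?s = "if odd (parity a + parity b) \<and> odd (parity c + parity d) then - 1 else 1 :: ('m, 'n) Ugl"
  let ?x = "\<lambda>a. if even (parity a) then of_int q else - of_int q :: ('m, 'n) Ugl"
  have s: "cscale (super_sign (a, b) (c, d)) y = ?s * y" for y
    by (simp add: super_sign_cases)
  have central: "?x a * y = y * ?x a" for a y
    by (simp add: mult_of_int_commute)
  have comm: "shift_gen q a b * shift_gen q c d - ?s * (shift_gen q c d * shift_gen q a b) =
      e a b * e c d - ?s * (e c d * e a b)"
    by (cases "a = b"; cases "c = d") (simp_all add: shift_gen_def distrib_left distrib_right mult_of_int_commute)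
  have par: "parity x = 0 \<or> parity x = 1" for x :: "('m, 'n) symbol"
    by (cases x) simp_all
  \<comment> \<open>For equal parities the sign is \<open>1\<close> and the constants agree; for
    different parities both the sign and the constant change. This is why even and odd symbols are
    shifted in opposite directions.\<close>
  have diag: "(if b = c then (if a = d then ?x a else 0) else 0) = ?s * (if a = d then (if c = b then ?x c else 0) else 0)"
    using par[of a] par[of b] by auto
  have "(if b = c then shift_gen q a d else 0) - ?s * (if a = d then shift_gen q c b else 0) =
      (if b = c then e a d else 0) - ?s * (if a = d then e c b else 0)
      + ((if b = c then (if a = d then ?x a else 0) else 0) - ?s * (if a = d then (if c = b then ?x c else 0) else 0))"
    by (cases "b = c"; cases "a = d") (simp_all add: shift_gen_def distrib_left algebra_simps)
  then have rhs: "(if b = c then shift_gen q a d else 0) - ?s * (if a = d then shift_gen q c b else 0) =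
      (if b = c then e a d else 0) - ?s * (if a = d then e c b else 0)"
    using diag by simp
  have "e a b * e c d - ?s * (e c d * e a b) = (if b = c then e a d else 0) - ?s * (if a = d then e c b else 0)"
    using e_superbracket[of a b c d] by (simp only: s)
  then have "shift_gen q a b * shift_gen q c d - ?s * (shift_gen q c d * shift_gen q a b) =
      (if b = c then shift_gen q a d else 0) - ?s * (if a = d then shift_gen q c b else 0)"
    by (simp only: comm rhs)
  then show "shift_gen q a b * shift_gen q c d - cscale (super_sign (a, b) (c, d)) 1 * (shift_gen q c d * shift_gen q a b) =
       (if b = c then shift_gen q a d else 0) - cscale (super_sign (a, b) (c, d)) 1 * (if a = d then shift_gen q c b else 0)"
    by (simp only: s mult_1_right)
qed

lemma (in ugl_family) val_uminus: "val (- x) = - val x"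
  using val_diff[of 0 x] by (simp add: val_zero)

lemma (in ugl_family) val_of_int: "val (of_int m) = of_int m"
proof -
  have nat: "val (of_nat n) = of_nat n" for n
    by (induction n) (simp_all add: val_zero val_one val_add)
  show ?thesis
    by (cases m) (simp_all add: nat val_uminus del: of_nat_Suc)
qed

lemma (in ugl_family) val_cdet: "val (cdet k M) = cdet k (\<lambda>r s. val (M r s))"
proof -
  have sum: "val (sum f A) = (\<Sum>i\<in>A. val (f i))" for f :: "(nat \<Rightarrow> nat) \<Rightarrow> ('m, 'n) Ugl" and A
    by (induction A rule: infinite_finite_induct) (simp_all add: val_zero val_add)
  have prod_list: "val (prod_list (map g l)) = prod_list (map (\<lambda>s. val (g s)) l)" for g :: "nat \<Rightarrow> ('m, 'n) Ugl" and l
    by (induction l) (simp_all add: val_one val_mult)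
  show ?thesis
    unfolding cdet_def by (simp only: sum val_mult val_of_int prod_list)
qed

lemma shifted_cdet_commute:
  fixes \<nu> :: "nat \<Rightarrow> 'n::finite" and q :: int and D :: "('m::finite, 'n) Ugl"
  assumes \<nu>: "inj_on \<nu> {1..k}" and i: "i \<in> {1..k}" and j: "j \<in> {1..k}"
  defines "D \<equiv> shifted_cdet \<nu> k q"
  shows "D * proper_gen \<nu> i j = proper_gen \<nu> i j * D"
proof -
  interpret shift: ugl_family "\<lambda>z. cscale z 1" "shift_gen q :: ('m, 'n) symbol \<Rightarrow> ('m, 'n) symbol \<Rightarrow> ('m, 'n) Ugl"
    by (rule ugl_family_shift)
  \<comment> \<open>Proper symbols are odd, so their diagonal generators are shifted by minus
    \<open>q\<close>, as on the diagonal of \<open>D\<close>.\<close>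
  have gen: "shift.val (proper_gen \<nu> r s) = proper_gen \<nu> r s - (if r = s then of_int q else 0)"
    if "r \<in> {1..k}" "s \<in> {1..k}" for r s
    using inj_on_eq_iff[OF \<nu> that] by (simp add: proper_gen_def shift.val_e shift_gen_def)
  have "shift.val (shifted_cdet \<nu> k 0) = cdet k (\<lambda>r s. shift.val (proper_gen \<nu> r s + (if r = s then of_int (int k - int r - 0) else 0)))"
    unfolding shifted_cdet_def by (rule shift.val_cdet)
  also have "\<dots> = D"
    unfolding D_def shifted_cdet_def cdet_eq_set_cdet
  proof (rule set_cdet_cong)
    fix r s assume rs: "r \<in> {1..k}" "s \<in> {1..k}"
    have "shift.val (proper_gen \<nu> r s + (if r = s then of_int (int k - int r - 0) else 0)) =
        shift.val (proper_gen \<nu> r s) + (if r = s then of_int (int k - int r) else 0)"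
      by (cases "r = s") (simp_all only: shift.val_add shift.val_of_int shift.val_zero if_True if_False simp_thms diff_0_right)
    then show "shift.val (proper_gen \<nu> r s + (if r = s then of_int (int k - int r - 0) else 0)) =
        proper_gen \<nu> r s + (if r = s then of_int (int k - int r - q) else 0)"
      unfolding gen[OF rs] by (cases "r = s") simp_all
  qed simp
  finally have D: "shift.val (shifted_cdet \<nu> k 0) = D" .
  have "D * shift.val (proper_gen \<nu> i j) = shift.val (proper_gen \<nu> i j) * D"
    unfolding D[symmetric] shift.val_mult[symmetric] capelli_determinant_commute[OF \<nu> i j] ..
  then show ?thesis
    unfolding gen[OF i j] by (cases "i = j") (simp_all add: algebra_simps mult_of_int_commute)
qed

lemma capelli_C_center:
  fixes \<nu> :: "nat \<Rightarrow> 'n::finite"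
  assumes "inj_on \<nu> {1..k}"
  shows "(capelli_C \<nu> k q :: ('m::finite, 'n) Ugl) \<in> center (U_gl \<nu> k)"
proof -
  have "capelli_C \<nu> k q * x = x * capelli_C \<nu> k q" if "x \<in> U_gl \<nu> k" for x :: "('m, 'n) Ugl"
    using that unfolding U_gl_def capelli_C_eq_shifted_cdet
    by (rule subalgebra_commute) (use shifted_cdet_commute[OF assms] in \<open>auto simp: proper_gen_def\<close>)
  then show ?thesis
    by (simp add: center_def capelli_C_eq_shifted_cdet shifted_cdet_U_gl)
qed

section \<open>The Capelli-Deruyts bitableau\<close>

lemma prod_list_intertwine:
  fixes z :: "'a::ring_1"
  assumes "\<And>x. x \<in> set l \<Longrightarrow> z * f x = g x * z"
  shows "z * prod_list (map f l) = prod_list (map g l) * z"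
  using assms
proof (induction l)
  case (Cons x l)
  have "z * prod_list (map f (x # l)) = g x * (z * prod_list (map f l))"
    using Cons.prems by (simp add: mult.assoc[symmetric])
  then show ?case
    using Cons by (simp add: mult.assoc)
qed simp

lemma cdet_intertwine:
  assumes "\<And>r s. r \<in> {1..k} \<Longrightarrow> s \<in> {1..k} \<Longrightarrow> z * M r s = M' r s * z"
  shows "z * cdet k M = cdet k M' * z"
proof -
  have "z * (of_int (sign \<sigma>) * prod_list (map (\<lambda>s. M (\<sigma> s) s) [1..<Suc k])) =
      of_int (sign \<sigma>) * prod_list (map (\<lambda>s. M' (\<sigma> s) s) [1..<Suc k]) * z" if "\<sigma> permutes {1..k}" for \<sigma>
  proof -
    have "z * prod_list (map (\<lambda>s. M (\<sigma> s) s) [1..<Suc k]) = prod_list (map (\<lambda>s. M' (\<sigma> s) s) [1..<Suc k]) * z"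
      by (intro prod_list_intertwine assms) (use permutes_atLeastAtMost_upt[OF that] in blast)+
    then show ?thesis
      by (simp only: of_int_mult_left_commute[symmetric] mult.assoc)
  qed
  then show ?thesis
    unfolding cdet_def sum_distrib_left sum_distrib_right by (intro sum.cong[OF refl]) simp
qed

definition deruyts_rows :: "(nat \<Rightarrow> 'n) \<Rightarrow> (nat \<Rightarrow> 'm) \<Rightarrow> nat list \<Rightarrow> nat \<Rightarrow> ('m, 'n) Ugl" where
  "deruyts_rows \<nu> \<alpha> lam p = prod_list (map (\<lambda>i. e_monomial (ann_word (\<alpha> i) (map \<nu> (rev [1..<Suc (lam ! i)])))) [0..<p])"

definition deruyts_columns :: "(nat \<Rightarrow> 'n) \<Rightarrow> (nat \<Rightarrow> 'm) \<Rightarrow> nat list \<Rightarrow> nat \<Rightarrow> ('m, 'n) gl_index list" where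
  "deruyts_columns \<nu> \<alpha> lam p = concat (map (\<lambda>i. cre_word (\<alpha> i) (map \<nu> [1..<Suc (lam ! i)])) [0..<p])"

text \<open>All of \<open>1, ..., k\<close> occur in each of the \<open>p\<close> rows, so a
  diagonal generator gains one for each row it crosses to the right. Read backwards, the diagonal of
  the determinant drops by \<open>p\<close> when its entries move to the left.\<close>

lemma deruyts_rows_shifted_cdet:
  assumes \<nu>: "inj_on \<nu> {1..n}" and lam: "\<And>i. i < p \<Longrightarrow> k \<le> lam ! i \<and> lam ! i \<le> n"
  shows "deruyts_rows \<nu> \<alpha> lam p * shifted_cdet \<nu> k 0 = shifted_cdet \<nu> k (int p) * deruyts_rows \<nu> \<alpha> lam p"
proof -
  have gen: "proper_gen \<nu> r s * deruyts_rows \<nu> \<alpha> lam p =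
      deruyts_rows \<nu> \<alpha> lam p * (proper_gen \<nu> r s + (if r = s then of_nat p else 0))"
    if "p \<le> p'" "r \<in> {1..k}" "s \<in> {1..k}" "\<And>i. i < p' \<Longrightarrow> k \<le> lam ! i \<and> lam ! i \<le> n" for r s p p'
    using that(1)
  proof (induction p)
    case 0
    then show ?case
      by (simp add: deruyts_rows_def)
  next
    case (Suc p)
    let ?l = "map \<nu> (rev [1..<Suc (lam ! p)])"
    have lam_p: "k \<le> lam ! p" "lam ! p \<le> n"
      using that(4)[of p] Suc.prems by auto
    have "{1..lam ! p} \<subseteq> {1..n}"
      using lam_p by auto
    then have "distinct ?l"
      using inj_on_subset[OF \<nu>] by (simp add: distinct_map atLeastLessThanSuc_atLeastAtMost del: upt_Suc)
    moreover have "\<nu> r \<in> set ?l" "\<nu> s \<in> set ?l"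
      using that(2,3) lam_p by (auto simp del: upt_Suc)
    moreover have "\<nu> r = \<nu> s \<longleftrightarrow> r = s"
      using that(2,3) lam_p by (intro inj_on_eq_iff[OF \<nu>]) auto
    ultimately have step: "proper_gen \<nu> r s * e_monomial (ann_word (\<alpha> p) ?l) =
        e_monomial (ann_word (\<alpha> p) ?l) * (proper_gen \<nu> r s + (if r = s then 1 else 0))"
      using proper_ann_word_full[of ?l "\<nu> r" "\<nu> s" "\<alpha> p"] by (simp only: proper_gen_def)
    have rows: "deruyts_rows \<nu> \<alpha> lam (Suc p) = deruyts_rows \<nu> \<alpha> lam p * e_monomial (ann_word (\<alpha> p) ?l)"
      by (simp add: deruyts_rows_def del: upt_Suc) (simp add: upt_Suc)
    have IH: "proper_gen \<nu> r s * deruyts_rows \<nu> \<alpha> lam p =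
      deruyts_rows \<nu> \<alpha> lam p * (proper_gen \<nu> r s + (if r = s then of_nat p else 0))"
      using Suc by simp
    have "proper_gen \<nu> r s * deruyts_rows \<nu> \<alpha> lam (Suc p) =
        deruyts_rows \<nu> \<alpha> lam p * ((proper_gen \<nu> r s + (if r = s then of_nat p else 0)) * e_monomial (ann_word (\<alpha> p) ?l))"
      unfolding rows by (simp only: IH mult.assoc[symmetric])
    also have "\<dots> = deruyts_rows \<nu> \<alpha> lam (Suc p) * (proper_gen \<nu> r s + (if r = s then of_nat (Suc p) else 0))"
      unfolding rows distrib_right step
      by (cases "r = s") (simp_all add: distrib_left mult.assoc mult_of_nat_commute del: upt_Suc)
    finally show ?case .
  qed
  show ?thesis
    unfolding shifted_cdet_def
  proof (rule cdet_intertwine)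
    fix r s assume "r \<in> {1..k}" "s \<in> {1..k}"
    then show "deruyts_rows \<nu> \<alpha> lam p * (proper_gen \<nu> r s + (if r = s then of_int (int k - int r - 0) else 0)) =
      (proper_gen \<nu> r s + (if r = s then of_int (int k - int r - int p) else 0)) * deruyts_rows \<nu> \<alpha> lam p"
      using gen[of p p r s, OF _ _ _ lam]
      by (cases "r = s") (simp_all add: algebra_simps mult_of_nat_commute)
  qed
qed

text \<open>The remainder of row \<open>p\<close> has the earlier creators on its right, which avoid
  \<open>\<alpha> p\<close>, and is multiplied by \<open>?Q\<close> on the left only. Once the
  determinant has crossed \<open>?Q\<close>, the induction hypothesis too is multiplied on the left
  only, by \<open>?h'\<close>; this puts the factors in decreasing order of the rows.\<close>

lemma deruyts_Irr:
  fixes \<nu> :: "nat \<Rightarrow> 'n" and \<alpha> :: "nat \<Rightarrow> 'm"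
  assumes \<nu>: "inj_on \<nu> {1..n}" and \<alpha>: "inj_on \<alpha> {..<length lam}"
    and sorted: "sorted_wrt (\<ge>) lam" and le: "\<And>i. i < length lam \<Longrightarrow> lam ! i \<le> n" and p: "p \<le> length lam"
  shows "deruyts_rows \<nu> \<alpha> lam p * e_monomial (deruyts_columns \<nu> \<alpha> lam p)
    - (- 1) ^ (\<Sum>j<p. \<Sum>i<j. lam ! i * lam ! j)
      * prod_list (rev (map (\<lambda>i. shifted_cdet \<nu> (lam ! i) (int i)) [0..<p])) \<in> Irr"
  using p
proof (induction p)
  case 0
  then show ?case
    by (simp add: deruyts_rows_def deruyts_columns_def Irr_zero)
next
  case (Suc p)
  let ?k = "lam ! p" and ?Q = "deruyts_rows \<nu> \<alpha> lam p" and ?w = "deruyts_columns \<nu> \<alpha> lam p"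
  let ?A = "e_monomial (ann_word (\<alpha> p) (map \<nu> (rev [1..<Suc ?k])))"
  let ?b = "cre_word (\<alpha> p) (map \<nu> [1..<Suc ?k])"
  let ?R = "e_monomial ?w" and ?B = "e_monomial ?b"
  let ?h = "shifted_cdet \<nu> ?k 0 :: ('m, 'n) Ugl" and ?h' = "shifted_cdet \<nu> ?k (int p) :: ('m, 'n) Ugl"
  let ?N = "\<Sum>i<p. lam ! i"
  let ?s = "(- 1) ^ (\<Sum>j<p. \<Sum>i<j. lam ! i * lam ! j) :: ('m, 'n) Ugl"
  let ?F = "prod_list (rev (map (\<lambda>i. shifted_cdet \<nu> (lam ! i) (int i)) [0..<p])) :: ('m, 'n) Ugl"
  have rows: "deruyts_rows \<nu> \<alpha> lam (Suc p) = ?Q * ?A"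
    unfolding deruyts_rows_def upt_Suc_append[OF le0] by simp
  have columns: "deruyts_columns \<nu> \<alpha> lam (Suc p) = ?w @ ?b"
    unfolding deruyts_columns_def upt_Suc_append[OF le0] by simp
  have len_b: "length ?b = ?k"
    by simp
  have len_w: "length ?w = ?N"
    by (simp add: deruyts_columns_def length_concat o_def sum_list_sum_nth atLeast0LessThan del: upt_Suc)
  \<comment> \<open>Each of the \<open>?N\<close> earlier creators anticommutes with each of the
    \<open>?k\<close> new ones, which is the share of row \<open>p\<close> in the sign
    exponent.\<close>
  have swap: "?R * ?B = (- 1) ^ (?N * ?k) * (?B * ?R)"
  proof -
    let ?e = "\<lambda>(a, b). e a b :: ('m, 'n) Ugl"
    have "prod_list (map ?e ?w) * prod_list (map ?e ?b) =
        (- 1) ^ (length (map ?e ?w) * length (map ?e ?b)) * (prod_list (map ?e ?b) * prod_list (map ?e ?w))"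
      by (rule anticommute_prod_list_prod_list)
        (auto simp: deruyts_columns_def cre_word_def simp del: upt_Suc intro: cre_cre)
    then show ?thesis
      unfolding e_monomial_def length_map len_b len_w .
  qed
  have avoid: "avoids (\<alpha> p) ?w"
    using inj_onD[OF \<alpha>] Suc.prems by (fastforce simp: avoids_def deruyts_columns_def cre_word_def simp del: upt_Suc)
  have "{1..?k} \<subseteq> {1..n}"
    using le[of p] Suc.prems by auto
  then have virt: "(?A * ?B - ?h) * ?R \<in> Irr"
    by (intro row_column_word_capelli[OF inj_on_subset[OF \<nu>] avoid])
  have QH: "?Q * ?h = ?h' * ?Q"
    using sorted_wrt_nth_less[OF sorted] le Suc.prems by (intro deruyts_rows_shifted_cdet[OF \<nu>]) auto
  have IH: "?Q * ?R - ?s * ?F \<in> Irr"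
    using Suc by simp
  have sum: "(\<Sum>j<Suc p. \<Sum>i<j. lam ! i * lam ! j) = ?N * ?k + (\<Sum>j<p. \<Sum>i<j. lam ! i * lam ! j)"
    by (simp add: sum_distrib_right)
  have C: "prod_list (rev (map (\<lambda>i. shifted_cdet \<nu> (lam ! i) (int i)) [0..<Suc p])) = ?h' * ?F"
    by simp
  have sign: "(- 1 :: ('m, 'n) Ugl) ^ m = 1 \<or> (- 1 :: ('m, 'n) Ugl) ^ m = - 1" for m
    by (cases "even m") simp_all
  have swap_signs: "X * (t * Y) - t * s * (h' * F) = t * (X * Y - h' * (s * F))"
    if "t = 1 \<or> t = - 1" "s = 1 \<or> s = - 1" for X Y t s h' F :: "('m, 'n) Ugl"
    using that by auto
  have telescope: "Q * A * (B * R) - h' * (s * F) = Q * ((A * B - h) * R) + h' * (Q * R - s * F)"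
    if "Q * h = h' * Q" for Q A B R h h' s F :: "('m, 'n) Ugl"
  proof -
    have "Q * (h * R) = h' * (Q * R)"
      by (simp only: mult.assoc[symmetric] that)
    then show ?thesis
      by (simp add: right_diff_distrib left_diff_distrib mult.assoc)
  qed
  have "?Q * ?A * (?R * ?B) - (- 1) ^ (?N * ?k) * ?s * (?h' * ?F) =
      (- 1) ^ (?N * ?k) * (?Q * ((?A * ?B - ?h) * ?R) + ?h' * (?Q * ?R - ?s * ?F))"
    unfolding swap swap_signs[OF sign sign] telescope[OF QH] ..
  also have "\<dots> \<in> Irr"
    by (intro Irr_mult_left Irr_add virt IH)
  finally show ?case
    unfolding rows columns e_monomial_append sum C power_add .
qed

text \<open>The description operator needs uniqueness: two candidates differ by an element of both
  \<open>U_proper\<close> and \<open>Irr\<close>, hence by zero.\<close>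

lemma devirtualization_eqI:
  fixes u x :: "('m::finite, 'n::finite) Ugl"
  assumes "u \<in> U_proper" "x - u \<in> Irr"
  shows "devirtualization x = u"
  unfolding devirtualization_def
proof (rule the_equality)
  fix v assume v: "v \<in> U_proper \<and> x - v \<in> Irr"
  then have "v - u \<in> U_proper"
    using assms(1) unfolding U_proper_def by (blast intro: subalgebra_diff)
  moreover have "v - u = (x - u) - (x - v)"
    by simp
  then have "v - u \<in> Irr"
    using assms(2) v Irr_diff[of "x - u" "x - v"] by simp
  ultimately show "v = u"
    using U_proper_Int_Irr by fastforce
qed (use assms in auto)

theorem corollary8:
  fixes n :: nat
    and \<nu> :: "nat \<Rightarrow> 'n::finite"
    and \<alpha> :: "nat \<Rightarrow> 'm::finite"
    and lam :: "nat list"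
  assumes "n \<ge> 1"
    and "bij_betw \<nu> {1..n} UNIV"
    and "lam \<noteq> []"
    and "sorted_wrt (\<ge>) lam"
    and "\<forall>k\<in>set lam. k > 0"
    and "hd lam \<le> n"
    and "inj_on \<alpha> {..<length lam}"
  shows "(\<forall>i<length lam.
            (capelli_C \<nu> (lam ! i) (int i) :: ('m, 'n) Ugl) \<in> center (U_gl \<nu> (lam ! i)))
       \<and> (capelli_deruyts \<nu> \<alpha> lam :: ('m, 'n) Ugl) \<in> U_gl \<nu> n
       \<and> capelli_deruyts \<nu> \<alpha> lam =
           (-1) ^ (\<Sum>j<length lam. \<Sum>i<j. lam ! i * lam ! j)
           * prod_list (rev (map (\<lambda>i. capelli_C \<nu> (lam ! i) (int i)) [0..<length lam]))"
proof -
  let ?F = "(- 1) ^ (\<Sum>j<length lam. \<Sum>i<j. lam ! i * lam ! j)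
      * prod_list (rev (map (\<lambda>i. capelli_C \<nu> (lam ! i) (int i)) [0..<length lam])) :: ('m, 'n) Ugl"
  have \<nu>: "inj_on \<nu> {1..n}"
    using assms(2) by (rule bij_betw_imp_inj_on)
  have le: "lam ! i \<le> n" if "i < length lam" for i
  proof -
    have "lam ! i \<le> lam ! 0"
      using sorted_wrt_nth_less[OF assms(4), of 0 i] that by (cases "i = 0") auto
    with assms(3,6) show ?thesis
      by (simp add: hd_conv_nth)
  qed
  have center: "capelli_C \<nu> (lam ! i) (int i) \<in> center (U_gl \<nu> (lam ! i) :: ('m, 'n) Ugl set)" if "i < length lam" for i
  proof (rule capelli_C_center)
    show "inj_on \<nu> {1..lam ! i}"
      using le[OF that] by (intro inj_on_subset[OF \<nu>]) auto
  qed
  have F: "?F \<in> U_gl \<nu> n"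
  proof -
    have sign: "(- 1) ^ m \<in> U_gl \<nu> n" for m
      unfolding U_gl_def by (cases "even m") (auto intro: subalgebra.one subalgebra_uminus)
    have "capelli_C \<nu> (lam ! i) (int i) \<in> U_gl \<nu> n" if "i < length lam" for i
      unfolding capelli_C_eq_shifted_cdet using shifted_cdet_U_gl le[OF that] by (rule U_gl_mono)
    then have "prod_list (rev (map (\<lambda>i. capelli_C \<nu> (lam ! i) (int i)) [0..<length lam])) \<in> U_gl \<nu> n"
      unfolding U_gl_def by (intro subalgebra_prod_list) auto
    with sign show ?thesis
      unfolding U_gl_def by (rule subalgebra.mult)
  qed
  let ?X = "deruyts_rows \<nu> \<alpha> lam (length lam) * e_monomial (deruyts_columns \<nu> \<alpha> lam (length lam)) :: ('m, 'n) Ugl"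
  have rows: "deruyts_rows \<nu> \<alpha> lam (length lam) =
      prod_list (map (\<lambda>i. prod_list (map (\<lambda>s. e (Proper s) (Virtual (\<alpha> i))) (map (\<lambda>k. map \<nu> (rev [1..<Suc k])) lam ! i))) [0..<length lam])"
    unfolding deruyts_rows_def e_monomial_def ann_word_def
    by (intro arg_cong[of _ _ prod_list] map_cong[OF refl]) (simp add: o_def del: upt_Suc)
  have columns: "e_monomial (deruyts_columns \<nu> \<alpha> lam (length lam)) =
      prod_list (map (\<lambda>i. prod_list (map (\<lambda>t. e (Virtual (\<alpha> i)) (Proper t)) (map (\<lambda>k. map \<nu> [1..<Suc k]) lam ! i))) [0..<length lam])"
  proof -
    have "e_monomial (concat ws) = prod_list (map e_monomial ws)" for ws :: "('m, 'n) gl_index list list"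
      by (induction ws) (simp_all add: e_monomial_append)
    then have "e_monomial (deruyts_columns \<nu> \<alpha> lam (length lam)) =
        prod_list (map (\<lambda>i. e_monomial (cre_word (\<alpha> i) (map \<nu> [1..<Suc (lam ! i)])) :: ('m, 'n) Ugl) [0..<length lam])"
      by (simp add: deruyts_columns_def o_def del: upt_Suc)
    also have "\<dots> = prod_list (map (\<lambda>i. prod_list (map (\<lambda>t. e (Virtual (\<alpha> i)) (Proper t)) (map (\<lambda>k. map \<nu> [1..<Suc k]) lam ! i))) [0..<length lam])"
      unfolding e_monomial_def cre_word_def
      by (intro arg_cong[of _ _ prod_list] map_cong[OF refl]) (simp add: o_def del: upt_Suc)
    finally show ?thesis .
  qed
  have "capelli_deruyts \<nu> \<alpha> lam = devirtualization ?X"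
    unfolding capelli_deruyts_def capelli_bitableau_def length_map rows columns ..
  also have "\<dots> = ?F"
  proof (rule devirtualization_eqI)
    show "?F \<in> U_proper"
      by (rule U_gl_subset_U_proper[OF F])
    show "?X - ?F \<in> Irr"
      unfolding capelli_C_eq_shifted_cdet using deruyts_Irr[OF \<nu> assms(7,4) le, of "length lam"] by simp
  qed
  finally show ?thesis
    using center F by simp
qed

end
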